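(* The elementary embeddability relation on (indices of) computable graphs is a $\Sigma^1_1$ complete quasi-order with respect to computable reducibility: every $\Sigma^1_1$ quasi-order on $\omega$ is computably reducible to it. In particular, the elementary bi-embeddability relation on (indices of) computable graphs is a $\Sigma^1_1$ complete equivalence relation with respect to computable reducibility: every $\Sigma^1_1$ equivalence relation on $\omega$ is computably reducible to it.
   Context: Fix a computable enumeration $(\mathcal G_i)_{i\in\omega}$ of all partial computable graphs with universe $\omega$; a relation $R$ on graphs induces the relation $\{(i,j): \mathcal G_i\,R\,\mathcal G_j\}$ on $\omega$. A relation $R$ on $\omega$ is computably reducible to a relation $S$ on $\omega$ if there is a computable $f:\omega\to\omega$ with $i\,R\,j\iff f(i)\,S\,f(j)$ for all $i,j$. Elementary embeddability $\mathcal A\preccurlyeq\mathcal B$ means $\mathcal A$ elementarily embeds into $\mathcal B$; elementary bi-embeddability means $\mathcal A\preccurlyeq\mathcal B$ and $\mathcal B\preccurlyeq\mathcal A$. *)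

theory Defs
  imports Main "HOL-Library.Nat_Bijection"
begin

datatype recf = Z | S | Proj nat | Comp recf "recf list" | Prec recf recf | Mn recf

inductive eval :: "recf \<Rightarrow> nat list \<Rightarrow> nat \<Rightarrow> bool" where
  eval_Z: "eval Z xs 0"
| eval_S: "eval S (x # xs) (Suc x)"
| eval_Proj: "i < length xs \<Longrightarrow> eval (Proj i) xs (xs ! i)"
| eval_Comp: "list_all2 (\<lambda>g y. eval g xs y) gs ys \<Longrightarrow> eval f ys z \<Longrightarrow> eval (Comp f gs) xs z"
| eval_Prec0: "eval f xs z \<Longrightarrow> eval (Prec f g) (0 # xs) z"
| eval_PrecS: "eval (Prec f g) (n # xs) r \<Longrightarrow> eval g (r # n # xs) z \<Longrightarrow> eval (Prec f g) (Suc n # xs) z"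
| eval_Mn: "eval f (n # xs) 0 \<Longrightarrow> (\<forall>m<n. \<exists>k. eval f (m # xs) (Suc k)) \<Longrightarrow> eval (Mn f) xs n"
monos list_all2_mono

definition computable :: "(nat \<Rightarrow> nat) \<Rightarrow> bool" where
  "computable f \<longleftrightarrow> (\<exists>c. \<forall>n. eval c [n] (f n))"

definition computable_rel3 :: "(nat \<Rightarrow> nat \<Rightarrow> nat \<Rightarrow> bool) \<Rightarrow> bool" where
  "computable_rel3 P \<longleftrightarrow> (\<exists>c. \<forall>x y s. eval c [x, y, s] (if P x y s then 1 else 0))"

primrec enc :: "recf \<Rightarrow> nat" where
  "enc Z = prod_encode (0, 0)"
| "enc S = prod_encode (1, 0)"
| "enc (Proj i) = prod_encode (2, i)"
| "enc (Comp f gs) = prod_encode (3, prod_encode (enc f, list_encode (map enc gs)))"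
| "enc (Prec f g) = prod_encode (4, prod_encode (enc f, enc g))"
| "enc (Mn f) = prod_encode (5, enc f)"

text \<open>The i-th partial computable graph G_i has universe omega; distinct x, y are adjacent
  iff phi_i(x,y) and phi_i(y,x) both converge to 1, where phi_i is the partial recursive
  function with Goedel number i (no edges if i is not a Goedel number).\<close>
definition graphE :: "nat \<Rightarrow> nat \<Rightarrow> nat \<Rightarrow> bool" where
  "graphE i x y \<longleftrightarrow> x \<noteq> y \<and> (\<exists>c. enc c = i \<and> eval c [x, y] 1 \<and> eval c [y, x] 1)"

datatype fm = FEq nat nat | FRel nat nat | FNeg fm | FConj fm fm | FEx nat fm

primrec sat :: "(nat \<Rightarrow> nat \<Rightarrow> bool) \<Rightarrow> (nat \<Rightarrow> nat) \<Rightarrow> fm \<Rightarrow> bool" where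
  "sat E s (FEq u v) \<longleftrightarrow> s u = s v"
| "sat E s (FRel u v) \<longleftrightarrow> E (s u) (s v)"
| "sat E s (FNeg \<phi>) \<longleftrightarrow> \<not> sat E s \<phi>"
| "sat E s (FConj \<phi> \<psi>) \<longleftrightarrow> sat E s \<phi> \<and> sat E s \<psi>"
| "sat E s (FEx v \<phi>) \<longleftrightarrow> (\<exists>a. sat E (s(v := a)) \<phi>)"

definition elem_emb :: "(nat \<Rightarrow> nat \<Rightarrow> bool) \<Rightarrow> (nat \<Rightarrow> nat \<Rightarrow> bool) \<Rightarrow> (nat \<Rightarrow> nat) \<Rightarrow> bool" where
  "elem_emb E1 E2 h \<longleftrightarrow> (\<forall>\<phi> s. sat E1 s \<phi> \<longleftrightarrow> sat E2 (h \<circ> s) \<phi>)"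

definition elem_embeddable :: "(nat \<Rightarrow> nat \<Rightarrow> bool) \<Rightarrow> (nat \<Rightarrow> nat \<Rightarrow> bool) \<Rightarrow> bool" where
  "elem_embeddable E1 E2 \<longleftrightarrow> (\<exists>h. elem_emb E1 E2 h)"

definition EE :: "nat \<Rightarrow> nat \<Rightarrow> bool" where
  "EE i j \<longleftrightarrow> elem_embeddable (graphE i) (graphE j)"

definition EBE :: "nat \<Rightarrow> nat \<Rightarrow> bool" where
  "EBE i j \<longleftrightarrow> EE i j \<and> EE j i"

text \<open>R is Sigma-1-1: R x y iff some f : omega to omega has all its initial segments
  (coded by list_encode) satisfying a computable predicate (Kleene normal form).\<close>
definition sigma11 :: "(nat \<Rightarrow> nat \<Rightarrow> bool) \<Rightarrow> bool" where
  "sigma11 R \<longleftrightarrow> (\<exists>C. computable_rel3 C \<and>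
     (\<forall>x y. R x y \<longleftrightarrow> (\<exists>f :: nat \<Rightarrow> nat. \<forall>n. C x y (list_encode (map f [0..<n])))))"

definition comp_reducible :: "(nat \<Rightarrow> nat \<Rightarrow> bool) \<Rightarrow> (nat \<Rightarrow> nat \<Rightarrow> bool) \<Rightarrow> bool" where
  "comp_reducible R S' \<longleftrightarrow> (\<exists>f. computable f \<and> (\<forall>i j. R i j \<longleftrightarrow> S' (f i) (f j)))"

definition quasi_order :: "(nat \<Rightarrow> nat \<Rightarrow> bool) \<Rightarrow> bool" where
  "quasi_order R \<longleftrightarrow> reflp R \<and> transp R"

end

theory Submission
  imports Defs "HOL-Library.Infinite_Set"
begin

text \<open>
  Let \<open>R\<close> be a \<open>\<Sigma>\<^sup>1\<^sub>1\<close> quasi-order, \<open>R x y\<close> iff all initial segments of some \<open>f\<close> satisfy a decidable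
  \<open>K x y\<close>. To \<open>x\<close> we assign a hypergraph on \<open>\<nat>\<close>, split into levels \<open>{\<langle>i, v\<rangle> | v}\<close>: its hyperedges
  are certain finite lists with one vertex on each level \<open>0, \<dots>, n - 1\<close>, which dominate a chain of partial
  witnesses leading from \<open>z\<close> to \<open>x\<close>, where \<open>z\<close> is coded by the length \<open>n\<close>.
  A witness \<open>f\<close> for \<open>R x y\<close> prolongs these chains to \<open>y\<close>, so the injection \<open>\<langle>i, v\<rangle> \<mapsto> \<langle>i, v + f i + x + y\<rangle>\<close>
  preserves hyperedges. Conversely, an injection preserving hyperedges moves the vertices
  \<open>\<langle>i, 0\<rangle>\<close>, which span hyperedges of \<open>x\<close> because \<open>z = x\<close> needs no witness, to a branch that dominates
  chains from \<open>x\<close> to \<open>y\<close>; Koenig's lemma and the transitivity of \<open>R\<close> then give \<open>R x y\<close>.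

  The hypergraph becomes a graph by attaching to each list \<open>F\<close> of vertices infinitely many disjoint finite cliques
  of every size, and an infinite clique if \<open>F\<close> is a hyperedge. First-order logic does not
  see the difference between large finite and infinite cliques, so every injection of hypergraphs induces an
  elementary embedding (a pebble game), while an elementary embedding maps infinite
  cliques to infinite cliques and hence induces an injection of hypergraphs.

  That elementary embeddability is itself \<open>\<Sigma>\<^sup>1\<^sub>1\<close> holds because an oracle can code the embedding, certificates for
  the edges, and truth predicates of both graphs obeying Tarski's clauses.
\<close>

section \<open>Recursive functions of an environment\<close>

text \<open>For \<open>Mn\<close>, two different values would make the body both zero and positive
  at the smaller one; the other cases follow from the rules by induction.\<close>

lemma eval_det: "eval c xs y \<Longrightarrow> eval c xs z \<Longrightarrow> y = z"
proof (induction arbitrary: z rule: eval.induct)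
  case (eval_Comp xs gs ys f w)
  from eval_Comp.prems obtain ys' where ys': "list_all2 (\<lambda>g y. eval g xs y) gs ys'" "eval f ys' z"
    by (cases rule: eval.cases) auto
  have "ys = ys'"
    using eval_Comp.IH(1) ys'(1) by (auto simp: list_all2_conv_all_nth intro!: nth_equalityI)
  then show ?case using eval_Comp.IH(2) ys'(2) by simp
next
  case (eval_Mn f n xs)
  from eval_Mn.prems have z: "eval f (z # xs) 0" "\<forall>m<z. \<exists>k. eval f (m # xs) (Suc k)"
    by (cases rule: eval.cases; auto)+
  show ?case
  proof (cases n z rule: linorder_cases)
    case less
    then obtain k where "eval f (n # xs) (Suc k)" using z by auto
    then show ?thesis using eval_Mn.IH(1) by fastforce
  next
    case greater
    then show ?thesis using eval_Mn.IH(2) z(1) by fastforce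
  qed auto
next
  case (eval_PrecS f g n xs r z')
  from eval_PrecS.prems obtain r' where "eval (Prec f g) (n # xs) r'" "eval g (r' # n # xs) z"
    by (cases rule: eval.cases) auto
  then show ?case using eval_PrecS.IH by metis
next
  case (eval_Prec0 f xs w g)
  from eval_Prec0.prems have "eval f xs z" by (cases rule: eval.cases) auto
  then show ?case using eval_Prec0.IH by metis
qed (auto elim: eval.cases)

text \<open>Every index belongs to at most one program, so what \<open>graphE\<close> says about an
  index can be read off any program known to have it.\<close>

lemma enc_inj: "enc c = enc d \<Longrightarrow> c = d"
proof (induction c arbitrary: d)
  case (Comp f gs)
  from Comp.prems obtain g hs where d: "d = Comp g hs" "enc f = enc g" "map enc gs = map enc hs"
    by (cases d) (auto simp: list_encode_eq)
  have "gs = hs"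
    by (rule list.inj_map_strong[OF _ d(3)]) (use Comp.IH(2) in blast)
  then show ?case using Comp.IH(1) d by blast
next
  case Z then show ?case by (cases d) auto
next
  case S then show ?case by (cases d) auto
next
  case (Proj x) then show ?case by (cases d) auto
next
  case (Prec f g) then show ?case by (cases d) auto
next
  case (Mn f) then show ?case by (cases d) auto
qed

text \<open>The environment \<open>e\<close> is infinite, so that programs of different arities compose; only an initial
  segment of it is passed to the program.\<close>

definition recfn :: "((nat \<Rightarrow> nat) \<Rightarrow> nat) \<Rightarrow> bool" where
  "recfn F \<longleftrightarrow> (\<exists>c k. \<forall>e. eval c (map e [0..<k]) (F e))"

lemma eval_Projs: "k \<le> l \<Longrightarrow> list_all2 (\<lambda>g y. eval g (map e [0..<l]) y) (map Proj [0..<k]) (map e [0..<k])"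
  using eval_Proj[of _ "map e [0..<l]"] by (fastforce simp: list_all2_conv_all_nth)

text \<open>Padding: projections discard the entries beyond the arity, so finitely many programs can
  be brought to a common arity.\<close>

lemma recfnE:
  assumes "recfn F"
  obtains k0 where "\<And>k. k0 \<le> k \<Longrightarrow> \<exists>c. \<forall>e. eval c (map e [0..<k]) (F e)"
proof -
  from assms obtain c k0 where c: "\<forall>e. eval c (map e [0..<k0]) (F e)"
    unfolding recfn_def by blast
  have "\<exists>c. \<forall>e. eval c (map e [0..<k]) (F e)" if "k0 \<le> k" for k
    using eval_Comp[OF eval_Projs[OF that]] c by blast
  then show thesis using that by blast
qed

text \<open>A program for \<open>F\<close> sees only \<open>k\<close> entries of its environment, so
  only finitely many of the \<open>g i\<close> have to be composed with it.\<close>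

lemma recfn_subst:
  assumes F: "recfn F" and g: "\<And>i. recfn (g i)"
  shows "recfn (\<lambda>e. F (\<lambda>i. g i e))"
proof -
  from F obtain c k where c: "\<And>e. eval c (map e [0..<k]) (F e)"
    unfolding recfn_def by blast
  have "\<exists>K. \<forall>l\<ge>K. \<exists>c. \<forall>e. eval c (map e [0..<l]) (g i e)" for i
    using recfnE[OF g[of i]] by metis
  then obtain K where K: "\<And>i l. K i \<le> l \<Longrightarrow> \<exists>c. \<forall>e. eval c (map e [0..<l]) (g i e)"
    by metis
  define L where "L = Max (insert 0 (K ` {..<k}))"
  have L: "K i \<le> L" if "i < k" for i using that unfolding L_def by auto
  obtain d where d: "\<And>i e. i < k \<Longrightarrow> eval (d i) (map e [0..<L]) (g i e)"
    using K[OF L] by metis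
  have "eval (Comp c (map d [0..<k])) (map e [0..<L]) (F (\<lambda>i. g i e))" for e
    by (rule eval_Comp[OF _ c]) (auto simp: list_all2_conv_all_nth d)
  then show ?thesis unfolding recfn_def by blast
qed

lemma recfn_var: "recfn (\<lambda>e. e i)"
proof -
  have "eval (Proj i) (map e [0..<Suc i]) (e i)" for e
    using eval_Proj[of i "map e [0..<Suc i]"] by (simp add: nth_append del: upt_Suc)
  then show ?thesis unfolding recfn_def by blast
qed

lemma recfn_zero: "recfn (\<lambda>e. 0)"
  unfolding recfn_def using eval_Z by blast

lemma recfn_comp1: "recfn (\<lambda>e. F (e 0)) \<Longrightarrow> recfn f \<Longrightarrow> recfn (\<lambda>e. F (f e))"
  using recfn_subst[of "\<lambda>e. F (e 0)" "\<lambda>i. f"] by simp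

lemma recfn_comp2:
  assumes "recfn (\<lambda>e. F (e 0) (e 1))" "recfn f" "recfn g"
  shows "recfn (\<lambda>e. F (f e) (g e))"
  using recfn_subst[of "\<lambda>e. F (e 0) (e 1)" "\<lambda>i. if i = 0 then f else g"] assms by simp

lemma recfn_comp3:
  assumes "recfn (\<lambda>e. F (e 0) (e 1) (e 2))" "recfn f" "recfn g" "recfn h"
  shows "recfn (\<lambda>e. F (f e) (g e) (h e))"
  using recfn_subst[of "\<lambda>e. F (e 0) (e 1) (e 2)" "\<lambda>i. if i = 0 then f else if i = 1 then g else h"] assms by simp

lemma recfn_comp4:
  assumes "recfn (\<lambda>e. F (e 0) (e 1) (e 2) (e 3))" "recfn f" "recfn g" "recfn h" "recfn h'"
  shows "recfn (\<lambda>e. F (f e) (g e) (h e) (h' e))"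
  using recfn_subst[of "\<lambda>e. F (e 0) (e 1) (e 2) (e 3)"
    "\<lambda>i. if i = 0 then f else if i = 1 then g else if i = 2 then h else h'"] assms by simp

text \<open>Entry 0 acts as a de Bruijn variable: substituting \<open>f\<close> for it and shifting
  the other entries back removes it again.\<close>

lemma recfn_push:
  assumes "recfn (\<lambda>e. F (e 0) (\<lambda>i. e (Suc i)))" "recfn f"
  shows "recfn (\<lambda>e. F (f e) e)"
proof -
  have "recfn (\<lambda>e. (\<lambda>e. F (e 0) (\<lambda>i. e (Suc i))) (\<lambda>i. (case i of 0 \<Rightarrow> f | Suc j \<Rightarrow> (\<lambda>e. e j)) e))"
    by (rule recfn_subst[OF assms(1)]) (auto simp: assms(2) recfn_var split: nat.split)
  then show ?thesis by simp
qed

lemma recfn_Suc: "recfn f \<Longrightarrow> recfn (\<lambda>e. Suc (f e))"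
proof (rule recfn_comp1[where F = Suc])
  have "eval S (map e [0..<1]) (Suc (e 0))" for e using eval_S by simp
  then show "recfn (\<lambda>e. Suc (e 0))" unfolding recfn_def by blast
qed

lemma recfn_const: "recfn (\<lambda>e. c)"
  by (induction c) (auto intro: recfn_zero recfn_Suc)

text \<open>In the step function entry 0 is the value so far and entry 1 the counter, in the order
  in which \<open>eval_PrecS\<close> passes them.\<close>

lemma recfn_rec:
  assumes A: "recfn A" and G: "recfn (\<lambda>e. G (e 1) (e 0) (\<lambda>i. e (Suc (Suc i))))" and m: "recfn m"
  shows "recfn (\<lambda>e. rec_nat (A e) (\<lambda>n r. G n r e) (m e))"
proof (rule recfn_push[OF _ m])
  from recfnE[OF A] obtain ka where ka: "\<And>k. ka \<le> k \<Longrightarrow> \<exists>c. \<forall>e. eval c (map e [0..<k]) (A e)"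
    by metis
  from recfnE[OF G] obtain kg where kg: "\<And>k. kg \<le> k \<Longrightarrow>
    \<exists>c. \<forall>e. eval c (map e [0..<k]) (G (e 1) (e 0) (\<lambda>i. e (Suc (Suc i))))"
    by metis
  define k where "k = max ka kg"
  from ka[of k] obtain ca where ca: "\<And>e. eval ca (map e [0..<k]) (A e)"
    unfolding k_def by auto
  from kg[of "Suc (Suc k)"] obtain cg where
    cg: "\<And>e. eval cg (map e [0..<Suc (Suc k)]) (G (e 1) (e 0) (\<lambda>i. e (Suc (Suc i))))"
    unfolding k_def by (meson le_SucI max.cobounded2)
  have cg': "eval cg (r # n # map e [0..<k]) (G n r e)" for r n e
  proof -
    define e' where "e' = (\<lambda>i. case i of 0 \<Rightarrow> r | Suc 0 \<Rightarrow> n | Suc (Suc i) \<Rightarrow> e i)"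
    have "map e' [0..<Suc (Suc k)] = r # n # map e [0..<k]"
      by (rule nth_equalityI) (auto simp: nth_Cons e'_def simp del: upt_Suc split: nat.split)
    then show ?thesis using cg[of e'] unfolding e'_def by simp
  qed
  have main: "eval (Prec ca cg) (n # map e [0..<k]) (rec_nat (A e) (\<lambda>n r. G n r e) n)" for n e
  proof (induction n)
    case 0 then show ?case using ca by (auto intro: eval_Prec0)
  next
    case (Suc n) then show ?case using cg' by (auto intro: eval_PrecS)
  qed
  have "eval (Prec ca cg) (map e [0..<Suc k])
     (rec_nat (A (\<lambda>i. e (Suc i))) (\<lambda>n r. G n r (\<lambda>i. e (Suc i))) (e 0))" for e
  proof -
    have "map e [0..<Suc k] = e 0 # map (\<lambda>i. e (Suc i)) [0..<k]"
      by (simp add: upt_conv_Cons map_Suc_upt[symmetric] comp_def del: upt_Suc)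
    then show ?thesis using main[of "e 0" "\<lambda>i. e (Suc i)"] by simp
  qed
  then show "recfn (\<lambda>e. rec_nat (A (\<lambda>i. e (Suc i))) (\<lambda>n r. G n r (\<lambda>i. e (Suc i))) (e 0))"
    unfolding recfn_def by blast
qed

text \<open>Since \<open>ex\<close> holds in every environment, the unbounded search always halts,
  and below its result all values are positive as \<open>eval_Mn\<close> requires.\<close>

lemma recfn_Least0:
  assumes P: "recfn (\<lambda>e. P (e 0) (\<lambda>i. e (Suc i)))" and ex: "\<And>e. \<exists>n. P n e = 0"
  shows "recfn (\<lambda>e. LEAST n. P n e = 0)"
proof -
  from recfnE[OF P] obtain kg where kg: "\<And>k. kg \<le> k \<Longrightarrow>
    \<exists>c. \<forall>e. eval c (map e [0..<k]) (P (e 0) (\<lambda>i. e (Suc i)))"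
    by metis
  from kg[of "Suc kg"] obtain c where
    c: "\<And>e. eval c (map e [0..<Suc kg]) (P (e 0) (\<lambda>i. e (Suc i)))"
    by (auto simp del: upt_Suc)
  have c': "eval c (n # map e [0..<kg]) (P n e)" for n e
  proof -
    have "map (case_nat n e) [0..<Suc kg] = n # map e [0..<kg]"
      by (simp add: upt_conv_Cons map_Suc_upt[symmetric] comp_def del: upt_Suc)
    then show ?thesis using c[of "case_nat n e"] by simp
  qed
  have "eval (Mn c) (map e [0..<kg]) (LEAST n. P n e = 0)" for e
  proof (rule eval_Mn)
    show "eval c ((LEAST n. P n e = 0) # map e [0..<kg]) 0"
      using c'[of "LEAST n. P n e = 0" e] LeastI_ex[OF ex[of e]] by simp
    show "\<forall>m<(LEAST n. P n e = 0). \<exists>k. eval c (m # map e [0..<kg]) (Suc k)"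
      using c'[of _ e] not_less_Least by (metis not0_implies_Suc)
  qed
  then show ?thesis unfolding recfn_def by blast
qed

section \<open>Decidable predicates, arithmetic and bounded quantifiers\<close>

definition dec :: "((nat \<Rightarrow> nat) \<Rightarrow> bool) \<Rightarrow> bool" where
  "dec P \<longleftrightarrow> recfn (\<lambda>e. if P e then 1 else 0)"

lemma recfn_add: "recfn f \<Longrightarrow> recfn g \<Longrightarrow> recfn (\<lambda>e. f e + g e)"
proof (rule recfn_comp2[where F = "(+)"])
  have "recfn (\<lambda>e. rec_nat (e 0) (\<lambda>n r. Suc r) (e 1))"
    by (intro recfn_rec recfn_Suc recfn_var)
  moreover have "rec_nat a (\<lambda>n r. Suc r) b = a + b" for a b by (induction b) auto
  ultimately show "recfn (\<lambda>e. e 0 + e 1)" by simp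
qed

lemma recfn_mult: "recfn f \<Longrightarrow> recfn g \<Longrightarrow> recfn (\<lambda>e. f e * g e)"
proof (rule recfn_comp2[where F = "(*)"])
  have "recfn (\<lambda>e. rec_nat 0 (\<lambda>n r. r + e 0) (e 1))"
    by (intro recfn_rec recfn_add recfn_var recfn_const)
  moreover have "rec_nat 0 (\<lambda>n r. r + a) b = a * b" for a b by (induction b) auto
  ultimately show "recfn (\<lambda>e. e 0 * e 1)" by simp
qed

lemma recfn_power: "recfn f \<Longrightarrow> recfn g \<Longrightarrow> recfn (\<lambda>e. f e ^ g e)"
proof (rule recfn_comp2[where F = "(^)"])
  have "recfn (\<lambda>e. rec_nat 1 (\<lambda>n r. r * e 0) (e 1))"
    by (intro recfn_rec recfn_mult recfn_var recfn_const)
  moreover have "rec_nat 1 (\<lambda>n r. r * a) b = a ^ b" for a b :: nat by (induction b) auto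
  ultimately show "recfn (\<lambda>e. e 0 ^ e 1)" by simp
qed

lemma recfn_diff: "recfn f \<Longrightarrow> recfn g \<Longrightarrow> recfn (\<lambda>e. f e - g e)"
proof (rule recfn_comp2[where F = "(-)"])
  \<comment> \<open>The step returns the counter and forgets the value so far, which yields the
    predecessor.\<close>
  have "recfn (\<lambda>e. rec_nat 0 (\<lambda>n r. n) (e 0))"
    by (intro recfn_rec recfn_var recfn_const)
  moreover have "rec_nat 0 (\<lambda>n r. n) b = b - 1" for b by (cases b) auto
  ultimately have p: "recfn (\<lambda>e. e 0 - 1)" by simp
  have "recfn (\<lambda>e. rec_nat (e 0) (\<lambda>n r. r - 1) (e 1))"
    by (intro recfn_rec recfn_comp1[OF p] recfn_var recfn_const)
  moreover have "rec_nat a (\<lambda>n r. r - 1) b = a - b" for a b :: nat by (induction b) auto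
  ultimately show "recfn (\<lambda>e. e 0 - e 1)" by simp
qed

lemma recfn_if:
  assumes "dec P" "recfn f" "recfn g"
  shows "recfn (\<lambda>e. if P e then f e else g e)"
proof -
  have "recfn (\<lambda>e. (if P e then 1 else 0) * f e + (1 - (if P e then 1 else 0)) * g e)"
    using assms unfolding dec_def
    by (intro recfn_add recfn_mult recfn_diff recfn_const)
  moreover have "(\<lambda>e. (if P e then 1 else 0) * f e + (1 - (if P e then 1 else 0)) * g e)
    = (\<lambda>e. if P e then f e else g e)"
    by auto
  ultimately show ?thesis by simp
qed

lemma dec_const: "dec (\<lambda>e. b)"
  unfolding dec_def by (rule recfn_const)

lemma dec_cong: "dec P \<Longrightarrow> (\<And>e. P e = Q e) \<Longrightarrow> dec Q"
  by (drule ext[of P Q]) simp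

lemma recfn_cong: "recfn f \<Longrightarrow> (\<And>e. f e = g e) \<Longrightarrow> recfn g"
  by (drule ext[of f g]) simp

lemma dec_if:
  assumes "dec P" "dec Q" "dec R"
  shows "dec (\<lambda>e. if P e then Q e else R e)"
  unfolding dec_def
  by (rule recfn_cong[OF recfn_if[OF assms(1) assms(2,3)[unfolded dec_def]]]) auto

lemma dec_not:
  assumes "dec P"
  shows "dec (\<lambda>e. \<not> P e)"
  by (rule dec_cong[OF dec_if[OF assms dec_const[of False] dec_const[of True]]]) auto

lemma dec_conj:
  assumes "dec P" "dec Q"
  shows "dec (\<lambda>e. P e \<and> Q e)"
  by (rule dec_cong[OF dec_if[OF assms dec_const[of False]]]) auto

lemma dec_disj:
  assumes "dec P" "dec Q"
  shows "dec (\<lambda>e. P e \<or> Q e)"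
  by (rule dec_cong[OF dec_if[OF assms(1) dec_const[of True] assms(2)]]) auto

lemma dec_imp:
  assumes "dec P" "dec Q"
  shows "dec (\<lambda>e. P e \<longrightarrow> Q e)"
  by (rule dec_cong[OF dec_if[OF assms dec_const[of True]]]) auto

lemma dec_iff:
  assumes "dec P" "dec Q"
  shows "dec (\<lambda>e. P e \<longleftrightarrow> Q e)"
  by (rule dec_cong[OF dec_if[OF assms dec_not[OF assms(2)]]]) auto

lemma dec_eq0: assumes "recfn f" shows "dec (\<lambda>e. f e = 0)"
proof -
  have "recfn (\<lambda>e. 1 - f e)" by (intro recfn_diff recfn_const assms)
  moreover have "(\<lambda>e. 1 - f e) = (\<lambda>e. if f e = 0 then 1 else 0)" by auto
  ultimately show ?thesis unfolding dec_def by simp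
qed

lemma dec_le: "recfn f \<Longrightarrow> recfn g \<Longrightarrow> dec (\<lambda>e. f e \<le> g e)"
  using dec_eq0[OF recfn_diff[of f g]] by simp

lemma dec_less: "recfn f \<Longrightarrow> recfn g \<Longrightarrow> dec (\<lambda>e. f e < g e)"
  using dec_not[OF dec_le[of g f]] by (simp add: not_le)

lemma dec_eq: "recfn f \<Longrightarrow> recfn g \<Longrightarrow> dec (\<lambda>e. f e = g e)"
  using dec_conj[OF dec_le[of f g] dec_le[of g f]] by (simp add: eq_iff)

lemma recfn_Least:
  assumes "dec (\<lambda>e. P (e 0) (\<lambda>i. e (Suc i)))" "\<And>e. \<exists>n. P n e"
  shows "recfn (\<lambda>e. LEAST n. P n e)"
proof (rule recfn_cong)
  show "recfn (\<lambda>e. LEAST n. (if P n e then 0 else 1 :: nat) = 0)"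
    using assms by (intro recfn_Least0 recfn_if recfn_const) auto
qed auto

lemma dec_All_less:
  assumes "dec (\<lambda>e. P (e 0) (\<lambda>i. e (Suc i)))" "recfn b"
  shows "dec (\<lambda>e. \<forall>i<b e. P i e)"
proof -
  have "recfn (\<lambda>e. rec_nat 1 (\<lambda>n r :: nat. r * (if P n e then 1 else 0)) (b e))"
  proof (intro recfn_rec recfn_mult recfn_var recfn_const assms(2))
    have "recfn (\<lambda>e. (\<lambda>e. if P (e 0) (\<lambda>i. e (Suc i)) then 1 else 0) (\<lambda>i. e (Suc i)))"
      by (rule recfn_subst[where g = "\<lambda>i e. e (Suc i)"])
        (use assms(1) recfn_var in \<open>auto simp: dec_def\<close>)
    then show "recfn (\<lambda>e. if P (e 1) (\<lambda>i. e (Suc (Suc i))) then 1 else 0)" by simp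
  qed
  moreover have "rec_nat 1 (\<lambda>n r :: nat. r * (if P n e then 1 else 0)) m = (if \<forall>i<m. P i e then 1 else 0)" for m e
    by (induction m) (auto simp: less_Suc_eq)
  ultimately show ?thesis unfolding dec_def by simp
qed

lemma dec_Ex_less:
  assumes "dec (\<lambda>e. P (e 0) (\<lambda>i. e (Suc i)))" "recfn b"
  shows "dec (\<lambda>e. \<exists>i<b e. P i e)"
  using dec_not[OF dec_All_less[OF dec_not[OF assms(1)] assms(2)]] by simp

lemma dec_All_le:
  assumes "dec (\<lambda>e. P (e 0) (\<lambda>i. e (Suc i)))" "recfn b"
  shows "dec (\<lambda>e. \<forall>i\<le>b e. P i e)"
  using dec_All_less[OF assms(1) recfn_Suc[OF assms(2)]] by (simp add: less_Suc_eq_le)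

lemma dec_Ex_le:
  assumes "dec (\<lambda>e. P (e 0) (\<lambda>i. e (Suc i)))" "recfn b"
  shows "dec (\<lambda>e. \<exists>i\<le>b e. P i e)"
  using dec_Ex_less[OF assms(1) recfn_Suc[OF assms(2)]] by (simp add: less_Suc_eq_le)

text \<open>Closure rules directed by the syntax of the term, so that applying them exhaustively
  proves later computability goals.\<close>

lemmas rec_basic = recfn_var recfn_const recfn_Suc recfn_add recfn_mult recfn_power recfn_diff recfn_if
  dec_const dec_not dec_conj dec_disj dec_imp dec_iff dec_le dec_less dec_eq dec_All_less dec_Ex_less dec_All_le dec_Ex_le

lemma recfn_div: "recfn f \<Longrightarrow> recfn g \<Longrightarrow> recfn (\<lambda>e. f e div g e)"
proof (rule recfn_comp2[where F = "(div)"])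
  \<comment> \<open>The disjunct \<open>e 1 = 0\<close> keeps the search total; division by 0 has
    the value 0.\<close>
  have *: "recfn (\<lambda>e. if e 1 = 0 then 0 else (LEAST q. e 1 = 0 \<or> e 0 < Suc q * e 1))"
  proof (intro rec_basic recfn_Least)
    show "\<exists>n. e 1 = 0 \<or> e 0 < Suc n * e 1" for e :: "nat \<Rightarrow> nat"
      by (rule exI[of _ "e 0"]) (cases "e 1"; simp)
  qed
  have **: "(if b = 0 then 0 else (LEAST q. b = 0 \<or> a < Suc q * b)) = a div b" for a b :: nat
  proof (cases "b = 0")
    case False
    have "a < Suc q * b \<longleftrightarrow> a div b \<le> q" for q
      using div_less_iff_less_mult[of b a "Suc q"] False by (simp only: less_Suc_eq_le)
    then have "(LEAST q. b = 0 \<or> a < Suc q * b) = a div b"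
      using False by (intro Least_equality) (simp_all only: simp_thms order_refl)
    then show ?thesis using False by simp
  qed simp
  show "recfn (\<lambda>e. e 0 div e 1)" by (rule recfn_cong[OF *]) (rule **)
qed

lemma dec_comp3:
  assumes "dec (\<lambda>e. P (e 0) (e 1) (e 2))" "recfn f" "recfn g" "recfn h"
  shows "dec (\<lambda>e. P (f e) (g e) (h e))"
  using recfn_comp3[where F = "\<lambda>x y z. if P x y z then 1 else 0"] assms unfolding dec_def by simp

lemma recfn_mod: "recfn f \<Longrightarrow> recfn g \<Longrightarrow> recfn (\<lambda>e. f e mod g e)"
  unfolding modulo_nat_def by (intro recfn_diff recfn_mult recfn_div)

lemma dec_odd: "recfn f \<Longrightarrow> dec (\<lambda>e. odd (f e))"
  unfolding odd_iff_mod_2_eq_one by (intro dec_eq recfn_mod recfn_const)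

lemma dec_even: "recfn f \<Longrightarrow> dec (\<lambda>e. even (f e))"
  using dec_not[OF dec_odd] by simp

lemma dec_set_decode: "recfn f \<Longrightarrow> recfn g \<Longrightarrow> dec (\<lambda>e. f e \<in> set_decode (g e))"
  unfolding set_decode_def mem_Collect_eq by (intro dec_odd recfn_div recfn_power recfn_const)

section \<open>Pairs and lists as numbers\<close>

lemma recfn_prod_encode: "recfn f \<Longrightarrow> recfn g \<Longrightarrow> recfn (\<lambda>e. prod_encode (f e, g e))"
  unfolding prod_encode_def triangle_def prod.case
  by (intro recfn_add recfn_div recfn_mult recfn_Suc recfn_const)

definition pi1 :: "nat \<Rightarrow> nat" where "pi1 x = fst (prod_decode x)"
definition pi2 :: "nat \<Rightarrow> nat" where "pi2 x = snd (prod_decode x)"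

lemma pi1_encode [simp]: "pi1 (prod_encode (a, b)) = a"
  and pi2_encode [simp]: "pi2 (prod_encode (a, b)) = b"
  and pi_encode [simp]: "prod_encode (pi1 x, pi2 x) = x"
  by (simp_all add: pi1_def pi2_def)

lemma pi1_le: "pi1 x \<le> x" and pi2_le: "pi2 x \<le> x"
  by (metis pi_encode le_prod_encode_1) (metis pi_encode le_prod_encode_2)

text \<open>Unpairing is a search; the other component is at most the code, so the inner quantifier
  is bounded.\<close>

lemma recfn_pi1: assumes "recfn f" shows "recfn (\<lambda>e. pi1 (f e))"
proof (rule recfn_comp1[OF _ assms])
  have *: "recfn (\<lambda>e. LEAST a. \<exists>b\<le>e 0. prod_encode (a, b) = e 0)"
  proof (intro recfn_Least rec_basic recfn_prod_encode)
    show "\<exists>n. \<exists>b\<le>e 0. prod_encode (n, b) = e 0" for e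
      using pi2_le pi_encode by blast
  qed
  have "(LEAST a. \<exists>b\<le>x. prod_encode (a, b) = x) = pi1 x" for x
    by (rule Least_equality) (use pi2_le[of x] pi_encode[of x] in \<open>auto intro: exI[of _ "pi2 x"]\<close>)
  then show "recfn (\<lambda>e. pi1 (e 0))" by (intro recfn_cong[OF *])
qed

lemma recfn_pi2: assumes "recfn f" shows "recfn (\<lambda>e. pi2 (f e))"
proof (rule recfn_comp1[OF _ assms])
  have *: "recfn (\<lambda>e. LEAST b. prod_encode (pi1 (e 0), b) = e 0)"
  proof (intro recfn_Least rec_basic recfn_prod_encode recfn_pi1)
    show "\<exists>n. prod_encode (pi1 (e 0), n) = e 0" for e
      using pi_encode by blast
  qed
  have "(LEAST b. prod_encode (pi1 x, b) = x) = pi2 x" for x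
    by (rule Least_equality) (simp, metis order_refl pi2_encode)
  then show "recfn (\<lambda>e. pi2 (e 0))" by (intro recfn_cong[OF *])
qed

definition nth0 :: "nat list \<Rightarrow> nat \<Rightarrow> nat" where "nth0 xs i = (if i < length xs then xs ! i else 0)"
definition lenc :: "nat \<Rightarrow> nat" where "lenc x = length (list_decode x)"
definition nthc :: "nat \<Rightarrow> nat \<Rightarrow> nat" where "nthc x = nth0 (list_decode x)"
text \<open>A nonempty list has the successor of a pair as its code, so this is the tail; the empty
  list, coded by 0, is its own tail.\<close>

definition tlc :: "nat \<Rightarrow> nat" where "tlc x = pi2 (x - 1)"
definition takec :: "nat \<Rightarrow> nat \<Rightarrow> nat" where "takec m x = list_encode (take m (list_decode x))"

lemma lenc_encode [simp]: "lenc (list_encode xs) = length xs"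
  and nthc_encode [simp]: "nthc (list_encode xs) = nth0 xs"
  by (simp_all add: lenc_def nthc_def)

lemma list_decode_tlc: "list_decode ((tlc ^^ i) x) = drop i (list_decode x)"
proof (induction i)
  case (Suc i)
  have "list_decode (tlc y) = tl (list_decode y)" for y
    using pi2_le[of 0] by (cases y) (simp_all add: tlc_def pi2_def split: prod.splits)
  then show ?case using Suc by (simp add: drop_Suc tl_drop)
qed simp

lemma list_decode_eq_Nil: "list_decode x = [] \<longleftrightarrow> x = 0"
  by (metis list_decode.simps(1) list_decode_inverse list_encode.simps(1))

lemma code_eqI: "lenc x = lenc y \<Longrightarrow> (\<And>i. i < lenc x \<Longrightarrow> nthc x i = nthc y i) \<Longrightarrow> x = y"
  by (rule injD[OF inj_list_decode], rule nth_equalityI) (auto simp: lenc_def nthc_def nth0_def)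

lemma recfn_tlc_iter: "recfn f \<Longrightarrow> recfn g \<Longrightarrow> recfn (\<lambda>e. (tlc ^^ f e) (g e))"
proof (rule recfn_comp2[where F = "\<lambda>i. tlc ^^ i"])
  have *: "recfn (\<lambda>e. rec_nat (e 1) (\<lambda>n r. pi2 (r - 1)) (e 0))"
    by (intro recfn_rec rec_basic recfn_pi2)
  have "rec_nat x (\<lambda>n r. pi2 (r - 1)) i = (tlc ^^ i) x" for i x
    by (induction i) (auto simp: tlc_def)
  then show "recfn (\<lambda>e. (tlc ^^ e 0) (e 1))" by (intro recfn_cong[OF *])
qed

lemma recfn_lenc: "recfn f \<Longrightarrow> recfn (\<lambda>e. lenc (f e))"
proof (rule recfn_comp1[where F = lenc])
  have **: "(tlc ^^ n) x = 0 \<longleftrightarrow> lenc x \<le> n" for x n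
    using list_decode_tlc[of n x] list_decode_eq_Nil[of "(tlc ^^ n) x"] by (simp add: lenc_def)
  have *: "recfn (\<lambda>e. LEAST n. (tlc ^^ n) (e 0) = 0)"
  proof (intro recfn_Least rec_basic recfn_tlc_iter)
    show "\<exists>n. (tlc ^^ n) (e 0) = 0" for e unfolding ** by blast
  qed
  show "recfn (\<lambda>e. lenc (e 0))"
    by (rule recfn_cong[OF *]) (simp add: ** Least_equality)
qed

lemma recfn_nthc: "recfn f \<Longrightarrow> recfn g \<Longrightarrow> recfn (\<lambda>e. nthc (f e) (g e))"
proof (rule recfn_comp2[where F = nthc])
  have *: "recfn (\<lambda>e. pi1 ((tlc ^^ e 1) (e 0) - 1))"
    by (intro rec_basic recfn_pi1 recfn_tlc_iter)
  have "pi1 ((tlc ^^ i) x - 1) = nthc x i" for x i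
  proof (cases "(tlc ^^ i) x")
    case 0
    then show ?thesis using list_decode_tlc[of i x] pi1_le[of 0] by (simp add: nthc_def nth0_def)
  next
    case (Suc y)
    then have "drop i (list_decode x) = pi1 y # list_decode (pi2 y)"
      using list_decode_tlc[of i x] by (simp add: pi1_def pi2_def split: prod.splits)
    then show ?thesis unfolding Suc nthc_def nth0_def
      by (metis diff_Suc_1 drop_eq_Nil hd_drop_conv_nth leI list.sel(1) list.simps(3))
  qed
  then show "recfn (\<lambda>e. nthc (e 0) (e 1))" by (intro recfn_cong[OF *]) simp
qed

lemma recfn_takec: "recfn f \<Longrightarrow> recfn g \<Longrightarrow> recfn (\<lambda>e. takec (f e) (g e))"
proof (rule recfn_comp2[where F = takec])
  \<comment> \<open>The first three conjuncts make the length the minimum of \<open>m\<close> and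
    the length of \<open>x\<close>, in decidable terms.\<close>
  let ?P = "\<lambda>m x y. (lenc y = m \<or> lenc y = lenc x) \<and> lenc y \<le> m \<and> lenc y \<le> lenc x \<and> (\<forall>i<lenc y. nthc y i = nthc x i)"
  have P: "?P m x y \<longleftrightarrow> y = takec m x" for m x y
  proof
    assume *: "?P m x y"
    have "list_decode y = take m (list_decode x)"
      by (rule nth_equalityI) (use * in \<open>auto simp: lenc_def nthc_def nth0_def min_def split: if_splits\<close>)
    then show "y = takec m x" unfolding takec_def by (metis list_decode_inverse)
  next
    assume "y = takec m x" then show "?P m x y"
      by (auto simp: lenc_def nthc_def nth0_def takec_def min_def)
  qed
  have *: "recfn (\<lambda>e. LEAST y. ?P (e 0) (e 1) y)"
  proof (intro recfn_Least rec_basic recfn_lenc recfn_nthc)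
    show "\<exists>n. ?P (e 0) (e 1) n" for e unfolding P by blast
  qed
  show "recfn (\<lambda>e. takec (e 0) (e 1))"
    by (rule recfn_cong[OF *]) (simp add: P Least_equality)
qed

definition consc :: "nat \<Rightarrow> nat \<Rightarrow> nat" where "consc a x = Suc (prod_encode (a, x))"

lemma consc_encode [simp]: "consc a (list_encode xs) = list_encode (a # xs)"
  by (simp add: consc_def)

lemma recfn_consc: "recfn f \<Longrightarrow> recfn g \<Longrightarrow> recfn (\<lambda>e. consc (f e) (g e))"
  unfolding consc_def by (intro recfn_Suc recfn_prod_encode)

lemmas rec_intros = rec_basic dec_odd dec_even dec_set_decode recfn_div recfn_mod recfn_prod_encode recfn_pi1 recfn_pi2
  recfn_lenc recfn_nthc recfn_takec recfn_consc

section \<open>Passing between environments and programs\<close>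

lemma recfn_eval_list:
  assumes "recfn F"
  shows "\<exists>c. \<forall>xs. length xs = n \<longrightarrow> eval c xs (F (nth0 xs))"
proof -
  from assms obtain c k where c: "\<And>e. eval c (map e [0..<k]) (F e)"
    unfolding recfn_def by blast
  have "eval (Comp c (map (\<lambda>i. if i < n then Proj i else Z) [0..<k])) xs (F (nth0 xs))" if "length xs = n" for xs
    by (rule eval_Comp[OF _ c])
      (auto simp: list_all2_conv_all_nth nth0_def that intro!: eval_Proj eval_Z)
  then show ?thesis by blast
qed

lemma recfn_of_eval3:
  assumes "\<And>x y z. eval c [x, y, z] (F x y z)"
  shows "recfn (\<lambda>e. F (e 0) (e 1) (e 2))"
  unfolding recfn_def
proof (intro exI allI)
  fix e :: "nat \<Rightarrow> nat"
  have "map e [0..<3] = [e 0, e 1, e 2]" by (simp add: upt_rec eval_nat_numeral)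
  then show "eval c (map e [0..<3]) (F (e 0) (e 1) (e 2))" using assms by simp
qed

lemma computable_of_recfn: "recfn (\<lambda>e. f (e 0)) \<Longrightarrow> computable f"
  using recfn_eval_list[of "\<lambda>e. f (e 0)" 1] unfolding computable_def
  by (metis length_Cons list.size(3) nth0_def nth_Cons_0 One_nat_def zero_less_one)

lemma computable_rel3_iff_dec: "computable_rel3 C \<longleftrightarrow> dec (\<lambda>e. C (e 0) (e 1) (e 2))"
proof
  assume "computable_rel3 C"
  then obtain c where "\<forall>x y s. eval c [x, y, s] (if C x y s then 1 else 0)"
    unfolding computable_rel3_def by blast
  then show "dec (\<lambda>e. C (e 0) (e 1) (e 2))"
    unfolding dec_def by (intro recfn_of_eval3[where F = "\<lambda>x y z. if C x y z then 1 else 0"]) blast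
next
  assume "dec (\<lambda>e. C (e 0) (e 1) (e 2))"
  from recfn_eval_list[OF this[unfolded dec_def], of 3] obtain c where
    c: "\<And>xs. length xs = 3 \<Longrightarrow> eval c xs (if C (nth0 xs 0) (nth0 xs 1) (nth0 xs 2) then 1 else 0)"
    by blast
  have "eval c [x, y, s] (if C x y s then 1 else 0)" for x y s
    using c[of "[x, y, s]"] by (simp add: nth0_def)
  then show "computable_rel3 C" unfolding computable_rel3_def by blast
qed

text \<open>Hardwires a number into a program, as the s-m-n theorem requires.\<close>

primrec numeral_prog :: "nat \<Rightarrow> recf" where
  "numeral_prog 0 = Z"
| "numeral_prog (Suc n) = Comp S [numeral_prog n]"

lemma eval_numeral_prog: "eval (numeral_prog n) xs n"
  by (induction n) (auto intro!: eval_Z eval_S eval_Comp[where ys = "[_]"])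

lemma recfn_enc_numeral_prog: "recfn f \<Longrightarrow> recfn (\<lambda>e. enc (numeral_prog (f e)))"
proof (rule recfn_comp1[where F = "\<lambda>n. enc (numeral_prog n)"])
  have *: "recfn (\<lambda>e. rec_nat (enc Z) (\<lambda>n r. prod_encode (3, prod_encode (enc S, consc r 0))) (e 0))"
    by (intro recfn_rec rec_intros)
  have "rec_nat (enc Z) (\<lambda>n r. prod_encode (3, prod_encode (enc S, consc r 0))) n = enc (numeral_prog n)" for n
    by (induction n) (simp_all add: consc_def del: enc.simps(1,2))
  then show "recfn (\<lambda>e. enc (numeral_prog (e 0)))" by (intro recfn_cong[OF *])
qed

text \<open>An s-m-n argument: fixing the first argument of a decision program to the numeral of
  \<open>x\<close> gives a program whose code is computable from \<open>x\<close>. Symmetry and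
  irreflexivity reconcile \<open>E\<close> with the symmetric, loop-free reading in
  \<open>graphE\<close>.\<close>

lemma graph_index:
  assumes E: "dec (\<lambda>e. E (e 0) (e 1) (e 2))"
    and sym: "\<And>x u v. E x u v \<Longrightarrow> E x v u" and irrefl: "\<And>x u. \<not> E x u u"
  shows "\<exists>f. computable f \<and> (\<forall>x. graphE (f x) = E x)"
proof -
  from E obtain c where c: "\<And>x u v. eval c [x, u, v] (if E x u v then 1 else 0)"
    unfolding computable_rel3_iff_dec[symmetric] computable_rel3_def by blast
  define P where "P x = Comp c [numeral_prog x, Proj 0, Proj 1]" for x
  define f where "f x = enc (P x)" for x
  have "recfn (\<lambda>e. prod_encode (3, prod_encode (enc c,
    consc (enc (numeral_prog (e 0))) (consc (enc (Proj 0)) (consc (enc (Proj 1)) 0)))))"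
    by (intro rec_intros recfn_enc_numeral_prog)
  then have "computable f"
    by (intro computable_of_recfn) (simp add: f_def P_def consc_def)
  moreover have P: "eval (P x) [u, v] (if E x u v then 1 else 0)" for x u v
    unfolding P_def using eval_numeral_prog eval_Proj[of 0 "[u, v]"] eval_Proj[of 1 "[u, v]"]
    by (intro eval_Comp[OF _ c]) simp
  have "eval (P x) [u, v] 1 \<longleftrightarrow> E x u v" for x u v
    using P[of x u v] eval_det[OF P[of x u v], of 1] by (auto split: if_splits)
  then have "graphE (f x) u v = E x u v" for x u v
    unfolding graphE_def f_def using enc_inj sym irrefl by metis
  ultimately show ?thesis by blast
qed

section \<open>Graphs from labelled hypergraphs\<close>

datatype node = V nat | C "nat list" nat

text \<open>\<open>C F j\<close> is the \<open>j\<close>-th clique vertex attached to the list \<open>F\<close>; \<open>cls\<close> below partitions these vertices into the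
  cliques, with class \<open>0\<close> the infinite one. In class \<open>Suc \<langle>n, k\<rangle>\<close> there are \<open>n + 1\<close> vertices.\<close>

definition nd :: "nat \<Rightarrow> node" where
  "nd u = (if even u then V (u div 2)
           else C (list_decode (fst (prod_decode (u div 2)))) (snd (prod_decode (u div 2))))"

primrec un :: "node \<Rightarrow> nat" where
  "un (V a) = 2 * a"
| "un (C F j) = Suc (2 * prod_encode (list_encode F, j))"

lemma nd_un [simp]: "nd (un p) = p"
  by (cases p) (auto simp: nd_def)

lemma un_nd [simp]: "un (nd u) = u"
  by (auto simp: nd_def)

lemma nd_eq_iff [simp]: "nd u = nd v \<longleftrightarrow> u = v"
  by (metis un_nd)

text \<open>Among the codes of pairs with first component \<open>n\<close>, the second components
  are cut into consecutive blocks of length \<open>n + 1\<close>: infinitely many cliques of each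
  positive finite size.\<close>

definition fcls :: "nat \<Rightarrow> nat" where
  "fcls j = (case prod_decode j of (n, q) \<Rightarrow> Suc (prod_encode (n, q div Suc n)))"

text \<open>With an infinite clique present, it takes the odd positions and the even ones repeat the
  finite cliques, so doubling a position preserves its class.\<close>

definition cls :: "bool \<Rightarrow> nat \<Rightarrow> nat" where
  "cls b j = (if b then if odd j then 0 else fcls (j div 2) else fcls j)"

primrec adj :: "(nat list \<Rightarrow> bool) \<Rightarrow> node \<Rightarrow> node \<Rightarrow> bool" where
  "adj lab (V a) q = (case q of V b \<Rightarrow> False | C F j \<Rightarrow> a \<in> set F)"
| "adj lab (C F j) q = (case q of V b \<Rightarrow> b \<in> set F
     | C G k \<Rightarrow> F = G \<and> j \<noteq> k \<and> cls (lab F) j = cls (lab F) k)"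

definition gr :: "(nat list \<Rightarrow> bool) \<Rightarrow> nat \<Rightarrow> nat \<Rightarrow> bool" where
  "gr lab u v = adj lab (nd u) (nd v)"

lemma adj_sym: "adj lab p q \<Longrightarrow> adj lab q p"
  by (cases p; cases q) auto

lemma adj_irrefl: "\<not> adj lab p p"
  by (cases p) auto

lemma fcls_eq_iff:
  "fcls j = Suc w \<longleftrightarrow> (\<exists>r\<le>fst (prod_decode w). j = prod_encode (fst (prod_decode w), snd (prod_decode w) * Suc (fst (prod_decode w)) + r))"
proof -
  obtain n k where w: "w = prod_encode (n, k)" by (metis prod_decode_inverse surj_pair)
  obtain n' q where j: "j = prod_encode (n', q)" by (metis prod_decode_inverse surj_pair)
  have "q div Suc n = k \<longleftrightarrow> (\<exists>r\<le>n. q = k * Suc n + r)"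
  proof
    assume "q div Suc n = k"
    then show "\<exists>r\<le>n. q = k * Suc n + r"
      using div_mult_mod_eq[of q "Suc n"] mod_less_divisor[of "Suc n" q]
      by (intro exI[of _ "q mod Suc n"]) simp
  qed (auto simp del: mult_Suc_right)
  then show ?thesis unfolding w j fcls_def by (auto simp del: mult_Suc_right)
qed

lemma finite_card_cls:
  "finite {j. cls b j = Suc w} \<and> card {j. cls b j = Suc w} = Suc (fst (prod_decode w))"
proof -
  define n k where "n = fst (prod_decode w)" and "k = snd (prod_decode w)"
  have f: "{j. fcls j = Suc w} = (\<lambda>r. prod_encode (n, k * Suc n + r)) ` {..n}"
    unfolding fcls_eq_iff n_def k_def by auto
  have c: "finite {j. fcls j = Suc w} \<and> card {j. fcls j = Suc w} = Suc n"
    unfolding f by (subst card_image) (auto simp: inj_on_def simp del: mult_Suc_right)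
  show ?thesis
  proof (cases b)
    case True
    have "{j. cls b j = Suc w} = (\<lambda>j. 2 * j) ` {j. fcls j = Suc w}"
      using True by (auto simp: cls_def image_iff elim!: evenE split: if_splits)
    then show ?thesis using c by (simp add: card_image inj_on_def n_def)
  next
    case False
    then show ?thesis using c by (simp add: cls_def n_def)
  qed
qed

lemma infinite_cls: "infinite {j. cls True j = 0}"
proof -
  have "range (\<lambda>k. Suc (2 * k)) \<subseteq> {j. cls True j = 0}" by (auto simp: cls_def)
  moreover have "infinite (range (\<lambda>k::nat. Suc (2 * k)))"
    by (rule range_inj_infinite) (auto simp: inj_on_def)
  ultimately show ?thesis using finite_subset by blast
qed

lemma cls_eq_0: "cls b j = 0 \<Longrightarrow> b"
  by (auto simp: cls_def fcls_def split: prod.splits if_splits)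

text \<open>Reads off the class number whether the class has at least \<open>m\<close> members:
  class 0 is infinite, and otherwise \<open>c - 1\<close> codes a pair whose first component is one
  less than the size.\<close>

definition atleast :: "nat \<Rightarrow> nat \<Rightarrow> bool" where
  "atleast m c \<longleftrightarrow> c = 0 \<or> m \<le> Suc (fst (prod_decode (c - 1)))"

lemma atleast_card:
  assumes "P \<subseteq> {j. cls b j = c}"
  shows "atleast (card P) c"
  using card_mono[OF _ assms] finite_card_cls[of b "c - 1"] by (cases c) (auto simp: atleast_def)

text \<open>The vertex \<open>j0\<close> shows that the class occurs, so class 0 is met only where
  it is infinite.\<close>

lemma fresh_in_cls:
  assumes "finite P" "cls b j0 = c" "atleast (Suc (card P)) c"
  shows "\<exists>j. cls b j = c \<and> j \<notin> P"
proof (rule ccontr)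
  assume "\<not> ?thesis"
  then have sub: "{j. cls b j = c} \<subseteq> P" by blast
  show False
  proof (cases c)
    case 0
    then show False using sub assms infinite_cls cls_eq_0[of b j0] finite_subset by auto
  next
    case (Suc w)
    then show False
      using card_mono[OF assms(1) sub] finite_card_cls[of b w] assms(3) by (auto simp: atleast_def)
  qed
qed

definition tr :: "nat \<Rightarrow> nat \<Rightarrow> nat \<Rightarrow> bool" where
  "tr K c d \<longleftrightarrow> (\<forall>m\<le>K. atleast m c \<longleftrightarrow> atleast m d)"

lemma tr_eq: "c = d \<Longrightarrow> tr K c d"
  by (simp add: tr_def)

lemma fresh_cls:
  assumes "finite X"
  shows "\<exists>j. tr K c (cls b j) \<and> cls b j \<notin> X"
proof -
  \<comment> \<open>An infinite class is imitated by finite classes of size \<open>K + 1\<close>,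
    which the threshold \<open>K\<close> cannot tell from it.\<close>
  define n where "n = (if c = 0 then K else fst (prod_decode (c - 1)))"
  have "inj (\<lambda>k. Suc (prod_encode (n, k)))" by (auto simp: inj_on_def)
  then have "infinite (range (\<lambda>k. Suc (prod_encode (n, k))))" by (rule range_inj_infinite)
  then have "\<not> range (\<lambda>k. Suc (prod_encode (n, k))) \<subseteq> X"
    using assms by (blast intro: finite_subset)
  then obtain k where k: "Suc (prod_encode (n, k)) \<notin> X" by blast
  have "{j. cls b j = Suc (prod_encode (n, k))} \<noteq> {}"
    using finite_card_cls[of b "prod_encode (n, k)"] by force
  then obtain j where "cls b j = Suc (prod_encode (n, k))" by blast
  moreover have "tr K c (Suc (prod_encode (n, k)))"
    by (auto simp: tr_def atleast_def n_def)
  ultimately show ?thesis using k by (intro exI[of _ j]) simp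
qed

text \<open>The extension step of the pebble game over a single list \<open>F\<close>: \<open>J\<close> and \<open>J'\<close> are the
  pebbled vertices in the two graphs.\<close>

lemma cls_extend:
  assumes A: "finite A" "card A < K"
    and inj: "\<And>i k. i \<in> A \<Longrightarrow> k \<in> A \<Longrightarrow> J i = J k \<longleftrightarrow> J' i = J' k"
    and cl: "\<And>i k. i \<in> A \<Longrightarrow> k \<in> A \<Longrightarrow> cls b (J i) = cls b (J k) \<longleftrightarrow> cls b' (J' i) = cls b' (J' k)"
    and tr: "\<And>i. i \<in> A \<Longrightarrow> tr K (cls b (J i)) (cls b' (J' i))"
  shows "\<exists>j'. tr K (cls b j) (cls b' j') \<and>
    (\<forall>i\<in>A. (j = J i \<longleftrightarrow> j' = J' i) \<and> (cls b j = cls b (J i) \<longleftrightarrow> cls b' j' = cls b' (J' i)))"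
proof -
  consider (old) i where "i \<in> A" "j = J i"
    | (same) i where "i \<in> A" "cls b j = cls b (J i)" "j \<notin> J ` A"
    | (new) "\<And>i. i \<in> A \<Longrightarrow> cls b j \<noteq> cls b (J i)"
    by blast
  then show ?thesis
  proof cases
    case old
    then show ?thesis
      by (intro exI[of _ "J' i"] conjI ballI) (simp_all only: old tr inj cl)
  next
    case (same i0)
    \<comment> \<open>Within the class of \<open>j\<close> the pebbles occupy equally many vertices
      on both sides. Adding \<open>j\<close> gives a lower bound of at most \<open>K\<close> on the
      size, which \<open>tr\<close> transfers and which leaves room for \<open>j'\<close>.\<close>
    define B where "B = {i \<in> A. cls b (J i) = cls b j}"
    have B: "B \<subseteq> A" "finite B" using A by (auto simp: B_def)
    have s: "J' (inv_into B J (J k)) = J' k" if "k \<in> B" for k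
    proof -
      have "J (inv_into B J (J k)) = J k" "inv_into B J (J k) \<in> B"
        using that by (auto intro: f_inv_into_f inv_into_into)
      then show ?thesis using inj[of "inv_into B J (J k)" k] that B(1) by auto
    qed
    have "inj_on (\<lambda>x. J' (inv_into B J x)) (J ` B)"
    proof (rule inj_onI, clarify)
      fix i k assume "i \<in> B" "k \<in> B" "J' (inv_into B J (J i)) = J' (inv_into B J (J k))"
      then show "J i = J k" using s inj[of i k] B(1) by auto
    qed
    moreover have "(\<lambda>x. J' (inv_into B J x)) ` J ` B = J' ` B"
      unfolding image_image using s by (rule image_cong[OF refl])
    ultimately have card: "card (J' ` B) = card (J ` B)" by (metis card_image)
    have "card (insert j (J ` B)) = Suc (card (J ` B))"
      using same(3) B by (subst card_insert_disjoint) auto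
    moreover have "atleast (card (insert j (J ` B))) (cls b j)"
      by (rule atleast_card[of _ b]) (auto simp: B_def)
    ultimately have "atleast (Suc (card (J' ` B))) (cls b j)" using card by simp
    moreover have "Suc (card (J' ` B)) \<le> K"
      using card_image_le[OF B(2), of J'] card_mono[OF A(1) B(1)] A(2) by linarith
    ultimately have "atleast (Suc (card (J' ` B))) (cls b' (J' i0))"
      using tr[OF same(1)] same(2) unfolding tr_def by simp
    then obtain j' where j': "cls b' j' = cls b' (J' i0)" "j' \<notin> J' ` B"
      using fresh_in_cls[of "J' ` B" b' "J' i0"] B by blast
    have "tr K (cls b j) (cls b' j')" using tr[OF same(1)] same(2) j'(1) by simp
    moreover have "(j = J i \<longleftrightarrow> j' = J' i) \<and> (cls b j = cls b (J i) \<longleftrightarrow> cls b' j' = cls b' (J' i))"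
      if "i \<in> A" for i
    proof -
      have *: "cls b j = cls b (J i) \<longleftrightarrow> cls b' j' = cls b' (J' i)"
        using cl[OF same(1) that] same(2) j'(1) by metis
      moreover have "j \<noteq> J i" using same(3) that by blast
      moreover have "j' \<noteq> J' i" using * j'(2) that unfolding B_def by auto
      ultimately show ?thesis by simp
    qed
    ultimately show ?thesis by blast
  next
    case new
    obtain j' where "tr K (cls b j) (cls b' j')" "cls b' j' \<notin> (\<lambda>i. cls b' (J' i)) ` A"
      using fresh_cls[of "(\<lambda>i. cls b' (J' i)) ` A"] A(1) by blast
    then show ?thesis using new by (intro exI[of _ j']) (auto simp: image_iff)
  qed
qed

section \<open>Elementarity by a pebble game\<close>

primrec corr :: "(nat list \<Rightarrow> bool) \<Rightarrow> (nat list \<Rightarrow> bool) \<Rightarrow> (nat \<Rightarrow> nat) \<Rightarrow> nat \<Rightarrow> node \<Rightarrow> node \<Rightarrow> bool" where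
  "corr la lb f K (V a) q \<longleftrightarrow> q = V (f a)"
| "corr la lb f K (C F j) q \<longleftrightarrow> (\<exists>j'. q = C (map f F) j' \<and> tr K (cls (la F) j) (cls (lb (map f F)) j'))"

text \<open>Positions of the game with \<open>K\<close> pebbles: since at most \<open>K\<close> vertices are ever named at a time, clique
  sizes matter only up to the fixed threshold \<open>K\<close>. The bijection \<open>f\<close> on vertices is fixed throughout the game.\<close>

definition position :: "(nat list \<Rightarrow> bool) \<Rightarrow> (nat list \<Rightarrow> bool) \<Rightarrow> (nat \<Rightarrow> nat) \<Rightarrow> nat \<Rightarrow>
    (nat \<Rightarrow> node) \<Rightarrow> (nat \<Rightarrow> node) \<Rightarrow> bool" where
  "position la lb f K s t \<longleftrightarrow>
    (\<forall>i<K. corr la lb f K (s i) (t i)) \<and>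
    (\<forall>i<K. \<forall>k<K. \<forall>F j1 j2 j1' j2'. s i = C F j1 \<longrightarrow> s k = C F j2 \<longrightarrow>
       t i = C (map f F) j1' \<longrightarrow> t k = C (map f F) j2' \<longrightarrow>
       (j1 = j2 \<longleftrightarrow> j1' = j2') \<and>
       (cls (la F) j1 = cls (la F) j2 \<longleftrightarrow> cls (lb (map f F)) j1' = cls (lb (map f F)) j2'))"

lemma position_pair:
  assumes "position la lb f K s t" "i < K" "k < K"
    "s i = C F j1" "s k = C F j2" "t i = C (map f F) j1'" "t k = C (map f F) j2'"
  shows "(j1 = j2 \<longleftrightarrow> j1' = j2') \<and>
    (cls (la F) j1 = cls (la F) j2 \<longleftrightarrow> cls (lb (map f F)) j1' = cls (lb (map f F)) j2')"
  using conjunct2[OF assms(1)[unfolded position_def], rule_format, OF assms(2-7)] .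

lemma position_corr: "position la lb f K s t \<Longrightarrow> i < K \<Longrightarrow> corr la lb f K (s i) (t i)"
  by (simp only: position_def)

text \<open>Bijectivity of \<open>f\<close> lets every list be written as \<open>map f F\<close> for
  some \<open>F\<close>, after which the conditions read the same in both directions.\<close>

lemma position_sym:
  assumes "position la lb f K s t" "bij f"
  shows "position lb la (inv f) K t s"
proof -
  have inv: "map (inv f) (map f F) = F" "map f (map (inv f) F) = F" for F
    using assms(2) by (simp_all add: bij_def comp_def surj_f_inv_f)
  have c: "corr lb la (inv f) K q p" if "corr la lb f K p q" for p q
    using that inv assms(2) by (cases p) (auto simp: tr_def bij_def simp del: map_map)
  show ?thesis
    unfolding position_def
  proof (intro conjI allI impI c, goal_cases)
    case (1 i)
    then show ?case by (rule position_corr[OF assms(1)])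
  next
    case (2 i k F j1 j2 j1' j2')
    then show ?case
      using position_pair[OF assms(1), of i k "map (inv f) F" j1' j2' j1 j2] by (simp only: inv)
  next
    case (3 i k F j1 j2 j1' j2')
    then show ?case
      using position_pair[OF assms(1), of i k "map (inv f) F" j1' j2' j1 j2] by (simp only: inv)
  qed
qed

text \<open>Clique vertices over different lists are neither equal nor adjacent, and
  \<open>map f\<close> keeps lists different; over the same list the pair condition of
  \<open>position\<close> decides.\<close>

lemma position_atoms:
  assumes p: "position la lb f K s t" and "inj f" "i < K" "k < K"
  shows "s i = s k \<longleftrightarrow> t i = t k" "adj la (s i) (s k) \<longleftrightarrow> adj lb (t i) (t k)"
proof -
  have ci: "corr la lb f K (s i) (t i)" and ck: "corr la lb f K (s k) (t k)"
    using assms by (auto intro: position_corr)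
  have pp: "(j1 = j2 \<longleftrightarrow> j1' = j2') \<and>
       (cls (la F) j1 = cls (la F) j2 \<longleftrightarrow> cls (lb (map f F)) j1' = cls (lb (map f F)) j2')"
    if "s i = C F j1" "s k = C F j2" "t i = C (map f F) j1'" "t k = C (map f F) j2'" for F j1 j2 j1' j2'
    using position_pair[OF p \<open>i < K\<close> \<open>k < K\<close> that] .
  note m = inj_eq[OF inj_mapI[OF \<open>inj f\<close>]] inj_image_mem_iff[OF \<open>inj f\<close>] inj_eq[OF \<open>inj f\<close>]
  have *: "(s i = s k \<longleftrightarrow> t i = t k) \<and> (adj la (s i) (s k) \<longleftrightarrow> adj lb (t i) (t k))"
  proof (cases "s i")
    case (V a)
    then show ?thesis using ci ck m by (cases "s k") auto
  next
    case Ci: (C F j)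
    then obtain j' where ti: "t i = C (map f F) j'" using ci by auto
    show ?thesis
    proof (cases "s k")
      case (V a)
      then show ?thesis using Ci ti ck m by auto
    next
      case Ck: (C G l)
      then obtain l' where tk: "t k = C (map f G) l'" using ck by auto
      show ?thesis
      proof (cases "F = G")
        case True
        then show ?thesis using pp[of F j l j' l'] Ci Ck ti tk by simp
      next
        case False
        then show ?thesis using Ci Ck ti tk m by simp
      qed
    qed
  qed
  show "s i = s k \<longleftrightarrow> t i = t k" by (rule *[THEN conjunct1])
  show "adj la (s i) (s k) \<longleftrightarrow> adj lb (t i) (t k)" by (rule *[THEN conjunct2])
qed

text \<open>A vertex \<open>V a\<close> must be answered by \<open>V (f a)\<close>; a clique vertex
  is answered by \<open>cls_extend\<close>, applied to the pebbles over the same list.\<close>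

lemma position_forth:
  assumes p: "position la lb f K s t" and "inj f" "v < K"
  shows "\<exists>q. position la lb f K (s(v := p)) (t(v := q))"
proof (cases p)
  case (V a)
  have "position la lb f K (s(v := p)) (t(v := V (f a)))"
    unfolding position_def
  proof (rule conjI)
    show "\<forall>i<K. corr la lb f K ((s(v := p)) i) ((t(v := V (f a))) i)"
      using V by (simp add: position_corr[OF assms(1)])
    show "\<forall>i<K. \<forall>k<K. \<forall>G j1 j2 j1' j2'. (s(v := p)) i = C G j1 \<longrightarrow> (s(v := p)) k = C G j2 \<longrightarrow>
       (t(v := V (f a))) i = C (map f G) j1' \<longrightarrow> (t(v := V (f a))) k = C (map f G) j2' \<longrightarrow>
       (j1 = j2 \<longleftrightarrow> j1' = j2') \<and>
       (cls (la G) j1 = cls (la G) j2 \<longleftrightarrow> cls (lb (map f G)) j1' = cls (lb (map f G)) j2')"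
    proof (intro allI impI, goal_cases)
      case (1 i k G j1 j2 j1' j2')
      then have "i \<noteq> v" "k \<noteq> v" using V by auto
      with 1 show ?case using position_pair[OF assms(1), of i k G j1 j2 j1' j2'] by simp
    qed
  qed
  then show ?thesis by blast
next
  case (C F j)
  \<comment> \<open>Pebble \<open>v\<close> is being moved and is left out, so fewer than
    \<open>K\<close> pebbles remain over \<open>F\<close>.\<close>
  define A where "A = {i. i < K \<and> i \<noteq> v \<and> (\<exists>j. s i = C F j)}"
  have "A \<subseteq> {..<K} - {v}" unfolding A_def by auto
  then have A: "finite A" "card A < K"
    using finite_subset[of A "{..<K} - {v}"] card_mono[of "{..<K} - {v}" A] \<open>v < K\<close> by auto
  have "\<forall>i. \<exists>j j'. i \<in> A \<longrightarrow> s i = C F j \<and> t i = C (map f F) j' \<and> tr K (cls (la F) j) (cls (lb (map f F)) j')"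
  proof
    fix i
    show "\<exists>j j'. i \<in> A \<longrightarrow> s i = C F j \<and> t i = C (map f F) j' \<and> tr K (cls (la F) j) (cls (lb (map f F)) j')"
    proof (cases "i \<in> A")
      case True
      then obtain j where "i < K" "s i = C F j" by (auto simp: A_def)
      moreover then have "corr la lb f K (s i) (t i)" by (intro position_corr[OF assms(1)])
      ultimately show ?thesis by auto
    qed simp
  qed
  then obtain J J' where J: "\<And>i. i \<in> A \<Longrightarrow> s i = C F (J i) \<and> t i = C (map f F) (J' i) \<and>
      tr K (cls (la F) (J i)) (cls (lb (map f F)) (J' i))"
    by metis
  have JJ: "(J i = J k \<longleftrightarrow> J' i = J' k) \<and>
      (cls (la F) (J i) = cls (la F) (J k) \<longleftrightarrow> cls (lb (map f F)) (J' i) = cls (lb (map f F)) (J' k))"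
    if "i \<in> A" "k \<in> A" for i k
    using position_pair[OF assms(1), of i k F "J i" "J k" "J' i" "J' k"] J[OF that(1)] J[OF that(2)] that
    by (simp add: A_def)
  obtain j' where j': "tr K (cls (la F) j) (cls (lb (map f F)) j')"
    "\<And>i. i \<in> A \<Longrightarrow> (j = J i \<longleftrightarrow> j' = J' i) \<and>
      (cls (la F) j = cls (la F) (J i) \<longleftrightarrow> cls (lb (map f F)) j' = cls (lb (map f F)) (J' i))"
    using cls_extend[OF A, of J J' "la F" "lb (map f F)" j] JJ J by blast
  have new: "(j = j2 \<longleftrightarrow> j' = j2') \<and>
      (cls (la F) j = cls (la F) j2 \<longleftrightarrow> cls (lb (map f F)) j' = cls (lb (map f F)) j2')"
    if "k < K" "k \<noteq> v" "s k = C F j2" "t k = C (map f F) j2'" for k j2 j2'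
  proof -
    have "k \<in> A" using that by (auto simp: A_def)
    then show ?thesis using j'(2)[of k] J[of k] that by simp
  qed
  have "position la lb f K (s(v := C F j)) (t(v := C (map f F) j'))"
    unfolding position_def
  proof (rule conjI)
    show "\<forall>i<K. corr la lb f K ((s(v := C F j)) i) ((t(v := C (map f F) j')) i)"
      using j'(1) by (simp add: position_corr[OF assms(1)])
    show "\<forall>i<K. \<forall>k<K. \<forall>G j1 j2 j1' j2'. (s(v := C F j)) i = C G j1 \<longrightarrow> (s(v := C F j)) k = C G j2 \<longrightarrow>
       (t(v := C (map f F) j')) i = C (map f G) j1' \<longrightarrow> (t(v := C (map f F) j')) k = C (map f G) j2' \<longrightarrow>
       (j1 = j2 \<longleftrightarrow> j1' = j2') \<and>
       (cls (la G) j1 = cls (la G) j2 \<longleftrightarrow> cls (lb (map f G)) j1' = cls (lb (map f G)) j2')"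
    proof (intro allI impI, goal_cases)
      case (1 i k G j1 j2 j1' j2')
      consider "i = v" "k = v" | "i = v" "k \<noteq> v" | "i \<noteq> v" "k = v" | "i \<noteq> v" "k \<noteq> v" by blast
      then show ?case
      proof cases
        case ii: 1
        with 1 show ?thesis by simp
      next
        case 2
        with 1 show ?thesis using new[of k j2 j2'] by auto
      next
        case 3
        with 1 show ?thesis using new[of i j1 j1'] by auto
      next
        case 4
        with 1 show ?thesis using position_pair[OF assms(1), of i k G j1 j2 j1' j2'] by simp
      qed
    qed
  qed
  then show ?thesis using C by blast
qed

primrec var_bound :: "fm \<Rightarrow> nat" where
  "var_bound (FEq u v) = Suc (max u v)"
| "var_bound (FRel u v) = Suc (max u v)"
| "var_bound (FNeg p) = var_bound p"
| "var_bound (FConj p q) = max (var_bound p) (var_bound q)"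
| "var_bound (FEx v p) = max (Suc v) (var_bound p)"

lemma nd_fun_upd: "(\<lambda>i. nd ((s(v := a)) i)) = (\<lambda>i. nd (s i))(v := nd a)"
  by auto

text \<open>Induction on the formula: an existential quantifier needs a forth step, and for the
  converse a forth step in the mirrored game given by \<open>inv f\<close>. Bound variables also use
  pebbles, hence \<open>var_bound\<close> counts them.\<close>

lemma sat_position:
  assumes "bij f"
  shows "position la lb f K (\<lambda>i. nd (s i)) (\<lambda>i. nd (t i)) \<Longrightarrow> var_bound p \<le> K \<Longrightarrow>
    sat (gr la) s p \<longleftrightarrow> sat (gr lb) t p"
proof (induction p arbitrary: s t)
  case (FEq u v)
  then show ?case using position_atoms(1)[OF FEq(1) bij_is_inj[OF assms], of u v] by simp
next
  case (FRel u v)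
  then show ?case using position_atoms(2)[OF FRel(1) bij_is_inj[OF assms], of u v] by (simp add: gr_def)
next
  case (FNeg p)
  then show ?case by simp
next
  case (FConj p q)
  then show ?case by simp
next
  case (FEx v p)
  have forth: "\<exists>b. position la lb f K (\<lambda>i. nd ((s(v := a)) i)) (\<lambda>i. nd ((t(v := b)) i))" for a
    using position_forth[OF FEx(2) bij_is_inj[OF assms], of v "nd a"] FEx(3) nd_fun_upd nd_un
    by (metis max.boundedE var_bound.simps(5) Suc_le_eq)
  have inv: "bij (inv f)" "inv (inv f) = f" using assms by (auto simp: bij_imp_bij_inv inv_inv_eq)
  have backward: "\<exists>a. position la lb f K (\<lambda>i. nd ((s(v := a)) i)) (\<lambda>i. nd ((t(v := b)) i))" for b
    using position_forth[OF position_sym[OF FEx(2) assms] bij_is_inj[OF inv(1)], of v "nd b"] FEx(3) nd_fun_upd nd_un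
      position_sym[OF _ inv(1)] inv(2)
    by (metis max.boundedE var_bound.simps(5) Suc_le_eq)
  have "var_bound p \<le> K" using FEx(3) by simp
  then show ?case using FEx.IH forth backward by (metis sat.simps(5))
qed

text \<open>The game needs a bijection, whereas the maps between hypergraphs are only injective.
  Both complements of the finite parts are infinite and can be matched by their
  enumerations.\<close>

lemma bij_extend_finite:
  fixes g :: "nat \<Rightarrow> nat"
  assumes "inj g" "finite X"
  shows "\<exists>f. bij f \<and> (\<forall>x\<in>X. f x = g x)"
proof -
  have infi: "infinite (- X)" "infinite (- g ` X)" using assms(2) by auto
  have b: "bij_betw (enumerate (- g ` X) \<circ> inv_into UNIV (enumerate (- X))) (- X) (- g ` X)"
    using infi by (meson bij_betw_inv_into bij_betw_trans bij_enumerate)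
  then obtain e where e: "bij_betw e (- X) (- g ` X)" by blast
  define f where "f x = (if x \<in> X then g x else e x)" for x
  have "bij_betw f X (g ` X)"
    using assms(1) by (auto simp: f_def bij_betw_def inj_on_def)
  moreover have "bij_betw f (- X) (- g ` X)"
    using e by (rule bij_betw_cong[THEN iffD1, rotated]) (auto simp: f_def)
  ultimately have "bij_betw f (X \<union> - X) (g ` X \<union> - g ` X)"
    by (rule bij_betw_combine) auto
  then show ?thesis by (auto simp: f_def)
qed

text \<open>If only the target list carries an infinite clique, doubling finds the copy of the
  finite cliques there; for labels preserved by \<open>g\<close>, every class number stays
  unchanged.\<close>

primrec node_map :: "(nat list \<Rightarrow> bool) \<Rightarrow> (nat list \<Rightarrow> bool) \<Rightarrow> (nat \<Rightarrow> nat) \<Rightarrow> node \<Rightarrow> node" where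
  "node_map la lb g (V a) = V (g a)"
| "node_map la lb g (C F j) = C (map g F) (if lb (map g F) \<and> \<not> la F then 2 * j else j)"

primrec support :: "node \<Rightarrow> nat set" where
  "support (V a) = {a}"
| "support (C F j) = set F"

text \<open>For one formula and one assignment only finitely many vertices matter, and there
  \<open>g\<close> agrees with a bijection \<open>f\<close> for which the assignment and its image
  form a position.\<close>

lemma elem_emb_node_map:
  assumes g: "inj g" and mono: "\<And>F. la F \<Longrightarrow> lb (map g F)"
  shows "elem_emb (gr la) (gr lb) (\<lambda>u. un (node_map la lb g (nd u)))"
  unfolding elem_emb_def
proof (intro allI)
  fix p s
  define K where "K = var_bound p"
  define X where "X = (\<Union>i<K. support (nd (s i)))"
  have "finite (support q)" for q by (cases q) auto
  then have "finite X" by (auto simp: X_def)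
  from bij_extend_finite[OF g this] obtain f where f: "bij f" "\<forall>x\<in>X. f x = g x" by auto
  have fX: "f x = g x" if "i < K" "x \<in> support (nd (s i))" for i x
    using that f(2) by (auto simp: X_def)
  have fg: "map f F = map g F" if "i < K" "nd (s i) = C F j" for i F j
    using fX[OF that(1)] that(2) by simp
  have cl: "cls (lb (map g F)) (if lb (map g F) \<and> \<not> la F then 2 * j else j) = cls (la F) j" for F j
    using mono[of F] by (auto simp: cls_def)
  have "position la lb f K (\<lambda>i. nd (s i)) (\<lambda>i. node_map la lb g (nd (s i)))"
    unfolding position_def
  proof (intro conjI allI impI, goal_cases)
    case (1 i)
    show ?case
    proof (cases "nd (s i)")
      case (V a)
      then show ?thesis using fX[OF 1, of a] by simp
    next
      case (C F j)
      have "corr la lb f K (C F j) (node_map la lb g (C F j))"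
        unfolding corr.simps node_map.simps fg[OF 1 C] by (rule exI, rule conjI, rule refl, rule tr_eq, rule cl[symmetric])
      then show ?thesis by (simp only: C)
    qed
  next
    case (2 i k F j1 j2 j1' j2')
    have "j1' = (if lb (map g F) \<and> \<not> la F then 2 * j1 else j1)"
      "j2' = (if lb (map g F) \<and> \<not> la F then 2 * j2 else j2)"
      using 2(5,6) unfolding 2(3,4) by simp_all
    then show ?case by simp
  next
    case (3 i k F j1 j2 j1' j2')
    have j: "j1' = (if lb (map g F) \<and> \<not> la F then 2 * j1 else j1)"
      "j2' = (if lb (map g F) \<and> \<not> la F then 2 * j2 else j2)"
      using 3(5,6) unfolding 3(3,4) by simp_all
    show ?case unfolding fg[OF 3(1,3)] j cl ..
  qed
  then have "sat (gr la) s p \<longleftrightarrow> sat (gr lb) (\<lambda>i. un (node_map la lb g (nd (s i)))) p"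
    by (intro sat_position[OF f(1), of la lb K]) (simp_all only: nd_un K_def order_refl)
  then show "sat (gr la) s p \<longleftrightarrow> sat (gr lb) ((\<lambda>u. un (node_map la lb g (nd u))) \<circ> s) p"
    by (simp add: comp_def)
qed

section \<open>Reading the hypergraph off an elementary embedding\<close>

text \<open>Neighbourhoods of vertices \<open>V a\<close> are disjoint unions of cliques, whereas that of \<open>C F j\<close> contains two members of
  \<open>F\<close> and, between them, another vertex of the clique of \<open>C F j\<close>.\<close>

definition diamond :: "(nat \<Rightarrow> nat \<Rightarrow> bool) \<Rightarrow> nat \<Rightarrow> bool" where
  "diamond E u \<longleftrightarrow> (\<exists>a b c. E u a \<and> E u b \<and> E u c \<and> E a b \<and> E b c \<and> \<not> E a c \<and> a \<noteq> c)"

definition is_vertex :: "(nat \<Rightarrow> nat \<Rightarrow> bool) \<Rightarrow> nat \<Rightarrow> bool" where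
  "is_vertex E u \<longleftrightarrow> \<not> diamond E u \<and> (\<exists>v. E u v \<and> diamond E v)"

definition diamond_fm :: "nat \<Rightarrow> fm" where
  "diamond_fm x = FEx (Suc x) (FEx (Suc (Suc x)) (FEx (Suc (Suc (Suc x)))
     (FConj (FRel x (Suc x)) (FConj (FRel x (Suc (Suc x))) (FConj (FRel x (Suc (Suc (Suc x))))
     (FConj (FRel (Suc x) (Suc (Suc x))) (FConj (FRel (Suc (Suc x)) (Suc (Suc (Suc x))))
     (FConj (FNeg (FRel (Suc x) (Suc (Suc (Suc x))))) (FNeg (FEq (Suc x) (Suc (Suc (Suc x)))))))))))))"

definition vertex_fm :: "nat \<Rightarrow> fm" where
  "vertex_fm x = FConj (FNeg (diamond_fm x)) (FEx (Suc x) (FConj (FRel x (Suc x)) (diamond_fm (Suc x))))"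

text \<open>In the graphs \<open>gr\<close>, every neighbour of variable 0 that has the form
  \<open>V a\<close> is among variables 1 to \<open>n\<close>. The formula \<open>FEq 0 0\<close>
  stands for the empty conjunction.\<close>

definition cover_fm :: "nat \<Rightarrow> fm" where
  "cover_fm n = FNeg (FEx (Suc n) (FConj (FRel 0 (Suc n)) (FConj (vertex_fm (Suc n))
     (foldr (\<lambda>i. FConj (FNeg (FEq (Suc n) i))) [1..<Suc n] (FEq 0 0)))))"

lemma sat_diamond_fm: "sat E s (diamond_fm x) \<longleftrightarrow> diamond E (s x)"
  by (simp add: diamond_fm_def diamond_def)

lemma sat_vertex_fm: "sat E s (vertex_fm x) \<longleftrightarrow> is_vertex E (s x)"
  by (simp add: vertex_fm_def is_vertex_def sat_diamond_fm)

lemma sat_foldr_FConj: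
  "sat E s (foldr (\<lambda>i. FConj (f i)) is p) \<longleftrightarrow> (\<forall>i\<in>set is. sat E s (f i)) \<and> sat E s p"
  by (induction "is") auto

lemma sat_cover_fm:
  "sat E s (cover_fm n) \<longleftrightarrow> (\<forall>y. E (s 0) y \<and> is_vertex E y \<longrightarrow> (\<exists>i\<in>{1..n}. y = s i))"
  by (auto simp: cover_fm_def sat_vertex_fm sat_foldr_FConj atLeastLessThanSuc_atLeastAtMost simp del: upt_Suc)

text \<open>Supplies a clique with two vertices at every list, and with it the diamond vertices by
  which hypergraph vertices are recognised.\<close>

lemma two_in_cls: "\<exists>j k. j \<noteq> k \<and> cls b j = cls b k"
proof -
  have "card {j. cls b j = Suc (prod_encode (1, 0))} = 2"
    using finite_card_cls[of b "prod_encode (1, 0)"] by simp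
  then obtain j k where "j \<noteq> k" "{j. cls b j = Suc (prod_encode (1, 0))} = {j, k}"
    unfolding card_2_iff by auto
  moreover from this(2) have "cls b j = Suc (prod_encode (1, 0))" "cls b k = Suc (prod_encode (1, 0))"
    by auto
  ultimately show ?thesis by metis
qed

lemma gr_C: "gr lab u v \<longleftrightarrow> (\<exists>a\<in>set F. nd v = V a) \<or> (\<exists>k. nd v = C F k \<and> j \<noteq> k \<and> cls (lab F) j = cls (lab F) k)"
  if "nd u = C F j"
  by (cases "nd v") (auto simp: gr_def that)

lemma gr_V: "gr lab u v \<longleftrightarrow> (\<exists>F j. nd v = C F j \<and> a \<in> set F)" if "nd u = V a"
  by (cases "nd v") (auto simp: gr_def that)

lemma not_diamond_V:
  assumes u: "nd u = V x"
  shows "\<not> diamond (gr lab) u"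
proof
  assume "diamond (gr lab) u"
  then obtain a b c where d: "gr lab u a" "gr lab u b" "gr lab u c" "gr lab a b" "gr lab b c" "\<not> gr lab a c" "a \<noteq> c"
    unfolding diamond_def by blast
  from d(1-3) obtain F i G j H k where n: "nd a = C F i" "nd b = C G j" "nd c = C H k"
    unfolding gr_V[OF u] by auto
  from d(4,5) n have e: "G = F" "H = F" "cls (lab F) i = cls (lab F) j" "cls (lab F) j = cls (lab F) k"
    by (auto simp: gr_def)
  have "i \<noteq> k" using d(7) n e nd_eq_iff by metis
  then show False using d(6) n e by (simp add: gr_def)
qed

lemma diamond_C_iff:
  assumes u: "nd u = C F j"
  shows "diamond (gr lab) u \<longleftrightarrow> 2 \<le> card (set F) \<and> (\<exists>k. k \<noteq> j \<and> cls (lab F) k = cls (lab F) j)"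
    (is "?L \<longleftrightarrow> ?R")
proof
  assume ?L
  then obtain a b c where d: "gr lab u a" "gr lab u b" "gr lab u c" "gr lab a b" "gr lab b c" "\<not> gr lab a c" "a \<noteq> c"
    unfolding diamond_def by blast
  \<comment> \<open>A neighbour of \<open>u\<close> lying in its clique is adjacent to all other
    neighbours of \<open>u\<close>; hence the two nonadjacent ends of a diamond are members of
    \<open>F\<close>.\<close>
  have key: "gr lab p q \<or> p = q" if "gr lab u p" "gr lab u q" "nd p = C G i" for p q G i
  proof -
    have i: "nd p = C F i" "cls (lab F) j = cls (lab F) i"
      using that(1,3) unfolding gr_C[OF u] by auto
    show ?thesis
    proof (cases "nd q")
      case (V y)
      then show ?thesis using that(2) unfolding gr_C[OF u] gr_C[OF i(1)] by simp
    next
      case (C H k)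
      then have k: "nd q = C F k" "cls (lab F) j = cls (lab F) k"
        using that(2) unfolding gr_C[OF u] by auto
      show ?thesis
      proof (cases "i = k")
        case True
        then have "nd p = nd q" using i k by simp
        then show ?thesis by simp
      next
        case False
        then show ?thesis using i k by (simp add: gr_def)
      qed
    qed
  qed
  obtain x where x: "nd a = V x"
    using key[of a c] d by (cases "nd a") auto
  obtain y where y: "nd c = V y"
    using key[of c a] d adj_sym unfolding gr_def by (cases "nd c") auto
  have xF: "x \<in> set F" and yF: "y \<in> set F"
    using d(1,3) x y unfolding gr_C[OF u] by simp_all
  have "x \<noteq> y" using d(7) x y nd_eq_iff by metis
  then have "card {x, y} \<le> card (set F)" using xF yF by (intro card_mono) auto
  moreover have "\<exists>k. k \<noteq> j \<and> cls (lab F) k = cls (lab F) j"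
  proof (cases "nd b")
    case (V z)
    then show ?thesis using d(4) x by (simp add: gr_def)
  next
    case (C G k)
    then show ?thesis using d(2) unfolding gr_C[OF u] by (intro exI[of _ k]) auto
  qed
  ultimately show ?R using \<open>x \<noteq> y\<close> by simp
next
  assume R: ?R
  then obtain k where k: "k \<noteq> j" "cls (lab F) k = cls (lab F) j" by blast
  from R obtain X where "X \<subseteq> set F" "card X = 2" by (meson obtain_subset_with_card_n)
  then obtain x y where xy: "x \<in> set F" "y \<in> set F" "x \<noteq> y" by (auto simp: card_2_iff)
  show ?L unfolding diamond_def
    by (rule exI[of _ "un (V x)"], rule exI[of _ "un (C F k)"], rule exI[of _ "un (V y)"])
      (use xy k u in \<open>simp add: gr_def del: un.simps\<close>, simp)
qed

text \<open>A vertex \<open>V a\<close> has a diamond neighbour over the two-element list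
  \<open>[a, Suc a]\<close>. A diamond neighbour of a clique vertex lies in the same clique and
  passes the property on to it.\<close>

lemma is_vertex_iff: "is_vertex (gr lab) u \<longleftrightarrow> (\<exists>a. nd u = V a)"
proof (cases "nd u")
  case (V a)
  obtain j k where jk: "j \<noteq> k" "cls (lab [a, Suc a]) j = cls (lab [a, Suc a]) k"
    using two_in_cls by blast
  have "diamond (gr lab) (un (C [a, Suc a] j))"
    unfolding diamond_C_iff[OF nd_un] using jk by auto
  moreover have "gr lab u (un (C [a, Suc a] j))"
    unfolding gr_def nd_un V by simp
  ultimately show ?thesis
    using V not_diamond_V[OF V] unfolding is_vertex_def by auto
next
  case (C F j)
  have "diamond (gr lab) u" if v: "gr lab u v" "diamond (gr lab) v" for v
  proof (cases "nd v")
    case (V a)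
    then show ?thesis using not_diamond_V v(2) by blast
  next
    case (C G k)
    then have "G = F" "k \<noteq> j" "cls (lab F) k = cls (lab F) j"
      using v(1) \<open>nd u = C F j\<close> by (auto simp: gr_def)
    then show ?thesis
      using v(2) C unfolding diamond_C_iff[OF C] diamond_C_iff[OF \<open>nd u = C F j\<close>] by blast
  qed
  then show ?thesis using C unfolding is_vertex_def by auto
qed

text \<open>An infinite clique is sent to infinitely many pairwise adjacent clique vertices, hence
  into one infinite clique over some \<open>H\<close>. Preserved adjacency gives one inclusion
  between the image of \<open>F\<close> and \<open>set H\<close>, the first-order statement
  \<open>cover_fm\<close> the other. Only sets are compared, since adjacency does not see the order
  of a list.\<close>

lemma elem_emb_imp_hypergraph_map:
  assumes h: "elem_emb (gr la) (gr lb) h"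
  shows "\<exists>g. inj g \<and> (\<forall>F. la F \<and> 2 \<le> card (set F) \<longrightarrow> (\<exists>G. lb G \<and> set G = g ` set F))"
proof -
  have hs: "sat (gr la) s p \<longleftrightarrow> sat (gr lb) (\<lambda>i. h (s i)) p" for s p
    using h by (simp add: elem_emb_def comp_def)
  have rel: "gr la u v \<longleftrightarrow> gr lb (h u) (h v)" for u v
    using hs[of "(\<lambda>_. v)(0 := u)" "FRel 0 1"] by simp
  have h_inj: "u = v \<longleftrightarrow> h u = h v" for u v
    using hs[of "(\<lambda>_. v)(0 := u)" "FEq 0 1"] by simp
  have diam: "diamond (gr la) u \<longleftrightarrow> diamond (gr lb) (h u)" for u
    using hs[of "\<lambda>_. u" "diamond_fm 0"] by (simp add: sat_diamond_fm)
  have vert: "is_vertex (gr la) u \<longleftrightarrow> is_vertex (gr lb) (h u)" for u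
    using hs[of "\<lambda>_. u" "vertex_fm 0"] by (simp add: sat_vertex_fm)
  have "\<exists>b. nd (h (un (V a))) = V b" for a
    using vert[of "un (V a)"] unfolding is_vertex_iff nd_un by blast
  then obtain g where g: "\<And>a. nd (h (un (V a))) = V (g a)" by metis
  then have hV: "h (un (V a)) = un (V (g a))" for a by (metis un_nd)
  have "inj g"
  proof (rule injI)
    fix a b assume "g a = g b"
    then have "h (un (V a)) = h (un (V b))" by (simp only: hV)
    then have "un (V a) = un (V b)" by (rule h_inj[THEN iffD2])
    then show "a = b" by simp
  qed
  moreover have "\<exists>G. lb G \<and> set G = g ` set F" if F: "la F" "2 \<le> card (set F)" for F
  proof -
    \<comment> \<open>The odd positions run through the infinite clique at \<open>F\<close>.\<close>
    define c where "c j = un (C F (Suc (2 * j)))" for j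
    have nd_c: "nd (c j) = C F (Suc (2 * j))" for j by (simp only: c_def nd_un)
    have cc: "gr la (c i) (c j) \<longleftrightarrow> i \<noteq> j" for i j
      using F(1) by (simp add: gr_def nd_c cls_def)
    have "diamond (gr la) (c j)" for j
      unfolding diamond_C_iff[OF nd_c] using F by (auto simp: cls_def intro!: exI[of _ "Suc (2 * Suc j)"])
    then have "diamond (gr lb) (h (c j))" for j using diam by simp
    then have "\<exists>G k. nd (h (c j)) = C G k" for j
      by (cases "nd (h (c j))") (use not_diamond_V in blast)+
    then obtain G k where Gk: "\<And>j. nd (h (c j)) = C (G j) (k j)" by metis
    have adj_c: "G i = G j \<and> k i \<noteq> k j \<and> cls (lb (G i)) (k i) = cls (lb (G i)) (k j)" if "i \<noteq> j" for i j
      using cc[of i j] that unfolding rel gr_C[OF Gk] by (auto simp: Gk)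
    define H where "H = G 0"
    have GH: "G j = H" for j using adj_c[of 0 j] by (cases "j = 0") (auto simp: H_def)
    have "k j \<in> {i. cls (lb H) i = cls (lb H) (k 0)}" for j
      using adj_c[of 0 j] by (cases "j = 0") (auto simp: GH)
    then have sub: "range k \<subseteq> {i. cls (lb H) i = cls (lb H) (k 0)}" by blast
    have "inj k" using adj_c unfolding inj_on_def by blast
    then have "infinite (range k)" by (rule range_inj_infinite)
    then have "infinite {i. cls (lb H) i = cls (lb H) (k 0)}"
      using sub by (blast intro: finite_subset)
    then have "cls (lb H) (k 0) = 0"
      using finite_card_cls[of "lb H"] by (cases "cls (lb H) (k 0)") auto
    then have lb: "lb H" by (rule cls_eq_0)
    have "set H = g ` set F"
    proof (intro equalityI subsetI)
      fix b assume "b \<in> g ` set F"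
      then obtain a where a: "a \<in> set F" "b = g a" by blast
      then have "gr la (c 0) (un (V a))" unfolding gr_C[OF nd_c] nd_un by blast
      then have "gr lb (h (c 0)) (un (V (g a)))" unfolding rel hV .
      then show "b \<in> set H" unfolding gr_C[OF Gk] nd_un using a GH by auto
    next
      fix b assume b: "b \<in> set H"
      define xs where "xs = map (\<lambda>a. un (V a)) F"
      \<comment> \<open>Variable 0 holds a clique vertex and variables 1 to \<open>length xs\<close>
        hold the members of \<open>F\<close>, as \<open>cover_fm\<close> expects.\<close>
      define s where "s = (\<lambda>i. case i of 0 \<Rightarrow> c 0 | Suc i \<Rightarrow> if i < length xs then xs ! i else 0)"
      have ran: "(\<exists>i\<in>{1..length xs}. y = f (s i)) \<longleftrightarrow> (\<exists>x\<in>set xs. y = f x)" for y and f :: "nat \<Rightarrow> nat"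
      proof
        assume "\<exists>i\<in>{1..length xs}. y = f (s i)"
        then obtain i where "i \<in> {1..length xs}" "y = f (s i)" by blast
        then show "\<exists>x\<in>set xs. y = f x" by (cases i) (auto simp: s_def Suc_le_eq)
      next
        assume "\<exists>x\<in>set xs. y = f x"
        then obtain i where "i < length xs" "y = f (xs ! i)" by (auto simp: in_set_conv_nth)
        then show "\<exists>i\<in>{1..length xs}. y = f (s i)" by (intro bexI[of _ "Suc i"]) (auto simp: s_def)
      qed
      have "\<exists>x\<in>set xs. y = x" if y: "gr la (c 0) y" "is_vertex (gr la) y" for y
      proof -
        obtain a where "a \<in> set F" "nd y = V a"
          using y unfolding gr_C[OF nd_c] is_vertex_iff by auto
        moreover from this(2) have "y = un (V a)" by (metis un_nd)
        ultimately show ?thesis by (simp add: xs_def)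
      qed
      then have "sat (gr la) s (cover_fm (length xs))"
        unfolding sat_cover_fm ran[of _ "\<lambda>x. x"] by (simp add: s_def)
      then have "sat (gr lb) (\<lambda>i. h (s i)) (cover_fm (length xs))" by (simp only: hs)
      then have cov: "gr lb (h (c 0)) y \<Longrightarrow> is_vertex (gr lb) y \<Longrightarrow> \<exists>x\<in>set xs. y = h x" for y
        unfolding sat_cover_fm ran by (simp add: s_def)
      have "\<exists>x\<in>set xs. un (V b) = h x"
        by (rule cov) (use b in \<open>auto simp: gr_C[OF Gk] GH is_vertex_iff simp del: un.simps\<close>)
      then obtain a where "a \<in> set F" "un (V b) = un (V (g a))"
        unfolding xs_def by (auto simp: hV simp del: un.simps)
      then show "b \<in> g ` set F" by simp
    qed
    then show ?thesis using lb by blast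
  qed
  ultimately show ?thesis by blast
qed

section \<open>Hypergraphs coding a \<open>\<Sigma>\<^sup>1\<^sub>1\<close> quasi-order\<close>

lemma prod_encode_mono: "a \<le> a' \<Longrightarrow> b \<le> b' \<Longrightarrow> prod_encode (a, b) \<le> prod_encode (a', b')"
proof -
  assume ab: "a \<le> a'" "b \<le> b'"
  have "triangle (a + b) \<le> triangle (a' + b')" by (rule lift_Suc_mono_le) (use ab in simp_all)
  then show ?thesis using ab by (simp add: prod_encode_def)
qed

text \<open>Pairing is monotone in both arguments. The resulting bound on codes later bounds the
  quantifier over \<open>u\<close> in \<open>admits\<close>.\<close>

lemma list_encode_mono: "list_all2 (\<le>) xs ys \<Longrightarrow> list_encode xs \<le> list_encode ys"
  by (induction rule: list_all2_induct) (auto intro: prod_encode_mono)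

text \<open>A list is kept extendible to good lists of every length. One of the finitely many next
  entries bounded by \<alpha> preserves this, and the successive choices form
  \<open>f\<close>.\<close>

lemma koenig:
  fixes \<alpha> :: "nat \<Rightarrow> nat"
  assumes ex: "\<And>n. \<exists>u. length u = n \<and> (\<forall>i<n. u ! i \<le> \<alpha> i) \<and> (\<forall>m\<le>n. P (take m u))"
  shows "\<exists>f. \<forall>n. P (map f [0..<n])"
proof -
  define good where "good n u \<longleftrightarrow> length u = n \<and> (\<forall>i<n. u ! i \<le> \<alpha> i) \<and> (\<forall>m\<le>n. P (take m u))" for n u
  define ext where "ext s \<longleftrightarrow> (\<forall>n\<ge>length s. \<exists>u. good n u \<and> take (length s) u = s)" for s
  have ext_Nil: "ext []" using ex by (simp add: ext_def good_def)
  have step: "\<exists>a. ext (s @ [a])" if s: "ext s" for s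
  proof (rule ccontr)
    assume "\<nexists>a. ext (s @ [a])"
    then have "\<forall>a. \<exists>n. Suc (length s) \<le> n \<and> \<not> (\<exists>u. good n u \<and> take (Suc (length s)) u = s @ [a])"
      by (simp add: ext_def)
    then obtain b where b: "\<And>a. Suc (length s) \<le> b a"
      "\<And>a. \<not> (\<exists>u. good (b a) u \<and> take (Suc (length s)) u = s @ [a])"
      by metis
    \<comment> \<open>If every next entry failed at some length, a good list of the largest of these
      lengths would contradict the failure of its own entry.\<close>
    define N where "N = Max (b ` {..\<alpha> (length s)})"
    have N: "b a \<le> N" if "a \<le> \<alpha> (length s)" for a using that by (simp add: N_def)
    have lN: "length s < N" using N[of 0] b(1)[of 0] by simp
    then obtain u where u: "good N u" "take (length s) u = s"
      using s unfolding ext_def by (meson less_imp_le)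
    define a where "a = u ! length s"
    have a: "a \<le> \<alpha> (length s)" using u(1) lN by (simp add: a_def good_def)
    have "good (b a) (take (b a) u)"
      using u(1) N[OF a] by (auto simp: good_def min_def)
    moreover have "take (Suc (length s)) (take (b a) u) = s @ [a]"
      using u lN b(1)[of a] by (simp add: take_Suc_conv_app_nth a_def good_def min_def)
    ultimately show False using b(2)[of a] by blast
  qed
  define nxt where "nxt s = s @ [SOME a. ext (s @ [a])]" for s
  define sq where "sq n = (nxt ^^ n) []" for n
  have sq: "ext (sq n) \<and> length (sq n) = n" for n
  proof (induction n)
    case 0 then show ?case by (simp add: sq_def ext_Nil)
  next
    case (Suc n)
    then have "ext (nxt (sq n))" unfolding nxt_def by (intro someI_ex[OF step]) simp
    then show ?case using Suc by (simp add: sq_def nxt_def)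
  qed
  define f where "f n = sq (Suc n) ! n" for n
  have "map f [0..<n] = sq n" for n
  proof (induction n)
    case 0 then show ?case by (simp add: sq_def)
  next
    case (Suc n)
    have e: "sq (Suc n) = sq n @ [SOME a. ext (sq n @ [a])]" by (simp add: sq_def nxt_def)
    then have "f n = (SOME a. ext (sq n @ [a]))"
      using sq[of n] by (simp add: f_def nth_append)
    then show ?case using Suc e by simp
  qed
  moreover have "P (sq n)" for n
  proof -
    obtain u where "good n u" "take n u = sq n"
      using sq[of n] unfolding ext_def by (metis order_refl)
    then show ?thesis by (metis good_def order_refl)
  qed
  ultimately show ?thesis by metis
qed

text \<open>The list \<open>u\<close> is an initial segment of a possible witness for
  \<open>R w w'\<close>; dominating it by \<open>F\<close> instead of storing it in \<open>F\<close>
  allows the entries of \<open>F\<close> to grow.\<close>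

definition admits :: "(nat \<Rightarrow> nat \<Rightarrow> nat \<Rightarrow> bool) \<Rightarrow> nat list \<Rightarrow> nat \<Rightarrow> nat \<Rightarrow> bool" where
  "admits K F w w' \<longleftrightarrow> (\<exists>u. list_all2 (\<le>) u F \<and> (\<forall>m\<le>length F. K w w' (list_encode (take m u))))"

text \<open>The reflexive transitive closure of \<open>admits K F\<close> below \<open>hd F\<close>, in a form whose quantifier over \<open>r\<close>
  can be bounded. The closure makes hyperedges respect transitivity, the bound makes the argument by compactness
  in \<open>chained_path\<close> finite.\<close>

definition chained :: "(nat \<Rightarrow> nat \<Rightarrow> nat \<Rightarrow> bool) \<Rightarrow> nat list \<Rightarrow> nat \<Rightarrow> nat \<Rightarrow> bool" where
  "chained K F x y \<longleftrightarrow> x = y \<or> (x \<le> hd F \<and> y \<le> hd F \<and>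
    (\<forall>r. x \<in> r \<and> (\<forall>w\<le>hd F. \<forall>w'\<le>hd F. w \<in> r \<and> admits K F w w' \<longrightarrow> w' \<in> r) \<longrightarrow> y \<in> r))"

text \<open>Since \<open>pi1\<close> takes each value at arbitrarily large numbers, every source of
  a chain is coded by unbounded lengths. The levels make the entries distinct and recoverable from
  their set; two entries are what a diamond needs.\<close>

definition hyperedge :: "(nat \<Rightarrow> nat \<Rightarrow> nat \<Rightarrow> bool) \<Rightarrow> nat \<Rightarrow> nat list \<Rightarrow> bool" where
  "hyperedge K x F \<longleftrightarrow> 2 \<le> length F \<and> (\<forall>i<length F. pi1 (F ! i) = i) \<and> chained K F (pi1 (length F)) x"

lemma admits_mono:
  assumes "list_all2 (\<le>) F G" "admits K F w w'"
  shows "admits K G w w'"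
proof -
  from assms(2) obtain u where u: "list_all2 (\<le>) u F" "\<forall>m\<le>length F. K w w' (list_encode (take m u))"
    unfolding admits_def by blast
  have "list_all2 (\<le>) u G" using u(1) assms(1) by (rule list_all2_trans[rotated]) auto
  moreover have "length F = length G" using assms(1) by (rule list_all2_lengthD)
  ultimately show ?thesis using u(2) unfolding admits_def by auto
qed

lemma admits_map_mono:
  assumes "n \<le> n'" "admits K (map \<alpha> [0..<n']) w w'"
  shows "admits K (map \<alpha> [0..<n]) w w'"
proof -
  from assms(2) obtain u where u: "list_all2 (\<le>) u (map \<alpha> [0..<n'])" "\<forall>m\<le>n'. K w w' (list_encode (take m u))"
    unfolding admits_def by auto
  have "list_all2 (\<le>) (take n u) (map \<alpha> [0..<n])"
    using list_all2_takeI[OF u(1), of n] assms(1) by (simp add: take_map)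
  moreover have "\<forall>m\<le>n. K w w' (list_encode (take m (take n u)))"
    using u(2) assms(1) by (simp add: min_def)
  ultimately show ?thesis unfolding admits_def by auto
qed

lemma admits_koenig:
  assumes "\<And>n. admits K (map \<alpha> [0..<n]) w w'"
  shows "\<exists>f. \<forall>n. K w w' (list_encode (map f [0..<n]))"
proof (rule koenig)
  fix n
  from assms[of n] obtain u where "list_all2 (\<le>) u (map \<alpha> [0..<n])" "\<forall>m\<le>n. K w w' (list_encode (take m u))"
    unfolding admits_def by auto
  then show "\<exists>u. length u = n \<and> (\<forall>i<n. u ! i \<le> \<alpha> i) \<and> (\<forall>m\<le>n. K w w' (list_encode (take m u)))"
    by (intro exI[of _ u]) (auto simp: list_all2_conv_all_nth)
qed

text \<open>The shift by \<open>f i + x + y\<close> on level \<open>i\<close> does three things: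
  larger entries keep old chains valid, they dominate \<open>f\<close> and so admit the step from
  \<open>x\<close> to \<open>y\<close>, and the first entry becomes large enough to bound
  both.\<close>

lemma hyperedge_map:
  assumes f: "\<And>n. K x y (list_encode (map f [0..<n]))"
  shows "\<exists>g. inj g \<and> (\<forall>F. hyperedge K x F \<longrightarrow> hyperedge K y (map g F))"
proof -
  define g where "g a = prod_encode (pi1 a, pi2 a + (f (pi1 a) + x + y))" for a
  have "inj g"
  proof (rule injI)
    fix a b assume *: "g a = g b"
    have "pi1 a = pi1 b" using arg_cong[OF *, of pi1] by (simp add: g_def)
    moreover then have "pi2 a = pi2 b" using arg_cong[OF *, of pi2] by (simp add: g_def)
    ultimately show "a = b" by (metis pi_encode)
  qed
  moreover have "hyperedge K y (map g F)" if F: "hyperedge K x F" for F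
  proof -
    from F have len: "2 \<le> length F" and lev: "\<And>i. i < length F \<Longrightarrow> pi1 (F ! i) = i"
      and ch: "chained K F (pi1 (length F)) x"
      unfolding hyperedge_def by auto
    have "a \<le> g a" for a
      using prod_encode_mono[of "pi1 a" "pi1 a" "pi2 a" "pi2 a + (f (pi1 a) + x + y)"] by (simp add: g_def)
    then have le: "list_all2 (\<le>) F (map g F)" by (auto simp: list_all2_conv_all_nth)
    have ge: "f (pi1 a) + x + y \<le> g a" for a
      unfolding g_def using le_prod_encode_2 by (rule order_trans[rotated]) simp
    have adm: "admits K (map g F) x y"
      unfolding admits_def
    proof (intro exI conjI allI impI)
      have "f i \<le> g (F ! i)" if "i < length F" for i using ge[of "F ! i"] lev[OF that] by simp
      then show "list_all2 (\<le>) (map f [0..<length F]) (map g F)"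
        by (auto simp: list_all2_conv_all_nth)
      show "K x y (list_encode (take m (map f [0..<length F])))" if "m \<le> length (map g F)" for m
        using f[of m] that by (simp add: take_map)
    qed
    have hd: "hd F \<le> hd (map g F)" "x \<le> hd (map g F)" "y \<le> hd (map g F)"
      using len ge[of "hd F"] \<open>\<And>a. a \<le> g a\<close> by (cases F; auto)+
    have "chained K (map g F) (pi1 (length F)) y"
      unfolding chained_def
    proof (intro disjI2 conjI allI impI)
      \<comment> \<open>If the old chain is trivial, its source is \<open>x\<close>, which the
        shifted first entry bounds.\<close>
      show "pi1 (length F) \<le> hd (map g F)"
        using ch[unfolded chained_def] hd by (elim disjE conjE) (simp, linarith)
      show "y \<le> hd (map g F)" by (rule hd)
      fix r assume r: "pi1 (length F) \<in> r \<and>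
        (\<forall>w\<le>hd (map g F). \<forall>w'\<le>hd (map g F). w \<in> r \<and> admits K (map g F) w w' \<longrightarrow> w' \<in> r)"
      have closed: "\<forall>w\<le>hd F. \<forall>w'\<le>hd F. w \<in> r \<and> admits K F w w' \<longrightarrow> w' \<in> r"
      proof (intro allI impI, elim conjE)
        fix w w' assume "w \<le> hd F" "w' \<le> hd F" "w \<in> r" "admits K F w w'"
        then show "w' \<in> r"
          using r[THEN conjunct2, rule_format, of w w'] admits_mono[OF le] hd(1) by simp
      qed
      have "x \<in> r"
      proof (cases "pi1 (length F) = x")
        case True
        then show ?thesis using r by (simp only:)
      next
        case False
        have "\<forall>r. pi1 (length F) \<in> r \<and> (\<forall>w\<le>hd F. \<forall>w'\<le>hd F. w \<in> r \<and> admits K F w w' \<longrightarrow> w' \<in> r) \<longrightarrow> x \<in> r"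
          using ch[unfolded chained_def] False by (elim disjE conjE) (rule notE)
        from this[THEN spec, of r] show ?thesis
          by (rule mp) (rule conjI[OF r[THEN conjunct1] closed])
      qed
      \<comment> \<open>The step from \<open>x\<close> to \<open>y\<close> is appended to the old
        chain.\<close>
      then show "y \<in> r" using r[THEN conjunct2, rule_format, of x y] hd adm by simp
    qed
    then show ?thesis using len lev by (simp add: hyperedge_def g_def)
  qed
  ultimately show ?thesis by blast
qed

lemma chained_path:
  assumes R: "\<And>x y. R x y \<longleftrightarrow> (\<exists>f. \<forall>n. K x y (list_encode (map f [0..<n])))"
    and qo: "quasi_order R"
    and path: "\<And>N. \<exists>n\<ge>N. n > 0 \<and> chained K (map \<alpha> [0..<n]) x y"
  shows "R x y"
proof -
  have refl: "R w w" and trans: "R u v \<Longrightarrow> R v w \<Longrightarrow> R u w" for u v w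
    using qo unfolding quasi_order_def by (blast dest: reflpD transpD)+
  have "\<exists>n. \<not> R w w' \<longrightarrow> \<not> admits K (map \<alpha> [0..<n]) w w'" for w w'
    using admits_koenig[of K \<alpha> w w'] R[of w w'] by blast
  then obtain b where b: "\<And>w w'. \<not> R w w' \<Longrightarrow> \<not> admits K (map \<alpha> [0..<b w w']) w w'"
    by metis
  define N where "N = Max ((\<lambda>(w, w'). b w w') ` ({..\<alpha> 0} \<times> {..\<alpha> 0}))"
  have N: "b w w' \<le> N" if "w \<le> \<alpha> 0" "w' \<le> \<alpha> 0" for w w'
    unfolding N_def by (rule Max_ge) (use that in auto)
  obtain n where n: "N \<le> n" "0 < n" "chained K (map \<alpha> [0..<n]) x y" using path by blast
  have hd: "hd (map \<alpha> [0..<n]) = \<alpha> 0" using n(2) by (simp add: hd_map)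
  show ?thesis
  proof (cases "x = y")
    case False
    \<comment> \<open>The \<open>R\<close>-successors of \<open>x\<close> form one of the closed
      sets quantified over in \<open>chained\<close>.\<close>
    have "\<forall>w\<le>\<alpha> 0. \<forall>w'\<le>\<alpha> 0. w \<in> Collect (R x) \<and> admits K (map \<alpha> [0..<n]) w w' \<longrightarrow> w' \<in> Collect (R x)"
    proof (intro allI impI)
      fix w w' assume w: "w \<le> \<alpha> 0" "w' \<le> \<alpha> 0" "w \<in> Collect (R x) \<and> admits K (map \<alpha> [0..<n]) w w'"
      then have "admits K (map \<alpha> [0..<b w w']) w w'"
        using N[OF w(1,2)] n(1) by (intro admits_map_mono[of "b w w'" n]) auto
      then have "R w w'" using b by blast
      then show "w' \<in> Collect (R x)" using w(3) trans by blast
    qed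
    then have "y \<in> Collect (R x)"
      using n(3) False refl unfolding chained_def hd by blast
    then show ?thesis by simp
  qed (simp add: refl)
qed

text \<open>The first \<open>n\<close> vertices \<open>prod_encode (i, 0)\<close> form a hyperedge
  of \<open>x\<close> whenever \<open>2 \<le> n\<close> and \<open>pi1 n = x\<close>, by the trivial
  chain. Their images under \<open>g\<close> are nested and underlie hyperedges of \<open>y\<close>
  along one branch \<alpha>, to which the compactness argument applies.\<close>

lemma hyperedge_map_imp:
  assumes R: "\<And>x y. R x y \<longleftrightarrow> (\<exists>f. \<forall>n. K x y (list_encode (map f [0..<n])))"
    and qo: "quasi_order R"
    and g: "inj g" "\<And>F. hyperedge K x F \<Longrightarrow> 2 \<le> card (set F) \<Longrightarrow> \<exists>G. hyperedge K y G \<and> set G = g ` set F"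
  shows "R x y"
proof -
  have "\<exists>G. length G = n \<and> hyperedge K y G \<and> set G = g ` (\<lambda>i. prod_encode (i, 0)) ` {..<n}"
    if n: "2 \<le> n" "pi1 n = x" for n
  proof -
    define F where "F = map (\<lambda>i. prod_encode (i, 0)) [0..<n]"
    have inj: "inj (\<lambda>i. prod_encode (i, 0))" by (auto simp: inj_on_def)
    have set_F: "set F = (\<lambda>i. prod_encode (i, 0)) ` {..<n}" by (auto simp: F_def)
    have card_F: "card (set F) = n" unfolding set_F using inj by (simp add: card_image inj_on_subset)
    have "hyperedge K x F" using n by (simp add: F_def hyperedge_def chained_def)
    then obtain G where G: "hyperedge K y G" "set G = g ` set F"
      using g(2)[of F] n card_F by auto
    have "distinct G"
      using G(1) unfolding hyperedge_def distinct_conv_nth by metis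
    then have "length G = card (g ` set F)" using G(2) by (metis distinct_card)
    then have "length G = n" using card_F g(1) by (simp add: card_image inj_on_subset)
    then show ?thesis using G set_F by auto
  qed
  then obtain G where G: "\<And>n. 2 \<le> n \<Longrightarrow> pi1 n = x \<Longrightarrow> length (G n) = n \<and> hyperedge K y (G n) \<and>
      set (G n) = g ` (\<lambda>i. prod_encode (i, 0)) ` {..<n}"
    by metis
  \<comment> \<open>A hyperedge has exactly one vertex on each level below its length, so nested
    hyperedges agree entry by entry.\<close>
  have coh: "G n ! i = G m ! i" if n: "2 \<le> n" "pi1 n = x" and m: "2 \<le> m" "pi1 m = x" and "n \<le> m" "i < n" for n m i
  proof -
    have "G n ! i \<in> set (G n)" using G[OF n] \<open>i < n\<close> by (intro nth_mem) simp
    then have "G n ! i \<in> set (G m)" using G[OF n] G[OF m] \<open>n \<le> m\<close> by auto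
    then obtain j where "j < length (G m)" and j: "G m ! j = G n ! i" unfolding in_set_conv_nth by auto
    then have "j < m" using G[OF m] by simp
    have "pi1 (G m ! j) = j" "pi1 (G n ! i) = i"
      using G[OF m] G[OF n] \<open>j < m\<close> \<open>i < n\<close> unfolding hyperedge_def by auto
    then show ?thesis using j by simp
  qed
  \<comment> \<open>A length above \<open>i\<close> whose source is \<open>x\<close>; adding 2
    ensures the minimal length of a hyperedge.\<close>
  define k where "k i = prod_encode (x, i + 2)" for i
  have k: "2 \<le> k i" "pi1 (k i) = x" "i < k i" for i
    using le_prod_encode_2[of "i + 2" x] by (simp_all add: k_def)
  define \<alpha> where "\<alpha> i = G (k i) ! i" for i
  have G_eq: "G n = map \<alpha> [0..<n]" if n: "2 \<le> n" "pi1 n = x" for n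
  proof (rule nth_equalityI)
    show "length (G n) = length (map \<alpha> [0..<n])" using G[OF n] by simp
    fix i assume "i < length (G n)"
    then have i: "i < n" using G[OF n] by simp
    have "G n ! i = G (k i) ! i"
    proof (cases "n \<le> k i")
      case True
      show ?thesis by (rule coh[OF n k(1,2) True i])
    next
      case False
      then have "k i \<le> n" by simp
      then show ?thesis by (rule coh[OF k(1,2) n _ k(3), symmetric])
    qed
    then show "G n ! i = map \<alpha> [0..<n] ! i" using i by (simp add: \<alpha>_def)
  qed
  show ?thesis
  proof (rule chained_path[OF R qo])
    fix N
    have "chained K (map \<alpha> [0..<k N]) x y"
      using G[OF k(1,2), of N] k(2)[of N] unfolding G_eq[OF k(1,2)] hyperedge_def by simp
    then show "\<exists>n\<ge>N. n > 0 \<and> chained K (map \<alpha> [0..<n]) x y"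
      using k(1,3)[of N] by (intro exI[of _ "k N"]) auto
  qed
qed

section \<open>Decidability of hyperedges and of the graphs\<close>

lemma list_all2_nth0: "list_all2 (\<le>) u F \<longleftrightarrow> length u = length F \<and> (\<forall>i<length F. nth0 u i \<le> nth0 F i)"
  by (auto simp: list_all2_conv_all_nth nth0_def)

lemma admits_code: "admits K (list_decode v) w w' \<longleftrightarrow>
  (\<exists>u\<le>v. lenc u = lenc v \<and> (\<forall>i<lenc v. nthc u i \<le> nthc v i) \<and> (\<forall>m\<le>lenc v. K w w' (takec m u)))"
proof
  assume "admits K (list_decode v) w w'"
  then obtain u where u: "list_all2 (\<le>) u (list_decode v)" "\<forall>m\<le>lenc v. K w w' (list_encode (take m u))"
    unfolding admits_def lenc_def by blast
  then show "\<exists>u\<le>v. lenc u = lenc v \<and> (\<forall>i<lenc v. nthc u i \<le> nthc v i) \<and> (\<forall>m\<le>lenc v. K w w' (takec m u))"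
    using list_encode_mono[OF u(1)]
    by (intro exI[of _ "list_encode u"]) (auto simp: takec_def list_all2_nth0 lenc_def nthc_def)
next
  assume "\<exists>u\<le>v. lenc u = lenc v \<and> (\<forall>i<lenc v. nthc u i \<le> nthc v i) \<and> (\<forall>m\<le>lenc v. K w w' (takec m u))"
  then obtain u where "lenc u = lenc v \<and> (\<forall>i<lenc v. nthc u i \<le> nthc v i) \<and> (\<forall>m\<le>lenc v. K w w' (takec m u))"
    by blast
  then show "admits K (list_decode v) w w'"
    unfolding admits_def by (intro exI[of _ "list_decode u"]) (auto simp: takec_def list_all2_nth0 lenc_def nthc_def)
qed

lemma set_encode_less: "r \<subseteq> {..b} \<Longrightarrow> set_encode r < 2 ^ Suc b"
proof -
  assume r: "r \<subseteq> {..b}"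
  have "set_encode r \<le> (\<Sum>i\<le>b. 2 ^ i)" unfolding set_encode_def by (rule sum_mono2) (use r in auto)
  also have "(\<Sum>i\<le>b. 2 ^ i) < (2::nat) ^ Suc b" by (induction b) auto
  finally show ?thesis .
qed

text \<open>Only elements up to \<open>hd F\<close> matter for closure, so \<open>r\<close> may be
  cut down to a finite set, whose binary code is below \<open>2 ^ Suc (hd F)\<close>.\<close>

lemma chained_code: "chained K F x y \<longleftrightarrow> x = y \<or> (x \<le> hd F \<and> y \<le> hd F \<and>
    (\<forall>r<2 ^ Suc (hd F). x \<in> set_decode r \<and>
      (\<forall>w\<le>hd F. \<forall>w'\<le>hd F. w \<in> set_decode r \<and> admits K F w w' \<longrightarrow> w' \<in> set_decode r) \<longrightarrow> y \<in> set_decode r))"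
  (is "_ \<longleftrightarrow> x = y \<or> ?S")
proof
  assume R: "x = y \<or> ?S"
  have key: "y \<in> r" if r: "x \<le> hd F" "y \<le> hd F" "x \<in> r"
    "\<forall>w\<le>hd F. \<forall>w'\<le>hd F. w \<in> r \<and> admits K F w w' \<longrightarrow> w' \<in> r" "x \<noteq> y" for r
  proof -
    define r' where "r' = r \<inter> {..hd F}"
    have "finite r'" by (simp add: r'_def)
    then have d: "set_decode (set_encode r') = r'" by simp
    have q1: "set_encode r' < 2 ^ Suc (hd F)" by (rule set_encode_less) (simp add: r'_def)
    have q2: "x \<in> r'" using r(1,3) by (simp add: r'_def)
    have q3: "w' \<in> r'" if w: "w \<le> hd F" "w' \<le> hd F" "w \<in> r'" "admits K F w w'" for w w'
      using r(4)[rule_format, of w w'] w by (simp add: r'_def)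
    have q4: "\<forall>r<2 ^ Suc (hd F). x \<in> set_decode r \<and>
      (\<forall>w\<le>hd F. \<forall>w'\<le>hd F. w \<in> set_decode r \<and> admits K F w w' \<longrightarrow> w' \<in> set_decode r) \<longrightarrow> y \<in> set_decode r"
      using R r(5) by (elim disjE conjE) (rule notE)
    have "y \<in> set_decode (set_encode r')"
    proof (rule q4[THEN spec, THEN mp, OF q1, THEN mp], unfold d, intro conjI allI impI)
      show "x \<in> r'" by (rule q2)
      show "w' \<in> r'" if "w \<le> hd F" "w' \<le> hd F" "w \<in> r' \<and> admits K F w w'" for w w'
        using that(3) by (elim conjE) (rule q3[OF that(1,2)])
    qed
    then have "y \<in> r'" unfolding d .
    then show ?thesis by (simp add: r'_def)
  qed
  from R show "chained K F x y"
  proof (rule disjE)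
    assume "x = y"
    then show ?thesis by (simp only: chained_def simp_thms)
  next
    assume S: ?S
    show ?thesis unfolding chained_def
    proof (cases "x = y", goal_cases)
      case 2
      show ?case
      proof (intro disjI2 conjI allI impI, goal_cases)
        case (3 r)
        then show ?case using S 2 by (elim conjE) (rule key)
      qed (rule S[THEN conjunct1] S[THEN conjunct2, THEN conjunct1])+
    qed (rule disjI1)
  qed
next
  assume "chained K F x y"
  then show "x = y \<or> ?S" unfolding chained_def
  proof (rule disjE)
    assume *: "x \<le> hd F \<and> y \<le> hd F \<and>
      (\<forall>r. x \<in> r \<and> (\<forall>w\<le>hd F. \<forall>w'\<le>hd F. w \<in> r \<and> admits K F w w' \<longrightarrow> w' \<in> r) \<longrightarrow> y \<in> r)"
    show ?thesis
    proof (rule disjI2, intro conjI)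
      show "x \<le> hd F" by (rule *[THEN conjunct1])
      show "y \<le> hd F" by (rule *[THEN conjunct2, THEN conjunct1])
      show "\<forall>r<2 ^ Suc (hd F). x \<in> set_decode r \<and>
        (\<forall>w\<le>hd F. \<forall>w'\<le>hd F. w \<in> set_decode r \<and> admits K F w w' \<longrightarrow> w' \<in> set_decode r) \<longrightarrow> y \<in> set_decode r"
        by (intro allI, rule impI, rule *[THEN conjunct2, THEN conjunct2, THEN spec])
    qed
  qed (rule disjI1)
qed

text \<open>All quantifiers are bounded in this form, so the closure rules for \<open>dec\<close>
  apply.\<close>

lemma hyperedge_code: "hyperedge K x (list_decode v) \<longleftrightarrow> 2 \<le> lenc v \<and> (\<forall>i<lenc v. pi1 (nthc v i) = i) \<and>
   (pi1 (lenc v) = x \<or> (pi1 (lenc v) \<le> nthc v 0 \<and> x \<le> nthc v 0 \<and>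
    (\<forall>r<2 ^ Suc (nthc v 0). pi1 (lenc v) \<in> set_decode r \<and>
      (\<forall>w\<le>nthc v 0. \<forall>w'\<le>nthc v 0. w \<in> set_decode r \<and>
       (\<exists>u\<le>v. lenc u = lenc v \<and> (\<forall>i<lenc v. nthc u i \<le> nthc v i) \<and> (\<forall>m\<le>lenc v. K w w' (takec m u)))
        \<longrightarrow> w' \<in> set_decode r) \<longrightarrow> x \<in> set_decode r)))"
proof (cases "2 \<le> lenc v")
  case True
  then have "hd (list_decode v) = nthc v 0"
    by (cases "list_decode v") (auto simp: lenc_def nthc_def nth0_def)
  moreover have "(\<forall>i<lenc v. pi1 (list_decode v ! i) = i) \<longleftrightarrow> (\<forall>i<lenc v. pi1 (nthc v i) = i)"
    by (simp add: lenc_def nthc_def nth0_def)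
  ultimately show ?thesis
    unfolding hyperedge_def chained_code admits_code by (simp only: lenc_def)
next
  case False
  then show ?thesis by (simp add: hyperedge_def lenc_def)
qed

lemma dec_hyperedge:
  assumes K: "dec (\<lambda>e. K (e 0) (e 1) (e 2))"
  shows "dec (\<lambda>e. hyperedge K (e 0) (list_decode (e 1)))"
  unfolding hyperedge_code by (intro rec_intros dec_comp3[OF K])

lemma fcls_pi: "fcls j = Suc (prod_encode (pi1 j, pi2 j div Suc (pi1 j)))"
  by (simp add: fcls_def pi1_def pi2_def split: prod.split)

lemma recfn_fcls: "recfn f \<Longrightarrow> recfn (\<lambda>e. fcls (f e))"
  unfolding fcls_pi by (intro rec_intros)

lemma recfn_cls: "dec P \<Longrightarrow> recfn f \<Longrightarrow> recfn (\<lambda>e. cls (P e) (f e))"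
  unfolding cls_def by (intro rec_intros recfn_fcls)

lemma gr_code: "gr lab u v \<longleftrightarrow>
  (if even u then odd v \<and> (\<exists>i<lenc (pi1 (v div 2)). nthc (pi1 (v div 2)) i = u div 2)
   else if even v then \<exists>i<lenc (pi1 (u div 2)). nthc (pi1 (u div 2)) i = v div 2
   else pi1 (u div 2) = pi1 (v div 2) \<and> pi2 (u div 2) \<noteq> pi2 (v div 2) \<and>
     cls (lab (list_decode (pi1 (u div 2)))) (pi2 (u div 2)) = cls (lab (list_decode (pi1 (u div 2)))) (pi2 (v div 2)))"
proof -
  have mem: "a \<in> set (list_decode x) \<longleftrightarrow> (\<exists>i<lenc x. nthc x i = a)" for a x
    by (auto simp: in_set_conv_nth lenc_def nthc_def nth0_def)
  have eq: "list_decode x = list_decode y \<longleftrightarrow> x = y" for x y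
    by (metis list_decode_inverse)
  show ?thesis
    by (cases "even u"; cases "even v")
      (simp_all add: gr_def nd_def mem eq pi1_def[symmetric] pi2_def[symmetric])
qed

lemma dec_gr:
  assumes "dec (\<lambda>e. lab (e 0) (list_decode (e 1)))"
  shows "dec (\<lambda>e. gr (lab (e 0)) (e 1) (e 2))"
proof -
  have lab: "dec (\<lambda>e. lab (f e) (list_decode (g e)))" if "recfn f" "recfn g" for f g
    using recfn_comp2[where F = "\<lambda>x y. if lab x (list_decode y) then 1 else 0"] assms that
    unfolding dec_def by simp
  show ?thesis unfolding gr_code by (intro rec_intros dec_if recfn_cls lab)
qed

section \<open>The reduction of quasi-orders to elementary embeddability\<close>

lemma sigma11_quasi_order_reduction:
  assumes "sigma11 R" "quasi_order R"
  obtains f where "computable f" "\<And>i j. R i j \<longleftrightarrow> EE (f i) (f j)"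
proof -
  from assms(1) obtain K where K: "dec (\<lambda>e. K (e 0) (e 1) (e 2))"
    and R: "\<And>x y. R x y \<longleftrightarrow> (\<exists>f. \<forall>n. K x y (list_encode (map f [0..<n])))"
    unfolding sigma11_def computable_rel3_iff_dec by blast
  have "\<exists>f. computable f \<and> (\<forall>x. graphE (f x) = gr (hyperedge K x))"
  proof (rule graph_index[of "\<lambda>x. gr (hyperedge K x)"])
    show "dec (\<lambda>e. gr (hyperedge K (e 0)) (e 1) (e 2))"
      by (rule dec_gr[OF dec_hyperedge[OF K]])
    show "gr (hyperedge K x) v u" if "gr (hyperedge K x) u v" for x u v
      using that adj_sym unfolding gr_def by blast
    show "\<not> gr (hyperedge K x) u u" for x u
      unfolding gr_def by (rule adj_irrefl)
  qed
  then obtain f where f: "computable f" "\<And>x. graphE (f x) = gr (hyperedge K x)" by blast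
  have "R i j \<longleftrightarrow> EE (f i) (f j)" for i j
  proof
    assume "R i j"
    then obtain \<phi> where "\<And>n. K i j (list_encode (map \<phi> [0..<n]))" using R by blast
    from hyperedge_map[of K i j \<phi>, OF this] obtain g where
      g: "inj g" "\<And>F. hyperedge K i F \<Longrightarrow> hyperedge K j (map g F)" by blast
    from elem_emb_node_map[of g "hyperedge K i" "hyperedge K j", OF this] show "EE (f i) (f j)"
      unfolding EE_def f(2) elem_embeddable_def by blast
  next
    assume "EE (f i) (f j)"
    then obtain h where "elem_emb (gr (hyperedge K i)) (gr (hyperedge K j)) h"
      unfolding EE_def f(2) elem_embeddable_def by blast
    from elem_emb_imp_hypergraph_map[OF this] obtain g where
      g: "inj g" "\<And>F. hyperedge K i F \<Longrightarrow> 2 \<le> card (set F) \<Longrightarrow> \<exists>G. hyperedge K j G \<and> set G = g ` set F"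
      by blast
    show "R i j" by (rule hyperedge_map_imp[OF R assms(2) g])
  qed
  then show thesis using that f(1) by blast
qed

section \<open>Certificates for convergent computations\<close>

lemma recfn_tlc: "recfn f \<Longrightarrow> recfn (\<lambda>e. tlc (f e))"
  using recfn_tlc_iter[OF recfn_const[of 1]] by simp

lemma tlc_encode: "tlc (list_encode (x # xs)) = list_encode xs"
  by (simp add: tlc_def)

text \<open>The judgement that \<open>c\<close> is a Goedel number.\<close>

definition code_item :: "nat \<Rightarrow> nat" where
  "code_item c = prod_encode (c, 0)"

text \<open>The judgement that program \<open>c\<close> maps the list coded by \<open>xs\<close> to
  \<open>z\<close>; the successor keeps it apart from \<open>code_item\<close>.\<close>

definition eval_item :: "nat \<Rightarrow> nat \<Rightarrow> nat \<Rightarrow> nat" where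
  "eval_item c xs z = prod_encode (c, Suc (prod_encode (xs, z)))"

definition code_rule :: "(nat \<Rightarrow> bool) \<Rightarrow> nat \<Rightarrow> bool" where
  "code_rule P c \<longleftrightarrow> c = enc Z \<or> c = enc S \<or> pi1 c = 2
    \<or> pi1 c = 3 \<and> P (code_item (pi1 (pi2 c))) \<and> (\<forall>l<lenc (pi2 (pi2 c)). P (code_item (nthc (pi2 (pi2 c)) l)))
    \<or> pi1 c = 4 \<and> P (code_item (pi1 (pi2 c))) \<and> P (code_item (pi2 (pi2 c)))
    \<or> pi1 c = 5 \<and> P (code_item (pi2 c))"

text \<open>The clauses are the introduction rules of \<open>eval\<close>, read on codes: the tags
  are those of \<open>enc\<close>, and \<open>P\<close> collects the items derived before.\<close>

definition eval_rule :: "nat \<Rightarrow> (nat \<Rightarrow> bool) \<Rightarrow> nat \<Rightarrow> nat \<Rightarrow> nat \<Rightarrow> bool" where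
  "eval_rule B P c xs z \<longleftrightarrow> c = enc Z \<and> z = 0
    \<or> c = enc S \<and> 0 < lenc xs \<and> z = Suc (nthc xs 0)
    \<or> pi1 c = 2 \<and> pi2 c < lenc xs \<and> z = nthc xs (pi2 c)
    \<or> pi1 c = 3 \<and> (\<exists>ys\<le>B. P (eval_item (pi1 (pi2 c)) ys z) \<and> lenc ys = lenc (pi2 (pi2 c)) \<and>
         (\<forall>l<lenc ys. P (eval_item (nthc (pi2 (pi2 c)) l) xs (nthc ys l))))
    \<or> pi1 c = 4 \<and> 0 < lenc xs \<and> nthc xs 0 = 0 \<and> P (eval_item (pi1 (pi2 c)) (tlc xs) z)
    \<or> pi1 c = 4 \<and> 0 < lenc xs \<and> 0 < nthc xs 0 \<and>
         (\<exists>r\<le>B. P (eval_item c (consc (nthc xs 0 - 1) (tlc xs)) r) \<and>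
           P (eval_item (pi2 (pi2 c)) (consc r (consc (nthc xs 0 - 1) (tlc xs))) z))
    \<or> pi1 c = 5 \<and> P (eval_item (pi2 c) (consc z xs) 0) \<and>
         (\<forall>m<z. \<exists>k\<le>B. P (eval_item (pi2 c) (consc m xs) (Suc k)))"

text \<open>\<open>B\<close> bounds the existential quantifiers in the rules, which keeps the rules decidable.\<close>

definition infer :: "nat \<Rightarrow> (nat \<Rightarrow> bool) \<Rightarrow> nat \<Rightarrow> bool" where
  "infer B P t \<longleftrightarrow> (if pi2 t = 0 then code_rule P (pi1 t)
     else eval_rule B P (pi1 t) (pi1 (pi2 t - 1)) (pi2 (pi2 t - 1)))"

definition valid :: "nat \<Rightarrow> nat \<Rightarrow> bool" where
  "valid B D \<longleftrightarrow> (\<forall>k<lenc D. infer B (\<lambda>t. \<exists>j<k. nthc D j = t) (nthc D k))"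

definition derivable :: "nat \<Rightarrow> bool" where
  "derivable t \<longleftrightarrow> (\<exists>B D. valid B D \<and> t \<in> set (list_decode D))"

lemma code_rule_mono: "code_rule P c \<Longrightarrow> (\<And>t. P t \<Longrightarrow> Q t) \<Longrightarrow> code_rule Q c"
  unfolding code_rule_def by (elim disjE conjE) simp_all

lemma eval_rule_mono:
  assumes "eval_rule B P c xs z" "B \<le> B'" "\<And>t. P t \<Longrightarrow> Q t"
  shows "eval_rule B' Q c xs z"
proof -
  have le: "\<And>n. n \<le> B \<Longrightarrow> n \<le> B'" using assms(2) by simp
  show ?thesis
    using assms(1) unfolding eval_rule_def
    by (elim disj_forward conj_forward ex_forward all_forward imp_forward) (assumption | erule le assms(3))+
qed

lemma rule_mono: "infer B P t \<Longrightarrow> B \<le> B' \<Longrightarrow> (\<And>t. P t \<Longrightarrow> Q t) \<Longrightarrow> infer B' Q t"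
  unfolding infer_def by (auto intro: code_rule_mono eval_rule_mono split: if_splits)

lemma nth0_append1: "j < length D \<Longrightarrow> nth0 (D @ D') j = nth0 D j"
  and nth0_append2: "nth0 (D @ D') (length D + j) = nth0 D' j"
  by (simp_all add: nth0_def nth_append)

lemma rule_append:
  assumes "infer B (\<lambda>t. \<exists>j<k. nthc (list_encode D) j = t) t" "k \<le> length D" "B \<le> B'"
  shows "infer B' (\<lambda>t. \<exists>j<k. nthc (list_encode (D @ D')) j = t) t"
  using assms(1,3)
proof (rule rule_mono)
  fix t assume "\<exists>j<k. nthc (list_encode D) j = t"
  then obtain j where "j < k" "nth0 D j = t" unfolding nthc_encode by blast
  then show "\<exists>j<k. nthc (list_encode (D @ D')) j = t"
    using assms(2) by (intro exI[of _ j]) (simp add: nth0_append1)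
qed

text \<open>The positions of the second derivation are shifted by the length of the first; its
  inferences survive because \<open>infer\<close> is monotone in the available items and in the
  bound.\<close>

lemma valid_append:
  assumes "valid B (list_encode D)" "valid B' (list_encode D')"
  shows "valid (max B B') (list_encode (D @ D'))"
  unfolding valid_def
proof (intro allI impI)
  fix k assume k: "k < lenc (list_encode (D @ D'))"
  show "infer (max B B') (\<lambda>t. \<exists>j<k. nthc (list_encode (D @ D')) j = t) (nthc (list_encode (D @ D')) k)"
  proof (cases "k < length D")
    case True
    have "infer B (\<lambda>t. \<exists>j<k. nthc (list_encode D) j = t) (nthc (list_encode D) k)"
      using assms(1) True unfolding valid_def by simp
    then have "infer (max B B') (\<lambda>t. \<exists>j<k. nthc (list_encode (D @ D')) j = t) (nthc (list_encode D) k)"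
      by (rule rule_append) (use True in simp_all)
    then show ?thesis unfolding nthc_encode nth0_append1[OF True] .
  next
    case False
    define i where "i = k - length D"
    have i: "k = length D + i" "i < length D'" using False k by (auto simp: i_def)
    have "infer B' (\<lambda>t. \<exists>j<i. nthc (list_encode D') j = t) (nthc (list_encode D') i)"
      using assms(2) i unfolding valid_def by simp
    then have "infer (max B B') (\<lambda>t. \<exists>j<k. nthc (list_encode (D @ D')) j = t) (nthc (list_encode D') i)"
    proof (rule rule_mono)
      fix t assume "\<exists>j<i. nthc (list_encode D') j = t"
      then obtain j where "j < i" "nth0 D' j = t" by auto
      then show "\<exists>j<k. nthc (list_encode (D @ D')) j = t"
        using i by (intro exI[of _ "length D + j"]) (simp add: nth0_append2)
    qed simp
    then show ?thesis unfolding nthc_encode i(1) nth0_append2 .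
  qed
qed

text \<open>Concatenation gathers finitely many premises in one derivation, as rules with several
  premises require.\<close>

lemma derivable_finite:
  assumes "finite X" "\<forall>t\<in>X. derivable t"
  shows "\<exists>B D. valid B (list_encode D) \<and> X \<subseteq> set D"
  using assms
proof (induction X)
  case empty
  have "valid 0 (list_encode [])" by (simp add: valid_def lenc_def del: list_encode.simps)
  then show ?case by blast
next
  case (insert t X)
  then obtain B D where "valid B (list_encode D)" "X \<subseteq> set D" by auto
  moreover obtain B' D' where "valid B' (list_encode D')" "t \<in> set D'"
    using insert.prems unfolding derivable_def by (metis insertI1 list_decode_inverse)
  ultimately show ?case
    using valid_append by (intro exI[of _ "max B B'"] exI[of _ "D @ D'"]) auto
qed

lemma derivable_rule:
  assumes "finite X" "\<forall>t\<in>X. derivable t" "infer B (\<lambda>t. t \<in> X) t"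
  shows "derivable t"
proof -
  obtain B' D where D: "valid B' (list_encode D)" "X \<subseteq> set D" using derivable_finite[OF assms(1,2)] by blast
  have "valid (max B B') (list_encode (D @ [t]))"
    unfolding valid_def
  proof (intro allI impI)
    fix k assume k: "k < lenc (list_encode (D @ [t]))"
    show "infer (max B B') (\<lambda>u. \<exists>j<k. nthc (list_encode (D @ [t])) j = u) (nthc (list_encode (D @ [t])) k)"
    proof (cases "k < length D")
      case True
      have "infer B' (\<lambda>t. \<exists>j<k. nthc (list_encode D) j = t) (nthc (list_encode D) k)"
        using D(1) True unfolding valid_def by simp
      then have "infer (max B B') (\<lambda>u. \<exists>j<k. nthc (list_encode (D @ [t])) j = u) (nthc (list_encode D) k)"
        by (rule rule_append) (use True in simp_all)
      then show ?thesis unfolding nthc_encode nth0_append1[OF True] .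
    next
      case False
      then have [simp]: "k = length D" using k by simp
      have "infer (max B B') (\<lambda>u. \<exists>j<k. nthc (list_encode (D @ [t])) j = u) t"
        using assms(3)
      proof (rule rule_mono)
        fix u assume "u \<in> X"
        then obtain j where "j < length D" "D ! j = u" using D(2) by (metis in_set_conv_nth subsetD)
        then show "\<exists>j<k. nthc (list_encode (D @ [t])) j = u"
          by (intro exI[of _ j]) (simp add: nth0_def nth_append)
      qed simp
      moreover have "nthc (list_encode (D @ [t])) k = t" by (simp add: nth0_def)
      ultimately show ?thesis by (simp only:)
    qed
  qed
  then show ?thesis unfolding derivable_def by (metis in_set_conv_decomp list_encode_inverse)
qed

lemma derivable_code_item: "derivable (code_item (enc c))"
proof (induction c)
  case (Comp f gs)
  show ?case
    by (rule derivable_rule[of "insert (code_item (enc f)) (code_item ` enc ` set gs)" 0])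
      (use Comp in \<open>auto simp: infer_def code_rule_def code_item_def nth0_def\<close>)
next
  case (Prec f g)
  show ?case
    by (rule derivable_rule[of "{code_item (enc f), code_item (enc g)}" 0])
      (use Prec in \<open>auto simp: infer_def code_rule_def code_item_def\<close>)
next
  case (Mn f)
  show ?case
    by (rule derivable_rule[of "{code_item (enc f)}" 0])
      (use Mn in \<open>auto simp: infer_def code_rule_def code_item_def\<close>)
qed (rule derivable_rule[of "{}" 0]; simp add: infer_def code_rule_def code_item_def)+

lemma rule_eval_item: "infer B P (eval_item c xs z) \<longleftrightarrow> eval_rule B P c xs z"
  by (simp add: infer_def eval_item_def)

text \<open>Completeness of the calculus. The bound covers the intermediate values: the code of the
  inner results for \<open>Comp\<close>, the recursive value for \<open>Prec\<close>, a maximum over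
  the failed trials for \<open>Mn\<close>.\<close>

lemma derivable_eval_item: "eval c xs z \<Longrightarrow> derivable (eval_item (enc c) (list_encode xs) z)"
proof (induction rule: eval.induct)
  case (eval_Z xs)
  show ?case by (rule derivable_rule[of "{}" 0]) (simp_all add: rule_eval_item eval_rule_def)
next
  case (eval_S x xs)
  show ?case
    by (rule derivable_rule[of "{}" 0]) (simp_all add: rule_eval_item eval_rule_def nth0_def del: list_encode.simps)
next
  case (eval_Proj i xs)
  then show ?case
    by (intro derivable_rule[of "{}" 0]) (simp_all add: rule_eval_item eval_rule_def nth0_def)
next
  case (eval_Comp xs gs ys f z)
  let ?X = "insert (eval_item (enc f) (list_encode ys) z) ((\<lambda>l. eval_item (enc (gs ! l)) (list_encode xs) (ys ! l)) ` {..<length ys})"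
  show ?case
    by (rule derivable_rule[of ?X "list_encode ys"])
      (use eval_Comp.IH in \<open>auto simp: rule_eval_item eval_rule_def nth0_def list_all2_conv_all_nth intro!: exI[of _ "list_encode ys"]\<close>)
next
  case (eval_Prec0 f xs z g)
  show ?case
    by (rule derivable_rule[of "{eval_item (enc f) (list_encode xs) z}" 0])
      (use eval_Prec0.IH in \<open>simp_all add: rule_eval_item eval_rule_def nth0_def tlc_encode del: list_encode.simps\<close>)
next
  case (eval_PrecS f g n xs r z)
  let ?X = "{eval_item (enc (Prec f g)) (list_encode (n # xs)) r, eval_item (enc g) (list_encode (r # n # xs)) z}"
  show ?case
    by (rule derivable_rule[of ?X r])
      (use eval_PrecS.IH in \<open>auto simp: rule_eval_item eval_rule_def nth0_def tlc_encode simp del: list_encode.simps\<close>)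
next
  case (eval_Mn f n xs)
  obtain v where v: "\<And>m. m < n \<Longrightarrow> eval f (m # xs) (Suc (v m)) \<and> derivable (eval_item (enc f) (list_encode (m # xs)) (Suc (v m)))"
    using eval_Mn.IH by metis
  let ?X = "insert (eval_item (enc f) (list_encode (n # xs)) 0) ((\<lambda>m. eval_item (enc f) (list_encode (m # xs)) (Suc (v m))) ` {..<n})"
  have k: "\<exists>k\<le>Max (v ` {..<n}). eval_item (enc f) (list_encode (m # xs)) (Suc k) \<in> ?X" if "m < n" for m
    by (rule exI[of _ "v m"]) (use that in simp)
  show ?case
  proof (rule derivable_rule[of ?X "Max (v ` {..<n})"])
    show "finite ?X" by simp
    show "\<forall>t\<in>?X. derivable t" using eval_Mn.IH(1) v by auto
    have "eval_rule (Max (v ` {..<n})) (\<lambda>t. t \<in> ?X) (enc (Mn f)) (list_encode xs) n"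
      unfolding eval_rule_def enc.simps pi1_encode pi2_encode consc_encode
      by (intro disjI2 conjI allI impI refl k) simp_all
    then show "infer (Max (v ` {..<n})) (\<lambda>t. t \<in> ?X) (eval_item (enc (Mn f)) (list_encode xs) n)"
      unfolding rule_eval_item .
  qed
qed

section \<open>Soundness of certificates\<close>

lemma enc_tagE:
  shows "pi1 (enc c) = 3 \<Longrightarrow> \<exists>f gs. c = Comp f gs"
    and "pi1 (enc c) = 4 \<Longrightarrow> \<exists>f g. c = Prec f g"
    and "pi1 (enc c) = 5 \<Longrightarrow> \<exists>f. c = Mn f"
  by (cases c; simp)+

lemma pi1_2E: "pi1 (enc c) = 2 \<Longrightarrow> c = Proj (pi2 (enc c))"
  by (cases c) simp_all

text \<open>Strong induction on the position, since the premises of an item occur earlier in the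
  derivation.\<close>

lemma valid_code_sound:
  assumes "valid B D" "k < lenc D" "nthc D k = code_item n"
  shows "\<exists>c. enc c = n"
  using assms(2,3)
proof (induction k arbitrary: n rule: less_induct)
  case (less k)
  have IH: "\<exists>c. enc c = m" if "\<exists>j<k. nthc D j = code_item m" for m
    using less.IH less.prems(1) that by (meson less_trans)
  have "code_rule (\<lambda>t. \<exists>j<k. nthc D j = t) n"
    using assms(1) less.prems unfolding valid_def infer_def code_item_def by force
  then show ?case
    unfolding code_rule_def
  proof (elim disjE conjE)
    assume "pi1 n = 2"
    then show ?thesis by (intro exI[of _ "Proj (pi2 n)"]) (metis enc.simps(3) pi_encode)
  next
    assume *: "pi1 n = 3" "\<exists>j<k. nthc D j = code_item (pi1 (pi2 n))"
      "\<forall>l<lenc (pi2 (pi2 n)). \<exists>j<k. nthc D j = code_item (nthc (pi2 (pi2 n)) l)"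
    obtain f where f: "enc f = pi1 (pi2 n)" using IH *(2) by blast
    have "\<exists>c. enc c = nthc (pi2 (pi2 n)) l" if "l < lenc (pi2 (pi2 n))" for l using IH *(3) that by blast
    then obtain g where g: "\<And>l. l < lenc (pi2 (pi2 n)) \<Longrightarrow> enc (g l) = nthc (pi2 (pi2 n)) l" by metis
    have "map enc (map g [0..<lenc (pi2 (pi2 n))]) = list_decode (pi2 (pi2 n))"
      by (rule nth_equalityI) (auto simp: g lenc_def nthc_def nth0_def)
    then have "enc (Comp f (map g [0..<lenc (pi2 (pi2 n))])) = n"
      unfolding enc.simps f by (metis list_decode_inverse pi_encode *(1))
    then show ?thesis by blast
  next
    assume *: "pi1 n = 4" "\<exists>j<k. nthc D j = code_item (pi1 (pi2 n))" "\<exists>j<k. nthc D j = code_item (pi2 (pi2 n))"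
    obtain f where f: "enc f = pi1 (pi2 n)" using IH *(2) by blast
    obtain g where g: "enc g = pi2 (pi2 n)" using IH *(3) by blast
    have "enc (Prec f g) = n" unfolding enc.simps f g using *(1) by (metis pi_encode)
    then show ?thesis by blast
  next
    assume *: "pi1 n = 5" "\<exists>j<k. nthc D j = code_item (pi2 n)"
    obtain f where f: "enc f = pi2 n" using IH *(2) by blast
    have "enc (Mn f) = n" unfolding enc.simps f using *(1) by (metis pi_encode)
    then show ?thesis by blast
  qed blast+
qed

text \<open>Only items about an existing program are treated; the premises of such an item concern
  the program itself or its subprograms, so the induction never leaves Goedel numbers.\<close>

lemma valid_eval_sound:
  assumes "valid B D" "k < lenc D" "nthc D k = eval_item (enc c) xs z"
  shows "eval c (list_decode xs) z"
  using assms(2,3)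
proof (induction k arbitrary: c xs z rule: less_induct)
  case (less k)
  have IH: "eval d ys y" if "\<exists>j<k. nthc D j = eval_item (enc d) (list_encode ys) y" for d ys y
    using less.IH less.prems(1) that by (metis less_trans list_encode_inverse)
  obtain l where l: "xs = list_encode l" by (metis list_decode_inverse)
  have "eval_rule B (\<lambda>t. \<exists>j<k. nthc D j = t) (enc c) (list_encode l) z"
    using assms(1) less.prems unfolding valid_def rule_eval_item[symmetric] l by metis
  then have "eval c l z"
    unfolding eval_rule_def lenc_encode nthc_encode
  proof (elim disjE conjE)
    assume "enc c = enc Z" "z = 0"
    then show ?thesis using enc_inj eval_Z by metis
  next
    assume *: "enc c = enc S" "0 < length l" "z = Suc (nth0 l 0)"
    then show ?thesis using enc_inj[OF *(1)] by (cases l) (auto simp: nth0_def intro: eval_S)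
  next
    assume *: "pi1 (enc c) = 2" "pi2 (enc c) < length l" "z = nth0 l (pi2 (enc c))"
    then show ?thesis using pi1_2E[OF *(1)] eval_Proj[OF *(2)] by (simp add: nth0_def)
  next
    assume "pi1 (enc c) = 3" "\<exists>ys\<le>B. (\<exists>j<k. nthc D j = eval_item (pi1 (pi2 (enc c))) ys z) \<and>
      lenc ys = lenc (pi2 (pi2 (enc c))) \<and>
      (\<forall>i<lenc ys. \<exists>j<k. nthc D j = eval_item (nthc (pi2 (pi2 (enc c))) i) (list_encode l) (nthc ys i))"
    then obtain ys where *: "pi1 (enc c) = 3" "\<exists>j<k. nthc D j = eval_item (pi1 (pi2 (enc c))) ys z"
      "lenc ys = lenc (pi2 (pi2 (enc c)))"
      "\<forall>i<lenc ys. \<exists>j<k. nthc D j = eval_item (nthc (pi2 (pi2 (enc c))) i) (list_encode l) (nthc ys i)"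
      by blast
    obtain f gs where c: "c = Comp f gs" using enc_tagE(1)[OF *(1)] by blast
    obtain ws where ws: "ys = list_encode ws" by (metis list_decode_inverse)
    have "eval f ws z" using *(2) unfolding c ws enc.simps pi1_encode pi2_encode by (rule IH)
    moreover have len: "length ws = length gs" using *(3) unfolding c ws by simp
    moreover have "eval (gs ! i) l (ws ! i)" if "i < length ws" for i
      using *(4)[rule_format, of i] that len unfolding c ws by (intro IH) (simp add: nth0_def)
    ultimately show ?thesis unfolding c by (intro eval_Comp[of l gs ws]) (auto simp: list_all2_conv_all_nth)
  next
    assume *: "pi1 (enc c) = 4" "0 < length l" "nth0 l 0 = 0"
      "\<exists>j<k. nthc D j = eval_item (pi1 (pi2 (enc c))) (tlc (list_encode l)) z"
    obtain f g where c: "c = Prec f g" using enc_tagE(2)[OF *(1)] by blast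
    obtain ws where ws: "l = 0 # ws" using *(2,3) by (cases l) (auto simp: nth0_def)
    have "eval f ws z" using *(4) unfolding c ws enc.simps pi1_encode pi2_encode tlc_encode by (rule IH)
    then show ?thesis unfolding c ws by (rule eval_Prec0)
  next
    assume "pi1 (enc c) = 4" "0 < length l" "0 < nth0 l 0"
      "\<exists>r\<le>B. (\<exists>j<k. nthc D j = eval_item (enc c) (consc (nth0 l 0 - 1) (tlc (list_encode l))) r) \<and>
       (\<exists>j<k. nthc D j = eval_item (pi2 (pi2 (enc c))) (consc r (consc (nth0 l 0 - 1) (tlc (list_encode l)))) z)"
    then obtain r where *: "pi1 (enc c) = 4" "0 < length l" "0 < nth0 l 0"
      "\<exists>j<k. nthc D j = eval_item (enc c) (consc (nth0 l 0 - 1) (tlc (list_encode l))) r"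
      "\<exists>j<k. nthc D j = eval_item (pi2 (pi2 (enc c))) (consc r (consc (nth0 l 0 - 1) (tlc (list_encode l)))) z"
      by blast
    obtain f g where c: "c = Prec f g" using enc_tagE(2)[OF *(1)] by blast
    obtain n ws where ws: "l = Suc n # ws" using *(2,3) by (cases l; cases "hd l") (auto simp: nth0_def)
    have n: "nth0 (Suc n # ws) 0 - 1 = n" by (simp add: nth0_def)
    have "eval c (n # ws) r" using *(4) unfolding ws n tlc_encode consc_encode by (rule IH)
    moreover have "eval g (r # n # ws) z"
      using *(5) unfolding c ws n tlc_encode consc_encode enc.simps pi2_encode by (rule IH)
    ultimately show ?thesis unfolding c ws by (intro eval_PrecS)
  next
    assume *: "pi1 (enc c) = 5" "\<exists>j<k. nthc D j = eval_item (pi2 (enc c)) (consc z (list_encode l)) 0"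
      "\<forall>m<z. \<exists>i\<le>B. \<exists>j<k. nthc D j = eval_item (pi2 (enc c)) (consc m (list_encode l)) (Suc i)"
    obtain f where c: "c = Mn f" using enc_tagE(3)[OF *(1)] by blast
    have "eval f (z # l) 0" using *(2) unfolding c enc.simps pi2_encode consc_encode by (rule IH)
    moreover have "\<exists>i. eval f (m # l) (Suc i)" if "m < z" for m
      using *(3)[rule_format, OF that] IH unfolding c enc.simps pi2_encode consc_encode by metis
    ultimately show ?thesis unfolding c by (intro eval_Mn) auto
  qed
  then show ?case by (simp add: l)
qed

text \<open>The number \<open>d\<close> packs a bound and a derivation; the three items correspond
  to the three conditions on the program in \<open>graphE\<close>.\<close>

definition graph_cert :: "nat \<Rightarrow> nat \<Rightarrow> nat \<Rightarrow> nat \<Rightarrow> bool" where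
  "graph_cert i x y d \<longleftrightarrow> x \<noteq> y \<and> valid (pi1 d) (pi2 d)
    \<and> (\<exists>k<lenc (pi2 d). nthc (pi2 d) k = code_item i)
    \<and> (\<exists>k<lenc (pi2 d). nthc (pi2 d) k = eval_item i (consc x (consc y 0)) 1)
    \<and> (\<exists>k<lenc (pi2 d). nthc (pi2 d) k = eval_item i (consc y (consc x 0)) 1)"

lemma consc2: "consc x (consc y 0) = list_encode [x, y]"
  by (simp add: consc_def)

lemma graphE_iff_cert: "graphE i x y \<longleftrightarrow> (\<exists>d. graph_cert i x y d)"
proof
  assume "graphE i x y"
  then obtain c where c: "x \<noteq> y" "enc c = i" "eval c [x, y] 1" "eval c [y, x] 1"
    unfolding graphE_def by blast
  have "\<forall>t\<in>{code_item i, eval_item i (list_encode [x, y]) 1, eval_item i (list_encode [y, x]) 1}. derivable t"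
    using derivable_code_item[of c] derivable_eval_item[OF c(3)] derivable_eval_item[OF c(4)] c(2) by simp
  from derivable_finite[OF _ this] obtain B D where D: "valid B (list_encode D)"
    "{code_item i, eval_item i (list_encode [x, y]) 1, eval_item i (list_encode [y, x]) 1} \<subseteq> set D"
    by blast
  have "\<exists>k<length D. nth0 D k = t" if "t \<in> set D" for t
    using that by (auto simp: in_set_conv_nth nth0_def)
  then have "graph_cert i x y (prod_encode (B, list_encode D))"
    unfolding graph_cert_def consc2 using c(1) D by simp
  then show "\<exists>d. graph_cert i x y d" by blast
next
  assume "\<exists>d. graph_cert i x y d"
  then obtain d where d: "graph_cert i x y d" by blast
  then have v: "valid (pi1 d) (pi2 d)" by (simp add: graph_cert_def)
  obtain c where c: "enc c = i" using d valid_code_sound[OF v] unfolding graph_cert_def by blast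
  have "eval c [x, y] 1" "eval c [y, x] 1"
    using d valid_eval_sound[OF v] unfolding graph_cert_def consc2 c[symmetric] by (metis list_encode_inverse)+
  then show "graphE i x y" using c d unfolding graphE_def graph_cert_def by blast
qed

lemma dec_graph_cert:
  assumes "recfn f1" "recfn f2" "recfn f3" "recfn f4"
  shows "dec (\<lambda>e. graph_cert (f1 e) (f2 e) (f3 e) (f4 e))"
proof -
  have "dec (\<lambda>e. graph_cert (e 0) (e 1) (e 2) (e 3))"
    unfolding graph_cert_def valid_def infer_def code_rule_def eval_rule_def code_item_def eval_item_def
    by (intro rec_intros dec_if recfn_tlc)
  then show ?thesis
    using recfn_comp4[where F = "\<lambda>x y z w. if graph_cert x y z w then 1 else 0"] assms
    unfolding dec_def by simp
qed

section \<open>Elementary embeddability is \<open>\<Sigma>\<^sup>1\<^sub>1\<close>\<close>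

text \<open>These are the effectively closed conditions on \<open>f\<close>; prefixing an
  existential quantifier over \<open>f\<close> gives \<open>sigma11\<close>.\<close>

definition pi01 :: "(nat \<Rightarrow> nat \<Rightarrow> (nat \<Rightarrow> nat) \<Rightarrow> bool) \<Rightarrow> bool" where
  "pi01 \<Phi> \<longleftrightarrow> (\<exists>K. dec (\<lambda>e. K (e 0) (e 1) (e 2)) \<and>
    (\<forall>x y f. \<Phi> x y f \<longleftrightarrow> (\<forall>n. K x y (list_encode (map f [0..<n])))))"

lemma sigma11I: "pi01 \<Phi> \<Longrightarrow> (\<And>x y. R x y \<longleftrightarrow> (\<exists>f. \<Phi> x y f)) \<Longrightarrow> sigma11 R"
  unfolding pi01_def sigma11_def computable_rel3_iff_dec by (elim exE conjE, rule exI, rule conjI) auto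

lemma pi01_conj: assumes "pi01 \<Phi>" "pi01 \<Psi>" shows "pi01 (\<lambda>x y f. \<Phi> x y f \<and> \<Psi> x y f)"
proof -
  obtain K where K: "dec (\<lambda>e. K (e 0) (e 1) (e 2))" "\<And>x y f. \<Phi> x y f \<longleftrightarrow> (\<forall>n. K x y (list_encode (map f [0..<n])))"
    using assms(1) unfolding pi01_def by blast
  obtain L where L: "dec (\<lambda>e. L (e 0) (e 1) (e 2))" "\<And>x y f. \<Psi> x y f \<longleftrightarrow> (\<forall>n. L x y (list_encode (map f [0..<n])))"
    using assms(2) unfolding pi01_def by blast
  show ?thesis unfolding pi01_def K(2) L(2)
    by (rule exI[of _ "\<lambda>x y s. K x y s \<and> L x y s"], rule conjI, rule dec_conj[OF K(1) L(1)]) auto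
qed

text \<open>On a finite segment the test is skipped until the segment contains all three places,
  which keeps it decidable and makes it take effect on long segments. The places depend on
  \<open>n\<close> alone, not on values of \<open>f\<close>.\<close>

lemma pi01_lookup:
  assumes P: "\<And>f0 f1 f2 f3 f4 f5. recfn f0 \<Longrightarrow> recfn f1 \<Longrightarrow> recfn f2 \<Longrightarrow> recfn f3 \<Longrightarrow> recfn f4 \<Longrightarrow> recfn f5 \<Longrightarrow>
      dec (\<lambda>e. P (f0 e) (f1 e) (f2 e) (f3 e) (f4 e) (f5 e))"
    and t: "\<And>g. recfn g \<Longrightarrow> recfn (\<lambda>e. t1 (g e))" "\<And>g. recfn g \<Longrightarrow> recfn (\<lambda>e. t2 (g e))"
      "\<And>g. recfn g \<Longrightarrow> recfn (\<lambda>e. t3 (g e))"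
  shows "pi01 (\<lambda>x y f. \<forall>n. P x y n (f (t1 n)) (f (t2 n)) (f (t3 n)))"
  unfolding pi01_def
proof (intro exI conjI allI)
  let ?K = "\<lambda>x y s. \<forall>n<lenc s. t1 n < lenc s \<and> t2 n < lenc s \<and> t3 n < lenc s \<longrightarrow>
    P x y n (nthc s (t1 n)) (nthc s (t2 n)) (nthc s (t3 n))"
  show "dec (\<lambda>e. ?K (e 0) (e 1) (e 2))"
    by (intro rec_intros P t)
  fix x y f
  have nth: "nthc (list_encode (map f [0..<n])) i = f i" if "i < n" for i n
    using that by (simp add: nth0_def)
  show "(\<forall>n. P x y n (f (t1 n)) (f (t2 n)) (f (t3 n))) \<longleftrightarrow> (\<forall>n. ?K x y (list_encode (map f [0..<n])))"
  proof (intro iffI allI impI)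
    fix n k assume *: "\<forall>n. P x y n (f (t1 n)) (f (t2 n)) (f (t3 n))"
      "t1 k < lenc (list_encode (map f [0..<n])) \<and> t2 k < lenc (list_encode (map f [0..<n])) \<and>
       t3 k < lenc (list_encode (map f [0..<n]))"
    then have "t1 k < n" "t2 k < n" "t3 k < n" by simp_all
    then show "P x y k (nthc (list_encode (map f [0..<n])) (t1 k)) (nthc (list_encode (map f [0..<n])) (t2 k))
      (nthc (list_encode (map f [0..<n])) (t3 k))"
      using *(1) by (simp only: nth)
  next
    fix k assume *: "\<forall>n. ?K x y (list_encode (map f [0..<n]))"
    \<comment> \<open>Long enough to contain \<open>k\<close> and all three places.\<close>
    define n where "n = Suc (k + t1 k + t2 k + t3 k)"
    have lt: "k < n" "t1 k < n" "t2 k < n" "t3 k < n" by (simp_all add: n_def)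
    then have "P x y k (nthc (list_encode (map f [0..<n])) (t1 k)) (nthc (list_encode (map f [0..<n])) (t2 k))
      (nthc (list_encode (map f [0..<n])) (t3 k))"
      using *[rule_format, of k n] by simp
    then show "P x y k (f (t1 k)) (f (t2 k)) (f (t3 k))" using lt by (simp only: nth)
  qed
qed

section \<open>Codes of formulas and satisfaction on lists\<close>

primrec fmenc :: "fm \<Rightarrow> nat" where
  "fmenc (FEq u v) = prod_encode (0, prod_encode (u, v))"
| "fmenc (FRel u v) = prod_encode (1, prod_encode (u, v))"
| "fmenc (FNeg p) = prod_encode (2, fmenc p)"
| "fmenc (FConj p q) = prod_encode (3, prod_encode (fmenc p, fmenc q))"
| "fmenc (FEx v p) = prod_encode (4, prod_encode (v, fmenc p))"

text \<open>Makes the decoding of formulas terminate: a positive tag forces the rest to be smaller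
  than the code.\<close>

lemma pi2_less: assumes "0 < pi1 n" shows "pi2 n < n"
proof -
  have "m \<le> triangle m" for m by (induction m) auto
  from this[of "pi1 n + pi2 n"] have "pi2 n < prod_encode (pi1 n, pi2 n)"
    using assms by (simp add: prod_encode_def)
  then show ?thesis by simp
qed

text \<open>A total decoding: every number counts as a formula, so the truth predicates need no case for invalid codes.\<close>

function fmdec :: "nat \<Rightarrow> fm" where
  "fmdec n = (if pi1 n = 0 then FEq (pi1 (pi2 n)) (pi2 (pi2 n))
    else if pi1 n = 1 then FRel (pi1 (pi2 n)) (pi2 (pi2 n))
    else if pi1 n = 2 then FNeg (fmdec (pi2 n))
    else if pi1 n = 3 then FConj (fmdec (pi1 (pi2 n))) (fmdec (pi2 (pi2 n)))
    else FEx (pi1 (pi2 n)) (fmdec (pi2 (pi2 n))))"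
  by pat_completeness auto
termination
  by (relation "measure id") (auto intro: pi2_less le_less_trans[OF pi1_le pi2_less] le_less_trans[OF pi2_le pi2_less])

declare fmdec.simps [simp del]

lemma fmdec_tag [simp]:
  "fmdec (prod_encode (0, q)) = FEq (pi1 q) (pi2 q)"
  "fmdec (prod_encode (Suc 0, q)) = FRel (pi1 q) (pi2 q)"
  "fmdec (prod_encode (2, q)) = FNeg (fmdec q)"
  "fmdec (prod_encode (3, q)) = FConj (fmdec (pi1 q)) (fmdec (pi2 q))"
  "fmdec (prod_encode (4, q)) = FEx (pi1 q) (fmdec (pi2 q))"
  by (simp_all add: fmdec.simps[of "prod_encode _"])

lemma fmdec_fmenc [simp]: "fmdec (fmenc p) = p"
  by (induction p) simp_all

text \<open>Variables of a decoded formula cannot exceed its code, so a list longer than the code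
  covers them all; \<open>agree_ok\<close> relies on this.\<close>

lemma var_bound_fmdec: "var_bound (fmdec n) \<le> Suc n"
proof (induction n rule: fmdec.induct)
  case (1 n)
  have le: "pi1 (pi2 n) \<le> n" "pi2 (pi2 n) \<le> n" "pi2 n \<le> n"
    using pi1_le[of "pi2 n"] pi2_le[of "pi2 n"] pi2_le[of n] by simp_all
  show ?case
    using 1 le by (subst fmdec.simps) (auto intro: order_trans)
qed

text \<open>Assignments are codes of finite lists, padded with \<open>0\<close>; quantifiers range over lists of the same length, so
  \<open>lsat\<close> agrees with \<open>sat\<close> only if the list covers all variables.\<close>

definition variant :: "nat \<Rightarrow> nat \<Rightarrow> nat \<Rightarrow> bool" where
  "variant a v b \<longleftrightarrow> lenc b = lenc a \<and> (\<forall>i<lenc a. i \<noteq> v \<longrightarrow> nthc b i = nthc a i)"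

primrec lsat :: "(nat \<Rightarrow> nat \<Rightarrow> bool) \<Rightarrow> fm \<Rightarrow> nat \<Rightarrow> bool" where
  "lsat E (FEq u v) a \<longleftrightarrow> nthc a u = nthc a v"
| "lsat E (FRel u v) a \<longleftrightarrow> E (nthc a u) (nthc a v)"
| "lsat E (FNeg p) a \<longleftrightarrow> \<not> lsat E p a"
| "lsat E (FConj p q) a \<longleftrightarrow> lsat E p a \<and> lsat E q a"
| "lsat E (FEx v p) a \<longleftrightarrow> (\<exists>b. variant a v b \<and> lsat E p b)"

lemma nthc_ge: "lenc a \<le> i \<Longrightarrow> nthc a i = 0"
  by (simp add: nthc_def nth0_def lenc_def)

text \<open>In the existential case the quantified variable is below the length of the list, so
  every new value is reached by a list update.\<close>

lemma lsat_iff_sat: "var_bound p \<le> lenc a \<Longrightarrow> lsat E p a \<longleftrightarrow> sat E (nthc a) p"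
proof (induction p arbitrary: a)
  case (FEx v p)
  show ?case
  proof
    assume "lsat E (FEx v p) a"
    then obtain b where b: "variant a v b" "lsat E p b" by auto
    have "nthc b = (nthc a)(v := nthc b v)"
    proof
      fix i
      show "nthc b i = ((nthc a)(v := nthc b v)) i"
        using b(1) nthc_ge[of a i] nthc_ge[of b i] by (cases "i < lenc a") (auto simp: variant_def)
    qed
    moreover have "sat E (nthc b) p"
      using FEx.IH[of b] FEx.prems b by (simp add: variant_def)
    ultimately show "sat E (nthc a) (FEx v p)" unfolding sat.simps by metis
  next
    assume "sat E (nthc a) (FEx v p)"
    then obtain w where w: "sat E ((nthc a)(v := w)) p" by auto
    define b where "b = list_encode ((list_decode a)[v := w])"
    have v: "v < lenc a" using FEx.prems by simp
    have nb: "nthc b = (nthc a)(v := w)"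
      using v by (auto simp: b_def nthc_def nth0_def lenc_def)
    have len: "lenc b = lenc a" by (simp add: b_def lenc_def)
    have "variant a v b" by (simp add: variant_def nb len)
    moreover have "lsat E p b" using FEx.IH[of b] FEx.prems w by (simp only: nb len) simp
    ultimately show "lsat E (FEx v p) a" by auto
  qed
qed simp_all

lemma sat_cong: "(\<And>v. v < var_bound p \<Longrightarrow> s v = t v) \<Longrightarrow> sat E s p \<longleftrightarrow> sat E t p"
proof (induction p arbitrary: s t)
  case (FEx v p)
  have "sat E (s(v := a)) p \<longleftrightarrow> sat E (t(v := a)) p" for a
    by (rule FEx.IH) (use FEx.prems in auto)
  then show ?case by simp
next
  case (FNeg p)
  then show ?case by (metis sat.simps(3) var_bound.simps(3))
next
  case (FConj p q)
  then show ?case by (metis sat.simps(4) var_bound.simps(4) less_max_iff_disj)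
qed auto

text \<open>The oracle \<open>f\<close> has columns \<open>\<lambda>m. f \<langle>k, m\<rangle>\<close>: the embedding (0), its action on codes of lists (1), the edges of the two
  graphs with certificates (2, 3) and their truth predicates with witnesses (4, 5); in columns 2 to 5 a
  positive value means true.\<close>

definition edges_ok :: "nat \<Rightarrow> nat \<Rightarrow> (nat \<Rightarrow> nat) \<Rightarrow> bool" where
  "edges_ok k i f \<longleftrightarrow>
    (\<forall>n. 0 < f (prod_encode (k, n)) \<longrightarrow> graph_cert i (pi1 n) (pi2 n) (f (prod_encode (k, n)) - 1)) \<and>
    (\<forall>n. graph_cert i (pi1 (pi1 n)) (pi2 (pi1 n)) (pi2 n) \<longrightarrow> 0 < f (prod_encode (k, pi1 n)))"

text \<open>Tarski's clauses, with the data packed into \<open>n\<close>: \<open>pi1 n\<close> holds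
  the assignment and \<open>pi2 n\<close> the parts of the formula. In the last clause
  \<open>pi1 n\<close> also holds a variant; storing a witness plus 1 as the value replaces an
  existential quantifier.\<close>

definition truth_ok :: "nat \<Rightarrow> nat \<Rightarrow> (nat \<Rightarrow> nat) \<Rightarrow> bool" where
  "truth_ok k l f \<longleftrightarrow>
    (\<forall>n. 0 < f (prod_encode (k, prod_encode (prod_encode (0, pi2 n), pi1 n))) \<longleftrightarrow>
       nthc (pi1 n) (pi1 (pi2 n)) = nthc (pi1 n) (pi2 (pi2 n))) \<and>
    (\<forall>n. 0 < f (prod_encode (k, prod_encode (prod_encode (1, pi2 n), pi1 n))) \<longleftrightarrow>
       0 < f (prod_encode (l, prod_encode (nthc (pi1 n) (pi1 (pi2 n)), nthc (pi1 n) (pi2 (pi2 n)))))) \<and>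
    (\<forall>n. 0 < f (prod_encode (k, prod_encode (prod_encode (2, pi2 n), pi1 n))) \<longleftrightarrow>
       \<not> 0 < f (prod_encode (k, prod_encode (pi2 n, pi1 n)))) \<and>
    (\<forall>n. 0 < f (prod_encode (k, prod_encode (prod_encode (3, pi2 n), pi1 n))) \<longleftrightarrow>
       0 < f (prod_encode (k, prod_encode (pi1 (pi2 n), pi1 n))) \<and>
       0 < f (prod_encode (k, prod_encode (pi2 (pi2 n), pi1 n)))) \<and>
    (\<forall>n. (f (prod_encode (k, prod_encode (prod_encode (4, pi2 n), pi1 (pi1 n)))) = Suc (pi2 (pi1 n)) \<longrightarrow>
         variant (pi1 (pi1 n)) (pi1 (pi2 n)) (pi2 (pi1 n)) \<and>
         0 < f (prod_encode (k, prod_encode (pi2 (pi2 n), pi2 (pi1 n))))) \<and>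
       (variant (pi1 (pi1 n)) (pi1 (pi2 n)) (pi2 (pi1 n)) \<and>
         0 < f (prod_encode (k, prod_encode (pi2 (pi2 n), pi2 (pi1 n)))) \<longrightarrow>
         0 < f (prod_encode (k, prod_encode (prod_encode (4, pi2 n), pi1 (pi1 n))))))"

text \<open>Recursion along list codes; the quantifier in the first clause brings it into the form
  of \<open>pi01_lookup\<close>.\<close>

definition map_ok :: "(nat \<Rightarrow> nat) \<Rightarrow> bool" where
  "map_ok f \<longleftrightarrow> (\<forall>n::nat. f (prod_encode (1, 0)) = 0) \<and>
    (\<forall>n. f (prod_encode (1, consc (pi1 n) (pi2 n))) = consc (f (prod_encode (0, pi1 n))) (f (prod_encode (1, pi2 n))))"

text \<open>Oracle places in \<open>pi01_lookup\<close> may not depend on oracle values, so the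
  image list is guessed inside \<open>n\<close> and compared with column 1. The length condition
  makes the list cover all variables of the formula.\<close>

definition agree_ok :: "(nat \<Rightarrow> nat) \<Rightarrow> bool" where
  "agree_ok f \<longleftrightarrow> (\<forall>n. f (prod_encode (1, pi1 (pi2 n))) = pi2 (pi2 n) \<and> pi1 n < lenc (pi1 (pi2 n)) \<longrightarrow>
    (0 < f (prod_encode (4, prod_encode (pi1 n, pi1 (pi2 n)))) \<longleftrightarrow>
     0 < f (prod_encode (5, prod_encode (pi1 n, pi2 (pi2 n))))))"

lemma dec_variant: "recfn f \<Longrightarrow> recfn g \<Longrightarrow> recfn h \<Longrightarrow> dec (\<lambda>e. variant (f e) (g e) (h e))"
proof (rule dec_comp3)
  show "dec (\<lambda>e. variant (e 0) (e 1) (e 2))" unfolding variant_def by (intro rec_intros)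
qed

text \<open>The flag \<open>b\<close> selects the index, so that one statement covers both
  graphs.\<close>

lemma pi01_edges_ok: "pi01 (\<lambda>x y f. edges_ok k (if b then x else y) f)"
  unfolding edges_ok_def
proof (rule pi01_conj, goal_cases)
  case 1
  show ?case
    by (rule pi01_lookup[where P = "\<lambda>x y n a _ _. 0 < a \<longrightarrow> graph_cert (if b then x else y) (pi1 n) (pi2 n) (a - 1)"
        and ?t1.0 = "\<lambda>n. prod_encode (k, n)" and ?t2.0 = "\<lambda>n. n" and ?t3.0 = "\<lambda>n. n"])
      (intro rec_intros dec_graph_cert; assumption)+
next
  case 2
  show ?case
    by (rule pi01_lookup[where P = "\<lambda>x y n a _ _. graph_cert (if b then x else y) (pi1 (pi1 n)) (pi2 (pi1 n)) (pi2 n) \<longrightarrow> 0 < a"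
        and ?t1.0 = "\<lambda>n. prod_encode (k, pi1 n)" and ?t2.0 = "\<lambda>n. n" and ?t3.0 = "\<lambda>n. n"])
      (intro rec_intros dec_graph_cert; assumption)+
qed

lemma pi01_truth_ok: "pi01 (\<lambda>x y f. truth_ok k l f)"
  unfolding truth_ok_def
proof (intro pi01_conj, goal_cases)
  case 1
  show ?case
    by (rule pi01_lookup[where P = "\<lambda>x y n a _ _. 0 < a \<longleftrightarrow> nthc (pi1 n) (pi1 (pi2 n)) = nthc (pi1 n) (pi2 (pi2 n))"
        and ?t1.0 = "\<lambda>n. prod_encode (k, prod_encode (prod_encode (0, pi2 n), pi1 n))" and ?t2.0 = "\<lambda>n. n" and ?t3.0 = "\<lambda>n. n"])
      (intro rec_intros; assumption)+
next
  case 2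
  show ?case
    by (rule pi01_lookup[where P = "\<lambda>x y n a b _. 0 < a \<longleftrightarrow> 0 < b"
        and ?t1.0 = "\<lambda>n. prod_encode (k, prod_encode (prod_encode (1, pi2 n), pi1 n))"
        and ?t2.0 = "\<lambda>n. prod_encode (l, prod_encode (nthc (pi1 n) (pi1 (pi2 n)), nthc (pi1 n) (pi2 (pi2 n))))"
        and ?t3.0 = "\<lambda>n. n"])
      (intro rec_intros; assumption)+
next
  case 3
  show ?case
    by (rule pi01_lookup[where P = "\<lambda>x y n a b _. 0 < a \<longleftrightarrow> \<not> 0 < b"
        and ?t1.0 = "\<lambda>n. prod_encode (k, prod_encode (prod_encode (2, pi2 n), pi1 n))"
        and ?t2.0 = "\<lambda>n. prod_encode (k, prod_encode (pi2 n, pi1 n))"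
        and ?t3.0 = "\<lambda>n. n"])
      (intro rec_intros; assumption)+
next
  case 4
  show ?case
    by (rule pi01_lookup[where P = "\<lambda>x y n a b c. 0 < a \<longleftrightarrow> 0 < b \<and> 0 < c"
        and ?t1.0 = "\<lambda>n. prod_encode (k, prod_encode (prod_encode (3, pi2 n), pi1 n))"
        and ?t2.0 = "\<lambda>n. prod_encode (k, prod_encode (pi1 (pi2 n), pi1 n))"
        and ?t3.0 = "\<lambda>n. prod_encode (k, prod_encode (pi2 (pi2 n), pi1 n))"])
      (intro rec_intros; assumption)+
next
  case 5
  show ?case
    by (rule pi01_lookup[where P = "\<lambda>x y n a b _.
          (a = Suc (pi2 (pi1 n)) \<longrightarrow> variant (pi1 (pi1 n)) (pi1 (pi2 n)) (pi2 (pi1 n)) \<and> 0 < b) \<and>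
          (variant (pi1 (pi1 n)) (pi1 (pi2 n)) (pi2 (pi1 n)) \<and> 0 < b \<longrightarrow> 0 < a)"
        and ?t1.0 = "\<lambda>n. prod_encode (k, prod_encode (prod_encode (4, pi2 n), pi1 (pi1 n)))"
        and ?t2.0 = "\<lambda>n. prod_encode (k, prod_encode (pi2 (pi2 n), pi2 (pi1 n)))"
        and ?t3.0 = "\<lambda>n. n"])
      (intro rec_intros dec_variant; assumption)+
qed

lemma pi01_map_ok: "pi01 (\<lambda>x y f. map_ok f)"
  unfolding map_ok_def
proof (rule pi01_conj, goal_cases)
  case 1
  show ?case
    by (rule pi01_lookup[where P = "\<lambda>x y n a _ _. a = 0"
        and ?t1.0 = "\<lambda>n. prod_encode (1, 0)" and ?t2.0 = "\<lambda>n. n" and ?t3.0 = "\<lambda>n. n"])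
      ((intro rec_intros; assumption) | (intro rec_intros))+
next
  case 2
  show ?case
    by (rule pi01_lookup[where P = "\<lambda>x y n a b c. a = consc b c"
        and ?t1.0 = "\<lambda>n. prod_encode (1, consc (pi1 n) (pi2 n))" and ?t2.0 = "\<lambda>n. prod_encode (0, pi1 n)"
        and ?t3.0 = "\<lambda>n. prod_encode (1, pi2 n)"])
      (intro rec_intros; assumption)+
qed

lemma pi01_agree_ok: "pi01 (\<lambda>x y f. agree_ok f)"
  unfolding agree_ok_def
  by (rule pi01_lookup[where P = "\<lambda>x y n a b c. a = pi2 (pi2 n) \<and> pi1 n < lenc (pi1 (pi2 n)) \<longrightarrow> (0 < b \<longleftrightarrow> 0 < c)"
        and ?t1.0 = "\<lambda>n. prod_encode (1, pi1 (pi2 n))" and ?t2.0 = "\<lambda>n. prod_encode (4, prod_encode (pi1 n, pi1 (pi2 n)))"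
        and ?t3.0 = "\<lambda>n. prod_encode (5, prod_encode (pi1 n, pi2 (pi2 n)))"])
      (intro rec_intros; assumption)+

section \<open>From oracles to elementary embeddings and back\<close>

lemma edges_ok_iff:
  assumes "edges_ok k i f"
  shows "0 < f (prod_encode (k, prod_encode (u, v))) \<longleftrightarrow> graphE i u v"
proof
  assume "0 < f (prod_encode (k, prod_encode (u, v)))"
  then show "graphE i u v"
    using conjunct1[OF assms[unfolded edges_ok_def], rule_format, of "prod_encode (u, v)"]
    unfolding graphE_iff_cert by auto
next
  assume "graphE i u v"
  then obtain d where "graph_cert i u v d" unfolding graphE_iff_cert by blast
  then show "0 < f (prod_encode (k, prod_encode (u, v)))"
    using conjunct2[OF assms[unfolded edges_ok_def], rule_format, of "prod_encode (prod_encode (u, v), d)"] by simp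
qed

lemma truth_ok_iff:
  assumes T: "truth_ok k l f" and E: "\<And>u v. 0 < f (prod_encode (l, prod_encode (u, v))) \<longleftrightarrow> E u v"
  shows "0 < f (prod_encode (k, prod_encode (fmenc p, a))) \<longleftrightarrow> lsat E p a"
proof (induction p arbitrary: a)
  case (FEq u v)
  show ?case
    using T[unfolded truth_ok_def, THEN conjunct1, rule_format, of "prod_encode (a, prod_encode (u, v))"] by simp
next
  case (FRel u v)
  show ?case
    using T[unfolded truth_ok_def, THEN conjunct2, THEN conjunct1, rule_format, of "prod_encode (a, prod_encode (u, v))"]
    by (simp add: E)
next
  case (FNeg p)
  then show ?case
    using T[unfolded truth_ok_def, THEN conjunct2, THEN conjunct2, THEN conjunct1, rule_format, of "prod_encode (a, fmenc p)"]
    by simp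
next
  case (FConj p q)
  then show ?case
    using T[unfolded truth_ok_def, THEN conjunct2, THEN conjunct2, THEN conjunct2, THEN conjunct1, rule_format,
        of "prod_encode (a, prod_encode (fmenc p, fmenc q))"]
    by simp
next
  case (FEx v p)
  have ex: "(f (prod_encode (k, prod_encode (fmenc (FEx v p), a))) = Suc b \<longrightarrow> variant a v b \<and> lsat E p b) \<and>
    (variant a v b \<and> lsat E p b \<longrightarrow> 0 < f (prod_encode (k, prod_encode (fmenc (FEx v p), a))))" for b
    using T[unfolded truth_ok_def, THEN conjunct2, THEN conjunct2, THEN conjunct2, THEN conjunct2, THEN spec,
        of "prod_encode (prod_encode (a, b), prod_encode (v, fmenc p))"] FEx
    by simp
  show ?case
  proof
    assume "0 < f (prod_encode (k, prod_encode (fmenc (FEx v p), a)))"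
    then obtain b where "f (prod_encode (k, prod_encode (fmenc (FEx v p), a))) = Suc b"
      by (metis gr0_implies_Suc)
    then show "lsat E (FEx v p) a" using ex[of b] by auto
  next
    assume "lsat E (FEx v p) a"
    then obtain b where "variant a v b" "lsat E p b" by auto
    then show "0 < f (prod_encode (k, prod_encode (fmenc (FEx v p), a)))" using ex[of b] by simp
  qed
qed

text \<open>A true existential formula gets the successor of a chosen witness, as the last clause of
  \<open>truth_ok\<close> demands; other true formulas get 1.\<close>

definition truth_value :: "(nat \<Rightarrow> nat \<Rightarrow> bool) \<Rightarrow> nat \<Rightarrow> nat \<Rightarrow> nat" where
  "truth_value E p a = (if lsat E (fmdec p) a
     then (case fmdec p of FEx v q \<Rightarrow> Suc (SOME b. variant a v b \<and> lsat E q b) | _ \<Rightarrow> 1) else 0)"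

lemma truth_value_pos: "0 < truth_value E p a \<longleftrightarrow> lsat E (fmdec p) a"
  by (simp add: truth_value_def split: fm.split)

lemma truth_value_ok:
  assumes f: "\<And>p a. f (prod_encode (k, prod_encode (p, a))) = truth_value E p a"
    and E: "\<And>u v. 0 < f (prod_encode (l, prod_encode (u, v))) \<longleftrightarrow> E u v"
  shows "truth_ok k l f"
  unfolding truth_ok_def f
proof (intro conjI allI, goal_cases)
  case (5 n)
  show ?case
  proof
    assume "truth_value E (prod_encode (4, pi2 n)) (pi1 (pi1 n)) = Suc (pi2 (pi1 n))"
    then have l: "\<exists>b. variant (pi1 (pi1 n)) (pi1 (pi2 n)) b \<and> lsat E (fmdec (pi2 (pi2 n))) b"
      and b: "pi2 (pi1 n) = (SOME b. variant (pi1 (pi1 n)) (pi1 (pi2 n)) b \<and> lsat E (fmdec (pi2 (pi2 n))) b)"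
      by (auto simp: truth_value_def split: if_splits)
    show "variant (pi1 (pi1 n)) (pi1 (pi2 n)) (pi2 (pi1 n)) \<and> 0 < truth_value E (pi2 (pi2 n)) (pi2 (pi1 n))"
      unfolding truth_value_pos b by (rule someI_ex[OF l])
  qed
next
  case (6 n)
  show ?case unfolding truth_value_pos fmdec_tag lsat.simps by blast
qed (simp_all add: truth_value_pos E)

lemma map_okD:
  assumes "map_ok f"
  shows "f (prod_encode (1, list_encode l)) = list_encode (map (\<lambda>x. f (prod_encode (0, x))) l)"
proof (induction l)
  case Nil
  then show ?case using assms by (simp add: map_ok_def)
next
  case (Cons x l)
  then show ?case
    using assms[unfolded map_ok_def, THEN conjunct2, rule_format, of "prod_encode (x, list_encode l)"]
    by (simp only: pi1_encode pi2_encode consc_encode list.map)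
qed

text \<open>Satisfaction is passed through list codes on both sides: \<open>truth_ok\<close> turns
  it into oracle values, and \<open>agree_ok\<close> links those for a list and its image.\<close>

lemma elem_emb_of_oracle:
  assumes e: "edges_ok 2 i f" "edges_ok 3 j f" and t: "truth_ok 4 2 f" "truth_ok 5 3 f"
    and m: "map_ok f" and ag: "agree_ok f"
  shows "elem_emb (graphE i) (graphE j) (\<lambda>x. f (prod_encode (0, x)))"
  unfolding elem_emb_def
proof (intro allI)
  fix p :: fm and s :: "nat \<Rightarrow> nat"
  let ?h = "\<lambda>x. f (prod_encode (0, x))"
  \<comment> \<open>An initial segment of the assignment longer than the code of \<open>p\<close>
    covers all its variables.\<close>
  define l where "l = map s [0..<Suc (fmenc p)]"
  have vb: "var_bound p \<le> Suc (fmenc p)" using var_bound_fmdec[of "fmenc p"] by simp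
  have l: "lenc (list_encode l) = Suc (fmenc p)" "lenc (list_encode (map ?h l)) = Suc (fmenc p)"
    by (simp_all add: l_def)
  have n: "nthc (list_encode l) v = s v" "nthc (list_encode (map ?h l)) v = ?h (s v)" if "v < Suc (fmenc p)" for v
    using that by (simp_all add: l_def nth0_def del: upt_Suc)
  have "sat (graphE i) s p \<longleftrightarrow> sat (graphE i) (nthc (list_encode l)) p"
    by (rule sat_cong) (use n(1) vb in simp)
  also have "\<dots> \<longleftrightarrow> lsat (graphE i) p (list_encode l)"
    by (rule lsat_iff_sat[symmetric]) (use vb l in simp)
  also have "\<dots> \<longleftrightarrow> 0 < f (prod_encode (4, prod_encode (fmenc p, list_encode l)))"
    by (rule truth_ok_iff[OF t(1) edges_ok_iff[OF e(1)], symmetric])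
  also have "\<dots> \<longleftrightarrow> 0 < f (prod_encode (5, prod_encode (fmenc p, list_encode (map ?h l))))"
    using ag[unfolded agree_ok_def, rule_format,
        of "prod_encode (fmenc p, prod_encode (list_encode l, list_encode (map ?h l)))"] l map_okD[OF m, of l]
    by (simp only: pi1_encode pi2_encode) simp
  also have "\<dots> \<longleftrightarrow> lsat (graphE j) p (list_encode (map ?h l))"
    by (rule truth_ok_iff[OF t(2) edges_ok_iff[OF e(2)]])
  also have "\<dots> \<longleftrightarrow> sat (graphE j) (nthc (list_encode (map ?h l))) p"
    by (rule lsat_iff_sat) (use vb l in simp)
  also have "\<dots> \<longleftrightarrow> sat (graphE j) (?h \<circ> s) p"
    by (rule sat_cong) (use n(2) vb in simp)
  finally show "sat (graphE i) s p \<longleftrightarrow> sat (graphE j) (?h \<circ> s) p" .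
qed

text \<open>The oracle is assembled column by column, choosing certificates for the edges and
  witnesses for the true existential formulas.\<close>

lemma oracle_of_elem_emb:
  assumes h: "elem_emb (graphE i) (graphE j) h"
  shows "\<exists>f. edges_ok 2 i f \<and> edges_ok 3 j f \<and> truth_ok 4 2 f \<and> truth_ok 5 3 f \<and> map_ok f \<and> agree_ok f"
proof -
  define ed where "ed i m = (if graphE i (pi1 m) (pi2 m) then Suc (SOME d. graph_cert i (pi1 m) (pi2 m) d) else 0)" for i m
  define f where "f n = (if pi1 n = 0 then h (pi2 n) else if pi1 n = 1 then list_encode (map h (list_decode (pi2 n)))
    else if pi1 n = 2 then ed i (pi2 n) else if pi1 n = 3 then ed j (pi2 n)
    else truth_value (if pi1 n = 4 then graphE i else graphE j) (pi1 (pi2 n)) (pi2 (pi2 n)))" for n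
  have f0: "f (prod_encode (0, m)) = h m" and f1: "f (prod_encode (1, m)) = list_encode (map h (list_decode m))"
    and f2: "f (prod_encode (2, m)) = ed i m" and f3: "f (prod_encode (3, m)) = ed j m"
    and f4: "f (prod_encode (4, prod_encode (p, a))) = truth_value (graphE i) p a"
    and f5: "f (prod_encode (5, prod_encode (p, a))) = truth_value (graphE j) p a" for m p a
    by (simp_all add: f_def)
  have ed_pos: "0 < ed i m \<longleftrightarrow> graphE i (pi1 m) (pi2 m)" for i m by (simp add: ed_def)
  have ed_cert: "graph_cert i (pi1 m) (pi2 m) (ed i m - 1)" if "0 < ed i m" for i m
    using someI_ex[of "graph_cert i (pi1 m) (pi2 m)"] that graphE_iff_cert[of i "pi1 m" "pi2 m"]
    unfolding ed_pos by (simp add: ed_def)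
  have "edges_ok 2 i f" "edges_ok 3 j f"
    unfolding edges_ok_def f2 f3 using ed_cert ed_pos graphE_iff_cert by auto
  moreover have "truth_ok 4 2 f"
    by (rule truth_value_ok[OF f4]) (simp add: f2 ed_pos)
  moreover have "truth_ok 5 3 f"
    by (rule truth_value_ok[OF f5]) (simp add: f3 ed_pos)
  moreover have "map_ok f"
    unfolding map_ok_def f0 f1
    by (metis consc_encode list.simps(8,9) list_decode.simps(1) list_decode_inverse list_encode.simps(1) list_encode_inverse)
  moreover have "agree_ok f"
    unfolding agree_ok_def f1 f4 f5 truth_value_pos
  proof (intro allI impI, elim conjE)
    fix n
    define p a where "p = fmdec (pi1 n)" and "a = pi1 (pi2 n)"
    assume b: "list_encode (map h (list_decode (pi1 (pi2 n)))) = pi2 (pi2 n)" and "pi1 n < lenc (pi1 (pi2 n))"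
    then have vb: "var_bound p \<le> lenc a"
      using var_bound_fmdec[of "pi1 n"] by (simp add: p_def a_def)
    have len: "lenc (pi2 (pi2 n)) = lenc a" unfolding b[symmetric] a_def by (simp add: lenc_def)
    have "lsat (graphE i) p a \<longleftrightarrow> sat (graphE i) (nthc a) p" by (rule lsat_iff_sat[OF vb])
    also have "\<dots> \<longleftrightarrow> sat (graphE j) (h \<circ> nthc a) p" using h by (simp add: elem_emb_def)
    also have "\<dots> \<longleftrightarrow> sat (graphE j) (nthc (pi2 (pi2 n))) p"
    proof (rule sat_cong)
      fix v assume "v < var_bound p"
      then have "v < lenc a" using vb by simp
      then show "(h \<circ> nthc a) v = nthc (pi2 (pi2 n)) v"
        unfolding b[symmetric] a_def by (simp add: lenc_def nthc_def nth0_def)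
    qed
    also have "\<dots> \<longleftrightarrow> lsat (graphE j) p (pi2 (pi2 n))"
      by (rule lsat_iff_sat[symmetric]) (simp add: len vb)
    finally show "lsat (graphE i) (fmdec (pi1 n)) (pi1 (pi2 n)) \<longleftrightarrow> lsat (graphE j) (fmdec (pi1 n)) (pi2 (pi2 n))"
      unfolding p_def a_def .
  qed
  ultimately show ?thesis by blast
qed

lemma sigma11_EE: "sigma11 EE"
proof (rule sigma11I)
  show "pi01 (\<lambda>x y f. edges_ok 2 (if True then x else y) f \<and> edges_ok 3 (if False then x else y) f \<and>
    truth_ok 4 2 f \<and> truth_ok 5 3 f \<and> map_ok f \<and> agree_ok f)"
    by (intro pi01_conj pi01_edges_ok pi01_truth_ok pi01_map_ok pi01_agree_ok)
  show "EE x y \<longleftrightarrow> (\<exists>f. edges_ok 2 (if True then x else y) f \<and> edges_ok 3 (if False then x else y) f \<and>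
    truth_ok 4 2 f \<and> truth_ok 5 3 f \<and> map_ok f \<and> agree_ok f)" for x y
    unfolding EE_def elem_embeddable_def if_True if_False
    using elem_emb_of_oracle oracle_of_elem_emb by blast
qed

section \<open>Symmetric parts of relations\<close>

definition slice :: "nat \<Rightarrow> nat \<Rightarrow> nat" where
  "slice k s = list_encode (map (\<lambda>i. nthc s (2 * i + k)) [0..<lenc s div 2])"

lemma recfn_slice: "recfn g \<Longrightarrow> recfn (\<lambda>e. slice k (g e))"
proof (rule recfn_comp1[where F = "slice k"])
  let ?P = "\<lambda>s t. lenc t = lenc s div 2 \<and> (\<forall>i<lenc t. nthc t i = nthc s (2 * i + k))"
  have P: "?P s t \<longleftrightarrow> t = slice k s" for s t
  proof
    assume *: "?P s t"
    show "t = slice k s"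
      by (rule code_eqI) (use * in \<open>auto simp: slice_def nth0_def\<close>)
  qed (simp add: slice_def nth0_def)
  have *: "recfn (\<lambda>e. LEAST t. ?P (e 0) t)"
  proof (intro recfn_Least rec_intros)
    show "\<exists>n. ?P (e 0) n" for e unfolding P by blast
  qed
  show "recfn (\<lambda>e. slice k (e 0))"
    by (rule recfn_cong[OF *]) (simp only: P, simp add: Least_equality)
qed

lemma slice_map: "k < 2 \<Longrightarrow> slice k (list_encode (map f [0..<n])) = list_encode (map (\<lambda>i. f (2 * i + k)) [0..<n div 2])"
  unfolding slice_def lenc_encode length_map length_upt diff_zero
  by (intro arg_cong[where f = list_encode] map_cong refl) (auto simp: nth0_def)

text \<open>One oracle carries both witnesses, interleaved on even and odd places.\<close>

lemma sigma11_symmetric_part: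
  assumes "sigma11 R"
  shows "sigma11 (\<lambda>x y. R x y \<and> R y x)"
proof -
  from assms obtain K where K: "dec (\<lambda>e. K (e 0) (e 1) (e 2))"
    and R: "\<And>x y. R x y \<longleftrightarrow> (\<exists>f. \<forall>n. K x y (list_encode (map f [0..<n])))"
    unfolding sigma11_def computable_rel3_iff_dec by blast
  let ?L = "\<lambda>x y s. K x y (slice 0 s) \<and> K y x (slice 1 s)"
  have "dec (\<lambda>e. ?L (e 0) (e 1) (e 2))"
    by (intro rec_intros dec_comp3[OF K] recfn_slice)
  moreover have "R x y \<and> R y x \<longleftrightarrow> (\<exists>f. \<forall>n. ?L x y (list_encode (map f [0..<n])))" for x y
  proof
    assume "R x y \<and> R y x"
    then obtain f g where fg: "\<And>n. K x y (list_encode (map f [0..<n]))" "\<And>n. K y x (list_encode (map g [0..<n]))"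
      using R by metis
    define h where "h n = (if even n then f (n div 2) else g (n div 2))" for n
    have "h (2 * i + 0) = f i" "h (2 * i + 1) = g i" for i by (simp_all add: h_def)
    then have "?L x y (list_encode (map h [0..<n]))" for n
      using fg by (simp only: slice_map)
    then show "\<exists>f. \<forall>n. ?L x y (list_encode (map f [0..<n]))" by blast
  next
    assume "\<exists>f. \<forall>n. ?L x y (list_encode (map f [0..<n]))"
    then obtain h where h: "\<And>n. ?L x y (list_encode (map h [0..<n]))" by blast
    \<comment> \<open>Slices of length \<open>n\<close> come from segments of length
      \<open>2 * n\<close>.\<close>
    have "K x y (list_encode (map (\<lambda>i. h (2 * i + 0)) [0..<n]))" "K y x (list_encode (map (\<lambda>i. h (2 * i + 1)) [0..<n]))" for n
      using h[of "2 * n"] slice_map[of 0 h "2 * n"] slice_map[of 1 h "2 * n"] by simp_all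
    then show "R x y \<and> R y x" unfolding R by blast
  qed
  ultimately show ?thesis
    unfolding sigma11_def computable_rel3_iff_dec by (intro exI[of _ ?L] conjI allI)
qed

section \<open>Completeness for quasi-orders and for equivalence relations\<close>

lemma quasi_order_EE: "quasi_order EE"
proof -
  have "EE i i" for i
    unfolding EE_def elem_embeddable_def elem_emb_def by (rule exI[of _ id]) simp
  moreover have "EE i k" if ij: "EE i j" "EE j k" for i j k
  proof -
    obtain g h where "elem_emb (graphE i) (graphE j) g" "elem_emb (graphE j) (graphE k) h"
      using ij unfolding EE_def elem_embeddable_def by blast
    then have "elem_emb (graphE i) (graphE k) (h \<circ> g)"
      unfolding elem_emb_def by (simp add: comp_assoc)
    then show ?thesis unfolding EE_def elem_embeddable_def by blast
  qed
  ultimately show ?thesis unfolding quasi_order_def by (blast intro: reflpI transpI)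
qed

theorem theorem1p3:
  shows "sigma11 EE \<and> quasi_order EE \<and>
         (\<forall>R. sigma11 R \<and> quasi_order R \<longrightarrow> comp_reducible R EE) \<and>
         sigma11 EBE \<and> equivp EBE \<and>
         (\<forall>R. sigma11 R \<and> equivp R \<longrightarrow> comp_reducible R EBE)"
proof (intro conjI allI impI)
  show "sigma11 EE" by (rule sigma11_EE)
  show qo: "quasi_order EE" by (rule quasi_order_EE)
  show "comp_reducible R EE" if "sigma11 R \<and> quasi_order R" for R
    using sigma11_quasi_order_reduction[of R] that unfolding comp_reducible_def by metis
  have EBE: "EBE = (\<lambda>i j. EE i j \<and> EE j i)" by (intro ext) (rule EBE_def)
  show "sigma11 EBE" unfolding EBE by (rule sigma11_symmetric_part[OF sigma11_EE])
  have "EE i i" "EE i j \<Longrightarrow> EE j k \<Longrightarrow> EE i k" for i j k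
    using qo unfolding quasi_order_def by (blast dest: reflpD transpD)+
  then show "equivp EBE"
    unfolding EBE by (intro equivpI reflpI sympI transpI) blast+
  show "comp_reducible R EBE" if R: "sigma11 R \<and> equivp R" for R
  proof -
    have "quasi_order R" using R unfolding quasi_order_def by (meson equivp_reflp_symp_transp)
    then obtain f where f: "computable f" "\<And>i j. R i j \<longleftrightarrow> EE (f i) (f j)"
      using sigma11_quasi_order_reduction[of R] R by metis
    \<comment> \<open>Symmetry of \<open>R\<close> supplies the second of the two
      embeddings.\<close>
    have "R i j \<longleftrightarrow> EBE (f i) (f j)" for i j
      using f(2) R unfolding EBE_def by (meson equivp_symp)
    then show ?thesis using f(1) unfolding comp_reducible_def by blast
  qed
qed

end
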